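(* A graph is a $2$-vertex extremal minimal bipartite matching covered graph if and only if it is obtained from a Halin tree by isomorphic leaf matching.
   Context: All graphs are finite and loopless; parallel edges are allowed. For a graph $G=(V,E)$ write $n=|V|$ and $m=|E|$. A connected graph on four or more vertices is matching covered if every edge lies in some perfect matching. A matching covered graph is minimal if deleting any single edge yields a graph that is not matching covered. $V_2$ denotes the set of vertices of degree two. A minimal bipartite matching covered graph is $2$-vertex extremal if $|V_2|=2(m-n+2)$. A Halin tree is a tree on at least two vertices with no vertex of degree two, i.e. all of whose non-leaves have degree at least three ($K_2$, both of whose vertices are leaves, is the smallest Halin tree). A graph $H$ is obtained from a tree $T$ (on at least two vertices) by isomorphic leaf matching if, for a disjoint copy $T'$ of $T$ and some fixed isomorphism from $T$ to $T'$, $H$ is obtained from $T\cup T'$ by adding, for each leaf of $T$, one edge joining this leaf to the corresponding leaf of $T'$ under the isomorphism. *)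

theory Defs
  imports Main
begin

(* Multigraphs: edges are named, so parallel edges are distinct edges with the same end set;
   "ends" is only meaningful on the edge set. *)
record ('v, 'e) graph =
  verts :: "'v set"
  edges :: "'e set"
  ends :: "'e \<Rightarrow> 'v set"

(* Every edge has exactly two ends, which excludes loops. *)
definition multigraph :: "('v, 'e) graph \<Rightarrow> bool" where
  "multigraph G \<longleftrightarrow> finite (verts G) \<and> finite (edges G) \<and>
     (\<forall>e\<in>edges G. ends G e \<subseteq> verts G \<and> card (ends G e) = 2)"

definition degree :: "('v, 'e) graph \<Rightarrow> 'v \<Rightarrow> nat" where
  "degree G v = card {e \<in> edges G. v \<in> ends G e}"

definition adjacency :: "('v, 'e) graph \<Rightarrow> ('v \<times> 'v) set" where
  "adjacency G = {(u, v). \<exists>e\<in>edges G. ends G e = {u, v}}"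

definition connected_graph :: "('v, 'e) graph \<Rightarrow> bool" where
  "connected_graph G \<longleftrightarrow> verts G \<noteq> {} \<and> (\<forall>u\<in>verts G. \<forall>v\<in>verts G. (u, v) \<in> (adjacency G)\<^sup>*)"

definition bipartite :: "('v, 'e) graph \<Rightarrow> bool" where
  "bipartite G \<longleftrightarrow> (\<exists>A B. A \<union> B = verts G \<and> A \<inter> B = {} \<and>
     (\<forall>e\<in>edges G. \<exists>a\<in>A. \<exists>b\<in>B. ends G e = {a, b}))"

definition delete_edge :: "('v, 'e) graph \<Rightarrow> 'e \<Rightarrow> ('v, 'e) graph" where
  "delete_edge G e = G\<lparr>edges := edges G - {e}\<rparr>"

definition perfect_matching :: "('v, 'e) graph \<Rightarrow> 'e set \<Rightarrow> bool" where
  "perfect_matching G M \<longleftrightarrow> M \<subseteq> edges G \<and> (\<forall>v\<in>verts G. \<exists>!e. e \<in> M \<and> v \<in> ends G e)"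

definition matching_covered :: "('v, 'e) graph \<Rightarrow> bool" where
  "matching_covered G \<longleftrightarrow> connected_graph G \<and> card (verts G) \<ge> 4 \<and>
     (\<forall>e\<in>edges G. \<exists>M. perfect_matching G M \<and> e \<in> M)"

definition minimal_matching_covered :: "('v, 'e) graph \<Rightarrow> bool" where
  "minimal_matching_covered G \<longleftrightarrow> matching_covered G \<and>
     (\<forall>e\<in>edges G. \<not> matching_covered (delete_edge G e))"

definition minimal_bipartite_matching_covered :: "('v, 'e) graph \<Rightarrow> bool" where
  "minimal_bipartite_matching_covered G \<longleftrightarrow> bipartite G \<and> minimal_matching_covered G"

definition degree_two_verts :: "('v, 'e) graph \<Rightarrow> 'v set" where
  "degree_two_verts G = {v \<in> verts G. degree G v = 2}"

definition two_vertex_extremal :: "('v, 'e) graph \<Rightarrow> bool" where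
  "two_vertex_extremal G \<longleftrightarrow>
     int (card (degree_two_verts G)) = 2 * (int (card (edges G)) - int (card (verts G)) + 2)"

(* A cycle is given by its vertices vs and edges es in cyclic order; a cycle of length two
   consists of two parallel edges. *)
definition is_cycle :: "('v, 'e) graph \<Rightarrow> 'v list \<Rightarrow> 'e list \<Rightarrow> bool" where
  "is_cycle G vs es \<longleftrightarrow> length vs = length es \<and> length es \<ge> 2 \<and>
     distinct vs \<and> distinct es \<and> set vs \<subseteq> verts G \<and> set es \<subseteq> edges G \<and>
     (\<forall>i<length es. ends G (es ! i) = {vs ! i, vs ! (Suc i mod length vs)})"

definition tree :: "('v, 'e) graph \<Rightarrow> bool" where
  "tree T \<longleftrightarrow> multigraph T \<and> connected_graph T \<and> (\<nexists>vs es. is_cycle T vs es)"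

definition leaves :: "('v, 'e) graph \<Rightarrow> 'v set" where
  "leaves T = {v \<in> verts T. degree T v = 1}"

definition halin_tree :: "('v, 'e) graph \<Rightarrow> bool" where
  "halin_tree T \<longleftrightarrow> tree T \<and> card (verts T) \<ge> 2 \<and> (\<forall>v\<in>verts T. degree T v \<noteq> 2)"

definition graph_isomorphism ::
  "('v \<Rightarrow> 'w) \<Rightarrow> ('e \<Rightarrow> 'f) \<Rightarrow> ('v, 'e) graph \<Rightarrow> ('w, 'f) graph \<Rightarrow> bool" where
  "graph_isomorphism f g G H \<longleftrightarrow> bij_betw f (verts G) (verts H) \<and> bij_betw g (edges G) (edges H) \<and>
     (\<forall>e\<in>edges G. ends H (g e) = f ` ends G e)"

(* H is the union of T, the disjoint copy T' and the new edges h v, one for each leaf v of T,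
   joining v to f v. As T ranges over all trees in the types of H, this is the same as H being
   isomorphic to a graph so constructed. *)
definition isomorphic_leaf_matching :: "('v, 'e) graph \<Rightarrow> ('v, 'e) graph \<Rightarrow> bool" where
  "isomorphic_leaf_matching T H \<longleftrightarrow> (\<exists>T' f g h.
     verts T \<inter> verts T' = {} \<and> edges T \<inter> edges T' = {} \<and> graph_isomorphism f g T T' \<and>
     inj_on h (leaves T) \<and> h ` leaves T \<inter> (edges T \<union> edges T') = {} \<and>
     verts H = verts T \<union> verts T' \<and>
     edges H = edges T \<union> edges T' \<union> h ` leaves T \<and>
     (\<forall>e\<in>edges T. ends H e = ends T e) \<and>
     (\<forall>e\<in>edges T'. ends H e = ends T' e) \<and>
     (\<forall>v\<in>leaves T. ends H (h v) = {v, f v}))"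

end

theory Submission
  imports Defs
begin

text \<open>
  A bipartite graph with colour classes \<open>A\<close> and \<open>B\<close> of equal size at least two is matching covered iff
  \<open>\<bar>N(Y)\<bar> > \<bar>Y\<bar>\<close> for all nonempty proper subsets \<open>Y\<close> of \<open>B\<close>. In a minimal such graph every edge \<open>ab\<close> has a
  tight set: \<open>Y\<close> with \<open>b \<in> Y\<close>, \<open>\<bar>N(Y)\<bar> = \<bar>Y\<bar> + 1\<close>, into which \<open>a\<close> sends no edge but \<open>ab\<close>. At a vertex of
  degree at least three, tight sets of different edges have almost disjoint neighbourhoods. Descending along
  maximal tight sets shows that the edges at the vertices of \<open>A\<close> of degree at least three form a
  forest, even together with the edges at one further vertex of \<open>A\<close>. Counting edges gives
  \<open>\<bar>A\<^sub>2\<bar> \<ge> m - n + 2\<close>, and likewise for \<open>B\<close>; extremality means equality on both sides.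

  In the extremal case contracting a vertex of degree two shows that (beyond the 4-cycle) each vertex of degree two has
  exactly one neighbour of degree two. A smallest tight set of an edge joining two vertices of degree at
  least three then exhibits a vertex \<open>b\<close> all of whose neighbours but one have degree two, such that the paths
  of length three leaving \<open>b\<close> through these neighbours all end in the same vertex \<open>p\<close>. Replacing these paths by
  a single edge \<open>bp\<close> yields a smaller extremal graph. Conversely, replacing an edge \<open>bp\<close> between vertices of degree
  two by at least two paths of length three preserves extremality; on a Halin tree and its copy this
  lets a leaf and its image sprout new leaves, and every Halin tree grows from \<open>K\<^sub>2\<close> in this way.
\<close>

section \<open>Tight sets\<close>

text \<open>Deleting one edge lowers \<open>card (nb E Y)\<close> by at most one, so in a minimal
  graph a set that fails once \<open>ab\<close> is gone had surplus exactly one and loses only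
  \<open>a\<close>: tight sets certify that an edge is indispensable. At a vertex of degree three or
  more their neighbourhoods meet only in that vertex, so any one other vertex can be kept out of one
  of them; this is why exactly one exceptional vertex \<open>a0\<close> may join the forest. Its two
  edges are the 2 in \<open>m - n + 2\<close>, as its own vertex cancels the strictness of the
  forest bound. Both classes obey the bound and the extremal count is the sum, so equality holds in
  each. Equality turns the forest with any one \<open>a0\<close> of degree two into a spanning tree,
  so every such \<open>a0\<close> joins the only two components of the forest; this rigidity drives
  the search for a reducible configuration. A tight set in one class determines one in the other, of
  complementary size, and uncrossing produces smaller tight sets now in one class, now in the other;
  a smallest one therefore has to be sought in both classes at once.\<close>

abbreviation nb :: "('a \<times> 'b) set \<Rightarrow> 'b set \<Rightarrow> 'a set" where
  "nb E Y \<equiv> E\<inverse> `` Y"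

abbreviation deg :: "('a \<times> 'b) set \<Rightarrow> 'a \<Rightarrow> nat" where
  "deg E a \<equiv> card (E `` {a})"

abbreviation codeg :: "('a \<times> 'b) set \<Rightarrow> 'b \<Rightarrow> nat" where
  "codeg E b \<equiv> card (nb E {b})"

section \<open>Strict surplus, its symmetry and the existence of tight sets\<close>

text \<open>\<open>E\<close> is a relation and cannot record parallel edges; nothing is lost, since
  a minimal graph has none. As the classes have equal size, \<open>Y = B\<close> can never have
  surplus and is excluded.\<close>

definition elementary :: "'a set \<Rightarrow> 'b set \<Rightarrow> ('a \<times> 'b) set \<Rightarrow> bool" where
  "elementary A B E \<longleftrightarrow> finite A \<and> finite B \<and> card A = card B \<and> 2 \<le> card B \<and> E \<subseteq> A \<times> B \<and>
     (\<forall>Y\<subseteq>B. Y \<noteq> {} \<longrightarrow> Y \<noteq> B \<longrightarrow> card Y < card (nb E Y))"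

definition minimal_elementary :: "'a set \<Rightarrow> 'b set \<Rightarrow> ('a \<times> 'b) set \<Rightarrow> bool" where
  "minimal_elementary A B E \<longleftrightarrow> elementary A B E \<and> (\<forall>e\<in>E. \<not> elementary A B (E - {e}))"

text \<open>The certificate lives in the class of the second end \<open>b\<close>. Certificates in
  the other class come from the same definition read in the converse relation, as
  \<open>tight A (E\<inverse>) b a\<close>.\<close>

definition tight :: "'b set \<Rightarrow> ('a \<times> 'b) set \<Rightarrow> 'a \<Rightarrow> 'b \<Rightarrow> 'b set \<Rightarrow> bool" where
  "tight B E a b Y \<longleftrightarrow> Y \<subseteq> B \<and> b \<in> Y \<and> Y \<noteq> B \<and> E `` {a} \<inter> Y = {b} \<and> card (nb E Y) = Suc (card Y)"

lemma elementaryD: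
  assumes "elementary A B E"
  shows "finite A" "finite B" "card A = card B" "2 \<le> card B" "E \<subseteq> A \<times> B" "finite E"
    "nb E Y \<subseteq> A" "E `` X \<subseteq> B" "finite (nb E Y)" "finite (E `` X)"
proof -
  show *: "finite A" "finite B" "card A = card B" "2 \<le> card B" "E \<subseteq> A \<times> B"
    using assms by (auto simp: elementary_def)
  show "finite E" using * by (meson finite_SigmaI finite_subset)
  show **: "nb E Y \<subseteq> A" "E `` X \<subseteq> B" using * by auto
  show "finite (nb E Y)" "finite (E `` X)" using ** * by (auto intro: finite_subset)
qed

lemma elementary_surplus:
  assumes "elementary A B E" "Y \<subseteq> B" "Y \<noteq> {}" "Y \<noteq> B"
  shows "card Y < card (nb E Y)"
  using assms by (auto simp: elementary_def)

lemma elementary_nb_all: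
  assumes "elementary A B E"
  shows "nb E B = A"
proof -
  note E = elementaryD[OF assms]
  obtain y where y: "y \<in> B" using E(4) by fastforce
  have "B - {y} \<noteq> {}" using E(2,4) y
    by (metis One_nat_def card.empty card_Diff_singleton diff_is_0_eq not_less_eq_eq numeral_2_eq_2)
  then have "card (B - {y}) < card (nb E (B - {y}))"
    using elementary_surplus[OF assms, of "B - {y}"] y by auto
  then have "card A \<le> card (nb E (B - {y}))" using E y by simp
  then have "nb E (B - {y}) = A" using card_seteq[OF E(1) E(7)] by blast
  then show ?thesis using E(7)[of B] by auto
qed

text \<open>A set \<open>X\<close> in \<open>A\<close> is tested through its non-neighbours in
  \<open>B\<close>: none of their neighbours lies in \<open>X\<close>, so their surplus bounds the
  size of \<open>X\<close> from above.\<close>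

lemma elementary_dual:
  assumes "elementary A B E"
  shows "elementary B A (E\<inverse>)"
proof -
  note E = elementaryD[OF assms]
  have "card X < card (E `` X)" if X: "X \<subseteq> A" "X \<noteq> {}" "X \<noteq> A" for X
  proof (cases "E `` X = B")
    case True
    then show ?thesis using X E(1,3) by (metis psubsetI psubset_card_mono)
  next
    case False
    have finX: "finite X" using X E(1) finite_subset by blast
    let ?Y = "B - E `` X"
    have "?Y \<noteq> B"
    proof
      assume "?Y = B"
      then have "E `` X = {}" using E(8)[of X] by blast
      then show False using X elementary_nb_all[OF assms] by blast
    qed
    then have "card ?Y < card (nb E ?Y)"
      using elementary_surplus[OF assms, of ?Y] False E(8)[of X] by blast
    also have "\<dots> \<le> card (A - X)"
      using E(1,7) by (intro card_mono) auto
    also have "\<dots> = card A - card X" using X finX by (simp add: card_Diff_subset)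
    finally have *: "card ?Y < card A - card X" .
    have "card ?Y = card B - card (E `` X)" using E by (simp add: card_Diff_subset)
    then show ?thesis using * E(3) by linarith
  qed
  then show ?thesis using E unfolding elementary_def by auto
qed

lemma elementary_dual_iff: "elementary B A (E\<inverse>) \<longleftrightarrow> elementary A B E"
  using elementary_dual[of A B E] elementary_dual[of B A "E\<inverse>"] by auto

lemma minimal_elementary_dual:
  assumes "minimal_elementary A B E"
  shows "minimal_elementary B A (E\<inverse>)"
proof -
  have "\<not> elementary B A (E\<inverse> - {e})" if "e \<in> E\<inverse>" for e
  proof -
    obtain b a where "e = (b, a)" by fastforce
    then have ab: "e = (b, a)" "(a, b) \<in> E" using that by auto
    have "E\<inverse> - {e} = (E - {(a, b)})\<inverse>" using ab by auto
    then show ?thesis using assms ab elementary_dual_iff[of B A "E - {(a, b)}"]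
      unfolding minimal_elementary_def by simp
  qed
  then show ?thesis using assms elementary_dual_iff[of B A E] unfolding minimal_elementary_def by blast
qed

lemma elementary_degree:
  assumes "elementary A B E"
  shows "a \<in> A \<Longrightarrow> 2 \<le> deg E a" and "b \<in> B \<Longrightarrow> 2 \<le> codeg E b"
proof -
  have *: "2 \<le> codeg E b" if el: "elementary A B E" and b: "b \<in> B"
    for A :: "'c set" and B :: "'d set" and E b
  proof -
    have "{b} \<noteq> B" using elementaryD(4)[OF el] by auto
    then show ?thesis using elementary_surplus[OF el, of "{b}"] b by simp
  qed
  show "b \<in> B \<Longrightarrow> 2 \<le> codeg E b" using *[OF assms] .
  show "a \<in> A \<Longrightarrow> 2 \<le> deg E a" using *[OF elementary_dual[OF assms], of a] by simp
qed

lemma ex_other_nbr: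
  assumes "2 \<le> card S" shows "\<exists>y\<in>S. y \<noteq> x"
proof (rule ccontr)
  assume "\<not> ?thesis"
  then have "S \<subseteq> {x}" by auto
  then have "card S \<le> card {x}" by (intro card_mono) auto
  then show False using assms by simp
qed

lemma minimal_imp_tight:
  assumes m: "minimal_elementary A B E" and e: "(a, b) \<in> E"
  shows "\<exists>Y. tight B E a b Y"
proof -
  have el: "elementary A B E" and "\<not> elementary A B (E - {(a, b)})"
    using assms by (auto simp: minimal_elementary_def)
  note E = elementaryD[OF el]
  let ?F = "E - {(a, b)}"
  have "?F \<subseteq> A \<times> B" using E(5) by auto
  then obtain Y where Y: "Y \<subseteq> B" "Y \<noteq> {}" "Y \<noteq> B" "\<not> card Y < card (nb ?F Y)"
    using \<open>\<not> elementary A B ?F\<close> E(1-4) unfolding elementary_def by blast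
  have s: "card Y < card (nb E Y)" using elementary_surplus[OF el] Y by blast
  have ne: "nb E Y \<noteq> nb ?F Y" using s Y by auto
  have sub: "nb E Y \<subseteq> insert a (nb ?F Y)" by auto
  have ab: "b \<in> Y" "a \<in> nb E Y" "a \<notin> nb ?F Y" using ne sub by auto
  have fin: "finite (nb ?F Y)" by (rule finite_subset[OF _ E(9)[of Y]]) auto
  have "nb E Y = insert a (nb ?F Y)" using sub ab by auto
  then have "card (nb E Y) = Suc (card (nb ?F Y))" using fin ab by simp
  then have "card (nb E Y) = Suc (card Y)" using s Y by simp
  moreover have "E `` {a} \<inter> Y = {b}" using ab e by auto
  ultimately show ?thesis using Y ab unfolding tight_def by blast
qed

lemma tightD:
  assumes "elementary A B E" "tight B E a b Y"
  shows "(a, b) \<in> E" "a \<in> nb E Y" "finite Y" "a \<in> A" "b \<in> B" "card (nb E Y - {a}) = card Y"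
proof -
  show *: "(a, b) \<in> E" "a \<in> nb E Y" using assms by (auto simp: tight_def)
  show "finite Y" "a \<in> A" "b \<in> B"
    using assms * elementaryD(2,5)[OF assms(1)] by (auto simp: tight_def intro: finite_subset)
  show "card (nb E Y - {a}) = card Y"
    using assms * by (simp add: tight_def)
qed

text \<open>The only edge between \<open>X\<close> and \<open>Y\<close> is \<open>ab\<close>. So the
  neighbours of \<open>X\<close> lie in \<open>insert b (B - Y)\<close>, which has just one element
  more than \<open>X\<close>, and surplus forces equality. As the two sizes add up to
  \<open>card A\<close>, enlarging one of the sets shrinks the other.\<close>

lemma elementary_tight_dual:
  assumes el: "elementary A B E" and t: "tight B E a b Y"
  defines "X \<equiv> A - (nb E Y - {a})"
  shows "tight A (E\<inverse>) b a X" "E `` X = insert b (B - Y)" "card X + card Y = card A"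
proof -
  note E = elementaryD[OF el] and T = tightD[OF el t]
  have sub: "E `` X \<subseteq> insert b (B - Y)" using t E(5) unfolding X_def tight_def by auto
  have YB: "Y \<subseteq> B" "b \<in> Y" "Y \<noteq> B" using t by (auto simp: tight_def)
  have cX: "card X = card A - card Y"
  proof -
    have "nb E Y - {a} \<subseteq> A" "finite (nb E Y - {a})" using E(7)[of Y] E(9)[of Y] by auto
    then show ?thesis unfolding X_def using T(6) by (simp add: card_Diff_subset)
  qed
  have le: "card Y \<le> card A" using YB E by (metis card_mono)
  show cc: "card X + card Y = card A" using cX le by simp
  have cB: "card (insert b (B - Y)) = Suc (card X)"
    using YB E T cX by (simp add: card_Diff_subset)
  have XA: "X \<subseteq> A" "X \<noteq> A" "X \<noteq> {}"
  proof -
    show "X \<subseteq> A" unfolding X_def by auto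
    have "card Y > 0" using YB T by (auto simp: card_gt_0_iff)
    then show "X \<noteq> A" using cc by auto
    have "a \<in> X" using T unfolding X_def by auto
    then show "X \<noteq> {}" by auto
  qed
  have "card X < card (E `` X)"
    using elementary_surplus[OF elementary_dual[OF el] XA(1,3,2)] by simp
  then show eq: "E `` X = insert b (B - Y)"
    using sub cB E(2) by (metis Suc_leI card_seteq finite.insertI finite_Diff)
  have "nb E {b} \<inter> X = {a}" using T YB unfolding X_def by auto
  then show "tight A (E\<inverse>) b a X"
    using XA eq cB T unfolding tight_def X_def by auto
qed

section \<open>Uncrossing of tight sets\<close>

text \<open>Neighbourhood size is submodular. The surpluses of \<open>Y\<close> and \<open>Z\<close>
  add up to two, while intersection and union have surplus at least one each, so both have exactly
  one.\<close>

lemma tight_inter_card: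
  assumes el: "elementary A B E" and t: "tight B E a b Y"
    and Z: "Z \<subseteq> B" "card (nb E Z) = Suc (card Z)" and un: "Y \<union> Z \<noteq> B"
    and ne: "Y \<inter> Z \<noteq> {}"
  shows "card (nb E (Y \<inter> Z)) = Suc (card (Y \<inter> Z))"
proof -
  note E = elementaryD[OF el] and T = tightD[OF el t]
  have YB: "Y \<subseteq> B" "b \<in> Y" "Y \<noteq> B" "card (nb E Y) = Suc (card Y)" using t by (auto simp: tight_def)
  have fZ: "finite Z" using Z E(2) finite_subset by blast
  have 1: "card (Y \<inter> Z) < card (nb E (Y \<inter> Z))"
    using elementary_surplus[OF el, of "Y \<inter> Z"] YB ne by auto
  have 2: "card (nb E (Y \<inter> Z)) \<le> card (nb E Y \<inter> nb E Z)"
    using E(9) by (intro card_mono) auto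
  have 3: "card (Y \<union> Z) < card (nb E (Y \<union> Z))"
    using elementary_surplus[OF el, of "Y \<union> Z"] YB Z un by auto
  have "nb E (Y \<union> Z) = nb E Y \<union> nb E Z" by auto
  then show ?thesis
    using 1 2 3 card_Un_Int[OF E(9)[of Y] E(9)[of Z]] card_Un_Int[OF T(3) fZ] YB(4) Z(2) by simp
qed

text \<open>The same submodular count, but \<open>Y\<close> and \<open>Z\<close> may be disjoint as
  long as their neighbourhoods meet. A neighbour of \<open>a\<close> other than \<open>b\<close>
  lies in neither set, which keeps the union proper.\<close>

lemma tight_union:
  assumes el: "elementary A B E" and t: "tight B E a b Y"
    and Z: "Z \<subseteq> B" "card (nb E Z) = Suc (card Z)" and az: "E `` {a} \<inter> Z \<subseteq> {b}"
    and ne: "nb E Y \<inter> nb E Z \<noteq> {}"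
  shows "tight B E a b (Y \<union> Z)"
proof -
  note E = elementaryD[OF el] and T = tightD[OF el t]
  have YB: "Y \<subseteq> B" "b \<in> Y" "Y \<noteq> B" "card (nb E Y) = Suc (card Y)" "E `` {a} \<inter> Y = {b}"
    using t by (auto simp: tight_def)
  have fZ: "finite Z" using Z E(2) finite_subset by blast
  obtain c where c: "c \<in> E `` {a}" "c \<noteq> b" using ex_other_nbr[OF elementary_degree(1)[OF el T(4)]] by blast
  have un: "Y \<union> Z \<noteq> B" using c az YB(5) E(8)[of "{a}"] by auto
  have "card (Y \<inter> Z) < card (nb E Y \<inter> nb E Z)"
  proof (cases "Y \<inter> Z = {}")
    case True
    then show ?thesis using ne E(9) by (simp add: card_gt_0_iff)
  next
    case False
    have "card (Y \<inter> Z) < card (nb E (Y \<inter> Z))"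
      using elementary_surplus[OF el, of "Y \<inter> Z"] YB False by auto
    also have "\<dots> \<le> card (nb E Y \<inter> nb E Z)"
      using E(9) by (intro card_mono) auto
    finally show ?thesis .
  qed
  moreover have "card (Y \<union> Z) < card (nb E (Y \<union> Z))"
    using elementary_surplus[OF el, of "Y \<union> Z"] YB Z un by auto
  moreover have "nb E (Y \<union> Z) = nb E Y \<union> nb E Z" by auto
  ultimately have "card (nb E (Y \<union> Z)) = Suc (card (Y \<union> Z))"
    using card_Un_Int[OF E(9)[of Y] E(9)[of Z]] card_Un_Int[OF T(3) fZ] YB(4) Z(2) by simp
  then show ?thesis using YB Z un az unfolding tight_def by auto
qed

text \<open>Without \<open>a\<close> the two neighbourhoods have exactly the sizes of
  \<open>Y\<close> and \<open>Z\<close>, and \<open>a\<close> has no neighbour in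
  \<open>Y \<inter> Z\<close>. A further common element would leave \<open>Y \<union> Z\<close>
  without surplus, so the union would be \<open>B\<close> and \<open>a\<close> would have no
  neighbours but \<open>b\<close> and \<open>c\<close>.\<close>

lemma tight_disjoint:
  assumes el: "elementary A B E" and d: "3 \<le> deg E a"
    and t: "tight B E a b Y" "tight B E a c Z" and bc: "b \<noteq> c"
  shows "nb E Y \<inter> nb E Z = {a}"
proof -
  note E = elementaryD[OF el] and T = tightD[OF el t(1)] and S = tightD[OF el t(2)]
  have Y: "Y \<subseteq> B" "b \<in> Y" "Y \<noteq> B" "E `` {a} \<inter> Y = {b}" using t(1) by (auto simp: tight_def)
  have Z: "Z \<subseteq> B" "c \<in> Z" "Z \<noteq> B" "E `` {a} \<inter> Z = {c}" using t(2) by (auto simp: tight_def)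
  let ?W = "nb E Y - {a}" and ?V = "nb E Z - {a}"
  have a: "a \<notin> nb E (Y \<inter> Z)" using Y Z bc by auto
  have sub: "nb E (Y \<inter> Z) \<subseteq> ?W \<inter> ?V" using a by auto
  have disj: "?W \<inter> ?V = {}"
  proof (rule ccontr)
    assume ne: "?W \<inter> ?V \<noteq> {}"
    have lt: "card (Y \<inter> Z) < card (?W \<inter> ?V)"
    proof (cases "Y \<inter> Z = {}")
      case True
      have "finite (?W \<inter> ?V)" using E(9) by auto
      then have "0 < card (?W \<inter> ?V)" using ne by (simp only: card_gt_0_iff) simp
      then show ?thesis using True by simp
    next
      case False
      have "card (Y \<inter> Z) < card (nb E (Y \<inter> Z))"
        using elementary_surplus[OF el, of "Y \<inter> Z"] Y False by auto
      also have "\<dots> \<le> card (?W \<inter> ?V)"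
        using E(9) sub by (intro card_mono) auto
      finally show ?thesis .
    qed
    have "nb E (Y \<union> Z) = insert a (?W \<union> ?V)" using T(2) by auto
    then have "card (nb E (Y \<union> Z)) = Suc (card (?W \<union> ?V))" using E(9) by simp
    moreover have "card ?W + card ?V = card (?W \<union> ?V) + card (?W \<inter> ?V)"
      using E(9) by (intro card_Un_Int) auto
    ultimately have "card (nb E (Y \<union> Z)) \<le> card (Y \<union> Z)"
      using lt card_Un_Int[OF T(3) S(3)] T(6) S(6) by linarith
    then have "Y \<union> Z = B"
      using elementary_surplus[OF el, of "Y \<union> Z"] Y Z by (metis Un_empty Un_subset_iff empty_iff leD)
    then have "E `` {a} \<subseteq> {b, c}" using Y Z E(8)[of "{a}"] by blast
    then have "deg E a \<le> card {b, c}" by (intro card_mono) auto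
    then show False using d bc by simp
  qed
  show "nb E Y \<inter> nb E Z = {a}" using disj T(2) S(2) by auto
qed

section \<open>Maximal tight sets and the descent between them\<close>

definition max_tight :: "'b set \<Rightarrow> ('a \<times> 'b) set \<Rightarrow> 'a \<Rightarrow> 'b \<Rightarrow> 'b set" where
  "max_tight B E a b = \<Union>{Y. tight B E a b Y}"

lemma tight_subset_max: "tight B E a b Y \<Longrightarrow> Y \<subseteq> max_tight B E a b"
  by (auto simp: max_tight_def)

text \<open>All tight sets of the edge have \<open>a\<close> in their neighbourhoods, so they can be
  united one after the other.\<close>

lemma tight_max_tight:
  assumes m: "minimal_elementary A B E" and e: "(a, b) \<in> E"
  shows "tight B E a b (max_tight B E a b)"
proof -
  have el: "elementary A B E" using m by (simp add: minimal_elementary_def)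
  let ?T = "{Y. tight B E a b Y}"
  have sub: "?T \<subseteq> Pow B" by (auto simp: tight_def)
  have fin: "finite ?T" using finite_subset[OF sub] elementaryD(2)[OF el] by simp
  have ne: "?T \<noteq> {}" using minimal_imp_tight[OF m e] by blast
  have "tight B E a b (\<Union>S)" if "finite S" "S \<noteq> {}" "S \<subseteq> ?T" for S
    using that
  proof (induction rule: finite_ne_induct)
    case (insert Y S)
    then have 1: "tight B E a b Y" "tight B E a b (\<Union>S)" by auto
    have "tight B E a b (Y \<union> \<Union>S)"
    proof (rule tight_union[OF el 1(1)])
      show "nb E Y \<inter> nb E (\<Union>S) \<noteq> {}" using tightD(2)[OF el 1(1)] tightD(2)[OF el 1(2)] by blast
    qed (use 1(2) in \<open>auto simp: tight_def\<close>)
    then show ?case by simp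
  qed simp
  from this[OF fin ne] show ?thesis by (simp add: max_tight_def)
qed

text \<open>The descent step: a maximal tight set contains one of the maximal tight sets at any two edges
  of another vertex of degree at least three that it meets.\<close>
lemma max_tight_descent:
  assumes m: "minimal_elementary A B E" and e: "(a, b) \<in> E"
    and d: "3 \<le> deg E a'" and aa: "a' \<noteq> a"
    and h: "(a', c) \<in> E" "c \<in> max_tight B E a b" and g: "(a', d) \<in> E" "d \<noteq> c"
  shows "\<exists>x\<in>{c, d}. max_tight B E a' x \<subset> max_tight B E a b \<and> a \<notin> nb E (max_tight B E a' x)"
proof -
  have el: "elementary A B E" using m by (simp add: minimal_elementary_def)
  let ?M = "max_tight B E"
  note tm = tight_max_tight[OF m]
  \<comment> \<open>At most one of the two neighbourhoods contains \<open>a\<close>. A set whose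
    neighbourhood avoids \<open>a\<close> can be united with the maximal tight set of
    \<open>ab\<close>, hence is already contained in it.\<close>
  have "nb E (?M a' c) \<inter> nb E (?M a' d) = {a'}"
    using tight_disjoint[OF el d tm[OF h(1)] tm[OF g(1)]] g(2) by auto
  then have "a \<notin> nb E (?M a' c) \<or> a \<notin> nb E (?M a' d)" using aa by (metis IntI singletonD)
  then obtain x where x: "x \<in> {c, d}" "a \<notin> nb E (?M a' x)" by blast
  then have t: "tight B E a' x (?M a' x)" using tm h g by blast
  have "tight B E a b (?M a b \<union> ?M a' x)"
  proof (rule tight_union[OF el tm[OF e]])
    show "nb E (?M a b) \<inter> nb E (?M a' x) \<noteq> {}" using h tightD(2)[OF el t] by blast
  qed (use t x in \<open>auto simp: tight_def\<close>)
  then have "?M a' x \<subseteq> ?M a b" using tight_subset_max by (metis Un_subset_iff)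
  moreover have "a \<in> nb E (?M a b)" using tightD(2)[OF el tm[OF e]] .
  ultimately show ?thesis using x by blast
qed

section \<open>The lower bound on vertices of degree two\<close>

text \<open>The edge set of a graph of minimum degree two: at each of its ends an edge meets another
  one. That no subset is a core expresses acyclicity without speaking of walks.\<close>

definition cyclic_core :: "('a \<times> 'b) set \<Rightarrow> bool" where
  "cyclic_core C \<longleftrightarrow> C \<noteq> {} \<and> (\<forall>(a, b)\<in>C. (\<exists>b'. b' \<noteq> b \<and> (a, b') \<in> C) \<and> (\<exists>a'. a' \<noteq> a \<and> (a', b) \<in> C))"

text \<open>Among the edges of \<open>C\<close> whose maximal tight set has no neighbour \<open>a0\<close>, one with a smallest such set
  contradicts the descent step. The exceptional vertex \<open>a0\<close> yields the second component in the count below.\<close>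
lemma no_cyclic_core:
  assumes m: "minimal_elementary A B E" and CE: "C \<subseteq> E"
    and deg: "\<And>a b. (a, b) \<in> C \<Longrightarrow> a \<noteq> a0 \<Longrightarrow> 3 \<le> deg E a"
  shows "\<not> cyclic_core C"
proof
  assume "cyclic_core C"
  then have ne: "C \<noteq> {}" and c1: "\<And>a b. (a, b) \<in> C \<Longrightarrow> \<exists>b'. b' \<noteq> b \<and> (a, b') \<in> C"
    and c2: "\<And>a b. (a, b) \<in> C \<Longrightarrow> \<exists>a'. a' \<noteq> a \<and> (a', b) \<in> C"
    unfolding cyclic_core_def by blast+
  have el: "elementary A B E" using m by (simp add: minimal_elementary_def)
  let ?M = "max_tight B E"
  note tm = tight_max_tight[OF m]
  let ?P = "\<lambda>(a, b). (a, b) \<in> C \<and> a \<noteq> a0 \<and> a0 \<notin> nb E (?M a b)"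
  obtain a b where ab: "(a, b) \<in> C" "a \<noteq> a0"
    using ne c2 by (metis ex_in_conv surj_pair)
  obtain b' where b': "b' \<noteq> b" "(a, b') \<in> C" using c1[OF ab(1)] by blast
  have "nb E (?M a b) \<inter> nb E (?M a b') = {a}"
    using tight_disjoint[OF el deg[OF ab] tm tm] ab(1) b' CE by (metis subsetD)
  then have "a0 \<notin> nb E (?M a b) \<or> a0 \<notin> nb E (?M a b')" using ab(2) by (metis IntI singletonD)
  then have "\<exists>p. ?P p" using ab b' by blast
  then obtain p0 where "?P p0" by blast
  then obtain p where p: "?P p" and pmin: "\<And>q. ?P q \<Longrightarrow> card (case_prod ?M p) \<le> card (case_prod ?M q)"
    using ex_has_least_nat[of ?P p0 "\<lambda>q. card (case_prod ?M q)"] by blast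
  obtain u v where uv: "p = (u, v)" by (cases p)
  then have u: "(u, v) \<in> C" "u \<noteq> a0" "a0 \<notin> nb E (?M u v)" using p by auto
  obtain w where w: "w \<noteq> u" "(w, v) \<in> C" using c2[OF u(1)] by blast
  have vM: "v \<in> ?M u v" "?M u v \<subseteq> B" using tm u(1) CE by (auto simp: tight_def)
  \<comment> \<open>\<open>w\<close> is adjacent to \<open>v\<close> and so lies in a neighbourhood
    that avoids \<open>a0\<close>: the descent never runs into the exceptional vertex.\<close>
  have w0: "w \<noteq> a0" using u(3) vM w CE by auto
  obtain d where d: "d \<noteq> v" "(w, d) \<in> C" using c1[OF w(2)] by blast
  obtain x where x: "x \<in> {v, d}" "?M w x \<subset> ?M u v"
    using max_tight_descent[OF m, of u v w v d] u w vM d CE deg[OF w(2) w0] by blast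
  have "?P (w, x)" using x w w0 d u(3) by auto
  then have "card (?M u v) \<le> card (?M w x)" using pmin uv by fastforce
  moreover have "card (?M w x) < card (?M u v)"
    using x vM(2) elementaryD(2)[OF el] by (meson finite_subset psubset_card_mono)
  ultimately show False by simp
qed

text \<open>The forest bound. An edge set that is not a core contains an edge that is alone at one
  of its ends; removing the edge together with that end lowers both sides by one. Strictness comes
  from the edgeless case, in which a vertex remains.\<close>

lemma card_no_cyclic_core:
  assumes "finite A" "finite B" "C \<subseteq> A \<times> B" "A \<noteq> {} \<or> B \<noteq> {}"
    and "\<And>C'. C' \<subseteq> C \<Longrightarrow> \<not> cyclic_core C'"
  shows "card C < card A + card B"
  using assms
proof (induction "card A + card B" arbitrary: A B C rule: less_induct)
  case less
  note fin = less.prems(1,2) and CAB = less.prems(3)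
  have fC: "finite C" using fin CAB by (meson finite_SigmaI finite_subset)
  show ?case
  proof (cases "C = {}")
    case True
    then show ?thesis using fin less.prems(4) by (auto simp: card_gt_0_iff)
  next
    case False
    then obtain a b where ab: "(a, b) \<in> C"
      and nc: "(\<forall>b'. b' \<noteq> b \<longrightarrow> (a, b') \<notin> C) \<or> (\<forall>a'. a' \<noteq> a \<longrightarrow> (a', b) \<notin> C)"
      using less.prems(5)[of C] unfolding cyclic_core_def by blast
    have abAB: "a \<in> A" "b \<in> B" using ab CAB by auto
    then have pos: "0 < card A" "0 < card B" using fin by (auto simp: card_gt_0_iff)
    have cC: "card C = Suc (card (C - {(a, b)}))" using card.remove[OF fC ab] .
    have nc': "\<not> cyclic_core C'" if "C' \<subseteq> C - {(a, b)}" for C' using less.prems(5) that by blast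
    from nc show ?thesis
    proof
      assume "\<forall>b'. b' \<noteq> b \<longrightarrow> (a, b') \<notin> C"
      then have "C - {(a, b)} \<subseteq> (A - {a}) \<times> B" using CAB by auto
      then have "card (C - {(a, b)}) < card (A - {a}) + card B"
        using less.hyps[of "A - {a}" B "C - {(a, b)}"] fin abAB pos nc' by auto
      then show ?thesis using cC abAB fin pos by simp
    next
      assume "\<forall>a'. a' \<noteq> a \<longrightarrow> (a', b) \<notin> C"
      then have "C - {(a, b)} \<subseteq> A \<times> (B - {b})" using CAB by auto
      then have "card (C - {(a, b)}) < card A + card (B - {b})"
        using less.hyps[of A "B - {b}" "C - {(a, b)}"] fin abAB pos nc' by auto
      then show ?thesis using cC abAB fin pos by simp
    qed
  qed
qed

section \<open>Counting edges by the degrees in one class\<close>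

definition deg2 :: "'a set \<Rightarrow> ('a \<times> 'b) set \<Rightarrow> 'a set" where
  "deg2 A E = {a \<in> A. deg E a = 2}"

lemma card_restrict_fst:
  assumes "finite X" "finite E"
  shows "card (E \<inter> X \<times> UNIV) = (\<Sum>a\<in>X. deg E a)"
proof -
  have "E \<inter> X \<times> UNIV = Sigma X (\<lambda>a. E `` {a})" by auto
  moreover have "finite (E `` {a})" for a
    using assms(2) by (rule finite_Image)
  ultimately show ?thesis using assms by simp
qed

lemma card_edges_split:
  assumes el: "elementary A B E"
  shows "card E = card (E \<inter> (A - deg2 A E) \<times> UNIV) + 2 * card (deg2 A E)"
    and "deg2 A E \<subseteq> A" and "card A = card (A - deg2 A E) + card (deg2 A E)"
    and "\<And>X. X \<subseteq> A - deg2 A E \<Longrightarrow> 3 * card X \<le> card (E \<inter> X \<times> UNIV)"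
    and "\<And>a. a \<in> A - deg2 A E \<Longrightarrow> 3 \<le> deg E a"
proof -
  note E = elementaryD[OF el]
  show sub: "deg2 A E \<subseteq> A" by (auto simp: deg2_def)
  have fd: "finite (deg2 A E)" using sub E(1) finite_subset by blast
  have "E = E \<inter> (A - deg2 A E) \<times> UNIV \<union> E \<inter> deg2 A E \<times> UNIV" using E(5) by auto
  then have "card E = card (E \<inter> (A - deg2 A E) \<times> UNIV) + card (E \<inter> deg2 A E \<times> UNIV)"
    using E(6) card_Un_disjoint[of "E \<inter> (A - deg2 A E) \<times> UNIV" "E \<inter> deg2 A E \<times> UNIV"] by auto
  moreover have "card (E \<inter> deg2 A E \<times> UNIV) = 2 * card (deg2 A E)"
    using card_restrict_fst[OF fd E(6)] by (simp add: deg2_def)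
  ultimately show "card E = card (E \<inter> (A - deg2 A E) \<times> UNIV) + 2 * card (deg2 A E)" by simp
  show "card A = card (A - deg2 A E) + card (deg2 A E)"
    using card_Diff_subset[OF fd sub] card_mono[OF E(1) sub] by simp
  show deg: "3 \<le> deg E a" if "a \<in> A - deg2 A E" for a
    using elementary_degree(1)[OF el, of a] that by (auto simp: deg2_def)
  show "3 * card X \<le> card (E \<inter> X \<times> UNIV)" if X: "X \<subseteq> A - deg2 A E" for X
  proof -
    have "finite X" using X E(1) finite_subset by blast
    then have "card (E \<inter> X \<times> UNIV) = (\<Sum>a\<in>X. deg E a)" using card_restrict_fst E(6) by blast
    also have "\<dots> \<ge> (\<Sum>a\<in>X. 3)" using deg X by (intro sum_mono) auto
    finally show ?thesis by simp
  qed
qed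

text \<open>The forest at \<open>a0\<close> and at the vertices of degree at least three splits into
  a piece over \<open>D\<close> containing \<open>a0\<close> and a piece over \<open>B - D\<close>.
  A piece with a vertex has strictly fewer edges than vertices. The 3 stands for the two edges at
  \<open>a0\<close> and the strictness of the first piece; a proper \<open>D\<close> gains one more
  from the second.\<close>

lemma card_two_components:
  assumes m: "minimal_elementary A B E" and a0: "a0 \<in> deg2 A E"
    and D: "D \<subseteq> B" "D \<noteq> {}" "E `` {a0} \<subseteq> D"
    and cl: "\<And>a. a \<in> A - deg2 A E \<Longrightarrow> E `` {a} \<subseteq> D \<or> E `` {a} \<inter> D = {}"
  shows "card (E \<inter> (A - deg2 A E) \<times> UNIV) + 3 + (if D = B then 0 else 1) \<le> Suc (card (A - deg2 A E)) + card B"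
proof -
  have el: "elementary A B E" using m by (simp add: minimal_elementary_def)
  note E = elementaryD[OF el] and S = card_edges_split[OF el]
  let ?A3 = "A - deg2 A E"
  have nc: "\<not> cyclic_core C'" if "C' \<subseteq> E \<inter> (insert a0 ?A3) \<times> UNIV" for C'
    using no_cyclic_core[OF m, of C' a0] that S(5) by blast
  let ?AD = "{a \<in> ?A3. E `` {a} \<subseteq> D}"
  let ?AC = "?A3 - ?AD"
  let ?C1 = "E \<inter> insert a0 ?AD \<times> UNIV" and ?C2 = "E \<inter> ?AC \<times> UNIV"
  have fin: "finite ?AD" "finite ?AC" "finite D" using E(1,2) D(1) by (auto intro: finite_subset)
  have a03: "a0 \<notin> ?A3" "deg E a0 = 2" using a0 by (auto simp: deg2_def)
  have "?C1 \<subseteq> insert a0 ?AD \<times> D" using D by auto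
  moreover have "\<not> cyclic_core C'" if "C' \<subseteq> ?C1" for C' using nc[of C'] that by blast
  ultimately have 1: "card ?C1 < card (insert a0 ?AD) + card D"
    using card_no_cyclic_core[of "insert a0 ?AD" D ?C1] fin by auto
  have 2: "card ?C2 + (if D = B then 0 else 1) \<le> card ?AC + card (B - D)"
  proof (cases "D = B")
    case True
    then have AC: "?AC = {}" using E(8) by auto
    show ?thesis unfolding AC using True by simp
  next
    case False
    have "?C2 \<subseteq> ?AC \<times> (B - D)" using cl E(5) by blast
    moreover have "\<not> cyclic_core C'" if "C' \<subseteq> ?C2" for C' using nc[of C'] that by blast
    moreover have "B - D \<noteq> {}" using False D by auto
    ultimately have "card ?C2 < card ?AC + card (B - D)"
      using card_no_cyclic_core[of ?AC "B - D" ?C2] fin E(2) by auto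
    then show ?thesis using False by simp
  qed
  have c1: "card ?C1 = 2 + card (E \<inter> ?AD \<times> UNIV)"
    using card_restrict_fst[OF _ E(6), of "insert a0 ?AD"] card_restrict_fst[OF fin(1) E(6)] fin a03 by auto
  have "E \<inter> ?A3 \<times> UNIV = (E \<inter> ?AD \<times> UNIV) \<union> ?C2" by auto
  then have c2: "card (E \<inter> ?A3 \<times> UNIV) = card (E \<inter> ?AD \<times> UNIV) + card ?C2"
    using E(6) card_Un_disjoint[of "E \<inter> ?AD \<times> UNIV" ?C2] by auto
  have c3: "card ?A3 = card ?AD + card ?AC"
  proof -
    have "?AD \<subseteq> ?A3" by auto
    then show ?thesis using card_Diff_subset[OF fin(1), of ?A3] card_mono[of ?A3 ?AD] E(1) by simp
  qed
  have c4: "card B = card D + card (B - D)"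
    using card_Diff_subset[OF fin(3) D(1)] card_mono[OF E(2) D(1)] by simp
  have c5: "card (insert a0 ?AD) = Suc (card ?AD)" using fin a03 by auto
  show ?thesis using 1 2 c1 c2 c3 c4 c5 by linarith
qed

text \<open>With a vertex \<open>a0\<close> of degree two, this is the forest bound for
  \<open>D = B\<close>. Without one, all of \<open>E\<close> would be a forest and yet have at least
  \<open>3 * card A\<close> edges.\<close>

lemma minimal_elementary_bound:
  assumes m: "minimal_elementary A B E"
  shows "card E + 2 \<le> 2 * card A + card (deg2 A E)"
proof -
  have el: "elementary A B E" using m by (simp add: minimal_elementary_def)
  note E = elementaryD[OF el] and S = card_edges_split[OF el]
  show ?thesis
  proof (cases "deg2 A E = {}")
    case True
    have "\<not> cyclic_core C'" if "C' \<subseteq> E" for C'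
      using no_cyclic_core[OF m that] S(5) True that E(5) by blast
    moreover have "B \<noteq> {}" using E(4) by auto
    ultimately have "card E < card A + card B"
      using card_no_cyclic_core[of A B E] E by auto
    moreover have "3 * card A \<le> card (E \<inter> A \<times> UNIV)" using S(4)[of A] True by simp
    moreover have "E \<inter> A \<times> UNIV = E" using E(5) by auto
    ultimately show ?thesis using E(3,4) by simp
  next
    case False
    then obtain a0 where "a0 \<in> deg2 A E" by blast
    then have "card (E \<inter> (A - deg2 A E) \<times> UNIV) + 3 \<le> Suc (card (A - deg2 A E)) + card B"
      using card_two_components[OF m, of a0 B] E(8) E(4) by force
    then show ?thesis using S(1,3) E(3) by linarith
  qed
qed

section \<open>Extremal graphs\<close>

text \<open>As \<open>n = 2 * card A\<close>, each equation says that the class has exactly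
  \<open>m - n + 2\<close> vertices of degree two, the least possible number.\<close>

definition extremal :: "'a set \<Rightarrow> 'b set \<Rightarrow> ('a \<times> 'b) set \<Rightarrow> bool" where
  "extremal A B E \<longleftrightarrow> minimal_elementary A B E \<and>
     card E + 2 = 2 * card A + card (deg2 A E) \<and> card E + 2 = 2 * card B + card (deg2 B (E\<inverse>))"

lemma extremal_minimal: "extremal A B E \<Longrightarrow> minimal_elementary A B E"
  by (simp add: extremal_def)

lemma extremal_elementary: "extremal A B E \<Longrightarrow> elementary A B E"
  by (simp add: extremal_def minimal_elementary_def)

lemma extremal_dual: "extremal A B E \<Longrightarrow> extremal B A (E\<inverse>)"
  unfolding extremal_def using minimal_elementary_dual by (auto simp: card_inverse)

text \<open>Equality leaves no room for a second component in the forest with \<open>a0\<close>. So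
  a proper union of components of the forest without \<open>a0\<close> cannot contain all neighbours
  of \<open>a0\<close>; this is applied to the complement of \<open>D\<close>.\<close>

lemma extremal_closed:
  assumes ex: "extremal A B E" and a0: "a0 \<in> deg2 A E"
    and D: "D \<subseteq> B" "D \<noteq> {}" "D \<noteq> B"
    and cl: "\<And>a. a \<in> A - deg2 A E \<Longrightarrow> E `` {a} \<subseteq> D \<or> E `` {a} \<inter> D = {}"
  shows "E `` {a0} \<inter> D \<noteq> {}"
proof -
  note m = extremal_minimal[OF ex] and el = extremal_elementary[OF ex]
  note E = elementaryD[OF el] and S = card_edges_split[OF el]
  have *: "\<not> E `` {a0} \<subseteq> D'" if "D' \<subseteq> B" "D' \<noteq> {}" "D' \<noteq> B"
    "\<And>a. a \<in> A - deg2 A E \<Longrightarrow> E `` {a} \<subseteq> D' \<or> E `` {a} \<inter> D' = {}" for D'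
  proof
    assume "E `` {a0} \<subseteq> D'"
    from card_two_components[OF m a0 that(1,2) this that(4)] that(3)
    have "card (E \<inter> (A - deg2 A E) \<times> UNIV) + 4 \<le> Suc (card (A - deg2 A E)) + card B" by simp
    then show False using ex S(1,3) E(3) unfolding extremal_def by linarith
  qed
  have "\<not> E `` {a0} \<subseteq> B - D"
  proof (rule *)
    show "E `` {a} \<subseteq> B - D \<or> E `` {a} \<inter> (B - D) = {}" if "a \<in> A - deg2 A E" for a
      using cl[OF that] E(8)[of "{a}"] by auto
  qed (use D in auto)
  then show "E `` {a0} \<inter> D \<noteq> {}" using E(8)[of "{a0}"] by auto
qed

section \<open>Contraction of a vertex of degree two\<close>

definition merge :: "'a \<Rightarrow> 'a \<Rightarrow> 'a \<Rightarrow> 'a" where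
  "merge a1 a2 x = (if x = a2 then a1 else x)"

definition contract :: "'a \<Rightarrow> 'a \<Rightarrow> 'b \<Rightarrow> ('a \<times> 'b) set \<Rightarrow> ('a \<times> 'b) set" where
  "contract a1 a2 \<beta> F = (\<lambda>(x, y). (merge a1 a2 x, y)) ` {(x, y) \<in> F. y \<noteq> \<beta>}"

lemma nb_contract: "\<beta> \<notin> Y \<Longrightarrow> nb (contract a1 a2 \<beta> F) Y = merge a1 a2 ` nb F Y"
  unfolding contract_def by force

text \<open>An edge that can be deleted from the contraction lifts to one that can be deleted from
  \<open>E\<close>. The delicate set in the lift is \<open>B - {\<beta>}\<close>: it would fail if
  \<open>a1\<close> or \<open>a2\<close> kept \<open>\<beta>\<close> as its only neighbour. Equal
  kinds of degrees at \<open>a1\<close> and \<open>a2\<close> exclude this.\<close>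

lemma contract_minimal:
  assumes m: "minimal_elementary A B E" and k: "3 \<le> card B"
    and nb: "nb E {\<beta>} = {a1, a2}" "a1 \<noteq> a2"
    and deg: "3 \<le> deg E a1 \<and> 3 \<le> deg E a2 \<or> deg E a1 = 2 \<and> deg E a2 = 2"
  defines "E' \<equiv> contract a1 a2 \<beta> E"
  shows "minimal_elementary (A - {a2}) (B - {\<beta>}) E'" "card E' + 2 = card E"
    "y \<in> B - {\<beta>} \<Longrightarrow> codeg E' y = codeg E y"
proof -
  have el: "elementary A B E" using m by (simp add: minimal_elementary_def)
  note E = elementaryD[OF el]
  let ?A = "A - {a2}" and ?B = "B - {\<beta>}" and ?p = "merge a1 a2" and ?c = "contract a1 a2 \<beta>"
  have e1: "(a1, \<beta>) \<in> E" "(a2, \<beta>) \<in> E" using nb by auto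
  then have aA: "a1 \<in> A" "a2 \<in> A" "\<beta> \<in> B" using E(5) by auto
  \<comment> \<open>A second common neighbour would turn into a parallel edge. It closes a 4-cycle,
    which is a core if both degrees are at least three; if both are two, \<open>{a1, a2}\<close> has
    only two neighbours and lacks surplus.\<close>
  have common: "y = \<beta>" if y: "(a1, y) \<in> E" "(a2, y) \<in> E" for y
  proof (rule ccontr)
    assume yb: "y \<noteq> \<beta>"
    from deg show False
    proof
      assume d: "3 \<le> deg E a1 \<and> 3 \<le> deg E a2"
      let ?C = "{(a1, \<beta>), (a2, \<beta>), (a1, y), (a2, y)}"
      have "\<not> cyclic_core ?C" using no_cyclic_core[OF m, of ?C] e1 y d by auto
      then show False using yb nb(2) unfolding cyclic_core_def by auto
    next
      assume d: "deg E a1 = 2 \<and> deg E a2 = 2"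
      have "{\<beta>, y} \<subseteq> E `` {a1}" "{\<beta>, y} \<subseteq> E `` {a2}" "card {\<beta>, y} = 2" using e1 y yb by auto
      then have "E `` {a1} = {\<beta>, y}" "E `` {a2} = {\<beta>, y}"
        using d E(10)[of "{a1}"] E(10)[of "{a2}"] by (metis card_subset_eq)+
      then have img: "E `` {a1, a2} = {\<beta>, y}" by blast
      have "{a1, a2} \<noteq> A" using k E(3) nb(2) by auto
      then have "card {a1, a2} < card (E `` {a1, a2})"
        using elementary_surplus[OF elementary_dual[OF el], of "{a1, a2}"] aA by simp
      then show False using img yb nb(2) by simp
    qed
  qed
  have pin: "inj_on ?p S" if "\<not> (a1 \<in> S \<and> a2 \<in> S)" for S
    using that by (auto simp: inj_on_def merge_def)
  have fin: "finite (nb F Y)" if "F \<subseteq> E" for F Y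
    using Image_mono[of "F\<inverse>" "E\<inverse>" Y Y] that finite_subset[OF _ E(9)[of Y]] by (simp add: converse_mono)
  have cA: "card ?A = card ?B" "2 \<le> card ?B" "finite ?A" "finite ?B" using E k aA by auto
  have sub: "?c F \<subseteq> ?A \<times> ?B" if "F \<subseteq> E" for F
  proof -
    have "F \<subseteq> A \<times> B" using that E(5) by blast
    then show ?thesis using aA nb(2) unfolding contract_def merge_def by (auto split: if_splits)
  qed
  have el': "elementary ?A ?B (?c E)"
  proof -
    have "card Y < card (nb (?c E) Y)" if Y: "Y \<subseteq> ?B" "Y \<noteq> {}" "Y \<noteq> ?B" for Y
    proof -
      have n: "nb (?c E) Y = ?p ` nb E Y" by (rule nb_contract) (use Y in blast)
      show ?thesis
      proof (cases "a1 \<in> nb E Y \<and> a2 \<in> nb E Y")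
        \<comment> \<open>Adding \<open>\<beta>\<close> to \<open>Y\<close> does not enlarge the
          neighbourhood, so \<open>Y\<close> has surplus at least two, and merging costs only
          one.\<close>
        case True
        then have "nb E {\<beta>} \<union> nb E Y = nb E Y" unfolding nb(1) by blast
        then have "nb E (insert \<beta> Y) = nb E Y" by (metis Image_Un insert_is_Un)
        moreover have "insert \<beta> Y \<subseteq> B" "insert \<beta> Y \<noteq> B" using Y aA by auto
        ultimately have "card (insert \<beta> Y) < card (nb E Y)"
          using elementary_surplus[OF el, of "insert \<beta> Y"] by simp
        moreover have "card (insert \<beta> Y) = Suc (card Y)"
          using Y E(2) by (subst card_insert_disjoint) (auto intro: finite_subset)
        moreover have "?p ` nb E Y = nb E Y - {a2}"
          using True nb(2) unfolding merge_def by (auto simp: image_iff)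
        ultimately show ?thesis using True fin[of E Y] n by simp
      next
        case False
        then have "card (?p ` nb E Y) = card (nb E Y)" by (intro card_image pin)
        moreover have "Y \<subseteq> B" "Y \<noteq> B" using Y aA by auto
        ultimately show ?thesis using elementary_surplus[OF el, of Y] Y n by simp
      qed
    qed
    then show ?thesis using cA sub[of E] unfolding elementary_def by auto
  qed
  have inj: "inj_on (\<lambda>(x, y). (?p x, y)) {(x, y) \<in> E. y \<noteq> \<beta>}"
    using common unfolding inj_on_def merge_def by (auto split: if_splits)
  show "card E' + 2 = card E"
  proof -
    have "card E' = card {(x, y) \<in> E. y \<noteq> \<beta>}" unfolding E'_def contract_def using inj by (rule card_image)
    moreover have "E = {(x, y) \<in> E. y \<noteq> \<beta>} \<union> {(a1, \<beta>), (a2, \<beta>)}" using nb by auto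
    moreover have "card ({(x, y) \<in> E. y \<noteq> \<beta>} \<union> {(a1, \<beta>), (a2, \<beta>)}) = card {(x, y) \<in> E. y \<noteq> \<beta>} + card {(a1, \<beta>), (a2, \<beta>)}"
      using E(6) by (intro card_Un_disjoint) (auto intro: finite_subset)
    ultimately show ?thesis using nb(2) by simp
  qed
  show "codeg E' y = codeg E y" if "y \<in> ?B"
  proof -
    have "nb E' {y} = ?p ` nb E {y}" unfolding E'_def by (rule nb_contract) (use that in blast)
    then show ?thesis using card_image[OF pin[of "nb E {y}"]] common that by auto
  qed
  have "\<not> elementary ?A ?B (?c E - {e'})" if e': "e' \<in> ?c E" for e'
  proof
    assume bad: "elementary ?A ?B (?c E - {e'})"
    obtain u v where uv: "(u, v) \<in> E" "v \<noteq> \<beta>" "e' = (?p u, v)"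
      using e' unfolding contract_def by auto
    let ?F = "E - {(u, v)}"
    have "?c E - {e'} = ?c ?F"
    proof -
      have "?c E - {(\<lambda>(x, y). (?p x, y)) (u, v)} = (\<lambda>(x, y). (?p x, y)) ` ({(x, y) \<in> E. y \<noteq> \<beta>} - {(u, v)})"
        unfolding contract_def using inj_on_image_set_diff[OF inj, of "{(x, y) \<in> E. y \<noteq> \<beta>}" "{(u, v)}"] uv by auto
      moreover have "{(x, y) \<in> E. y \<noteq> \<beta>} - {(u, v)} = {(x, y) \<in> ?F. y \<noteq> \<beta>}" by auto
      ultimately show ?thesis using uv(3) by (simp add: contract_def)
    qed
    then have bad': "elementary ?A ?B (?c ?F)" using bad by simp
    have nbF: "nb (?c ?F) Y = ?p ` nb ?F Y" if "\<beta> \<notin> Y" for Y using that by (rule nb_contract)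
    have nbb: "nb ?F {\<beta>} = {a1, a2}" using nb uv by auto
    have finF: "finite (nb ?F Y)" for Y using fin by blast
    have "card Y < card (nb ?F Y)" if Y: "Y \<subseteq> B" "Y \<noteq> {}" "Y \<noteq> B" for Y
    proof (cases "\<beta> \<in> Y")
      case True
      let ?Y = "Y - {\<beta>}"
      have cY: "card Y = Suc (card ?Y)" using card.remove[OF _ True] Y E(2) finite_subset by blast
      show ?thesis
      proof (cases "?Y = {}")
        case e: True
        then have "Y = {\<beta>}" using True by auto
        then show ?thesis using nbb nb(2) by simp
      next
        case False
        have "card ?Y < card (nb (?c ?F) ?Y)"
          using elementary_surplus[OF bad', of ?Y] False Y True by auto
        also have "nb (?c ?F) ?Y = ?p ` nb ?F ?Y" by (rule nbF) simp
        also have "card \<dots> \<le> card (nb ?F Y - {a2})"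
        proof (rule card_mono)
          have "a1 \<in> nb ?F Y" using nbb True by blast
          then show "?p ` nb ?F ?Y \<subseteq> nb ?F Y - {a2}" using nb(2) unfolding merge_def by auto
        qed (use finF in auto)
        finally have "card ?Y < card (nb ?F Y - {a2})" .
        moreover have "a2 \<in> nb ?F Y" using nbb True by blast
        ultimately show ?thesis unfolding cY card.remove[OF finF[of Y] \<open>a2 \<in> nb ?F Y\<close>] by simp
      qed
    next
      case False
      show ?thesis
      proof (cases "Y = ?B")
        case Y': True
        have all: "?p ` nb ?F ?B = ?A" using elementary_nb_all[OF bad'] nbF[of ?B] by simp
        \<comment> \<open>If deleting \<open>(u, v)\<close> left \<open>x\<close> with no neighbour
          but \<open>\<beta>\<close>, then \<open>x\<close> had degree two, and so did the other of
          \<open>a1\<close> and \<open>a2\<close>. The merged vertex would then keep a single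
          neighbour.\<close>
        have ends: "x \<in> nb ?F ?B" if x: "x \<in> {a1, a2}" for x
        proof (rule ccontr)
          assume no: "x \<notin> nb ?F ?B"
          then have sub1: "E `` {x} \<subseteq> {\<beta>, v}" using E(8)[of "{x}"] by auto
          then have "deg E x \<le> card {\<beta>, v}" by (intro card_mono) auto
          then have "deg E x \<le> 2" using card_2_iff[of "{\<beta>, v}"] uv by auto
          then have d: "deg E a1 = 2 \<and> deg E a2 = 2" using deg x by auto
          obtain x' where x': "{x, x'} = {a1, a2}" using x by auto
          have "?c ?F `` {a1} \<subseteq> E `` {x'} - {\<beta>}"
          proof
            fix y assume "y \<in> ?c ?F `` {a1}"
            then have "\<exists>z. (z, y) \<in> ?F \<and> y \<noteq> \<beta> \<and> ?p z = a1" unfolding contract_def by fastforce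
            then obtain z where z: "(z, y) \<in> ?F" "y \<noteq> \<beta>" "?p z = a1" by blast
            then have "z \<in> {a1, a2}" unfolding merge_def by (auto split: if_splits)
            moreover have "z \<noteq> x" using no z E(5) by auto
            ultimately have "z = x'" using x' by blast
            then show "y \<in> E `` {x'} - {\<beta>}" using z by auto
          qed
          then have "card (?c ?F `` {a1}) \<le> card (E `` {x'} - {\<beta>})"
            using E(10) by (intro card_mono) auto
          also have "\<dots> = 1"
          proof -
            have "x' \<in> {a1, a2}" using x' by blast
            then show ?thesis using d e1 E(10)[of "{x'}"] by auto
          qed
          finally have "card (?c ?F `` {a1}) \<le> 1" .
          then show False using elementary_degree(1)[OF bad', of a1] aA nb(2) by auto
        qed
        have "A \<subseteq> nb ?F ?B"
        proof
          fix x assume x: "x \<in> A"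
          show "x \<in> nb ?F ?B"
          proof (cases "x \<in> {a1, a2}")
            case True then show ?thesis using ends by blast
          next
            case False
            then have "x \<in> ?p ` nb ?F ?B" using x all by auto
            then obtain z where "z \<in> nb ?F ?B" "x = ?p z" by blast
            then show ?thesis using False unfolding merge_def by (auto split: if_splits)
          qed
        qed
        then have "card A \<le> card (nb ?F ?B)" by (intro card_mono finF)
        then show ?thesis using Y' E(2,3) aA(3) k by auto
      next
        case Y': False
        have "card Y < card (nb (?c ?F) Y)"
          using elementary_surplus[OF bad', of Y] Y Y' False by blast
        also have "\<dots> = card (?p ` nb ?F Y)" using nbF False by simp
        also have "\<dots> \<le> card (nb ?F Y)" by (intro card_image_le finF)
        finally show ?thesis .
      qed
    qed
    then have "elementary A B ?F" using E unfolding elementary_def by auto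
    then show False using m uv(1) by (auto simp: minimal_elementary_def)
  qed
  then show "minimal_elementary ?A ?B E'" using el' unfolding minimal_elementary_def E'_def by blast
qed

text \<open>Otherwise contracting \<open>\<beta>\<close> would give a minimal graph violating the lower bound for \<open>B\<close>.\<close>
lemma extremal_deg2_nb:
  assumes ex: "extremal A B E" and k: "3 \<le> card B" and b: "\<beta> \<in> deg2 B (E\<inverse>)"
  shows "\<exists>a1 a2. nb E {\<beta>} = {a1, a2} \<and> a1 \<noteq> a2 \<and> deg E a1 = 2 \<and> 3 \<le> deg E a2"
proof -
  note m = extremal_minimal[OF ex] and el = extremal_elementary[OF ex]
  note E = elementaryD[OF el]
  have bB: "\<beta> \<in> B" "codeg E (\<beta>) = 2" using b by (auto simp: deg2_def)
  then obtain a1 a2 where nb: "nb E {\<beta>} = {a1, a2}" "a1 \<noteq> a2" by (meson card_2_iff)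
  have aA: "a1 \<in> A" "a2 \<in> A" using nb E(7)[of "{\<beta>}"] by auto
  then have ge: "2 \<le> deg E a1" "2 \<le> deg E a2" using elementary_degree(1)[OF el] by auto
  have "\<not> (3 \<le> deg E a1 \<and> 3 \<le> deg E a2 \<or> deg E a1 = 2 \<and> deg E a2 = 2)"
  proof
    assume deg: "3 \<le> deg E a1 \<and> 3 \<le> deg E a2 \<or> deg E a1 = 2 \<and> deg E a2 = 2"
    let ?E = "contract a1 a2 \<beta> E" and ?B = "B - {\<beta>}"
    note C = contract_minimal[OF m k nb deg]
    \<comment> \<open>Contraction lowers the left side of the bound by two, the edges lost. The
      right side drops by three: two for the vertex lost from \<open>B\<close>, one for its degree
      being two. Equality before thus becomes a violation.\<close>
    have "deg2 ?B (?E\<inverse>) = deg2 B (E\<inverse>) - {\<beta>}"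
      using C(3) by (auto simp: deg2_def)
    moreover have "card (?E\<inverse>) + 2 \<le> 2 * card ?B + card (deg2 ?B (?E\<inverse>))"
      using minimal_elementary_bound[OF minimal_elementary_dual[OF C(1)]] .
    moreover have "finite (deg2 B (E\<inverse>))" using E(2) by (auto simp: deg2_def)
    then have "card (deg2 B (E\<inverse>) - {\<beta>}) + 1 = card (deg2 B (E\<inverse>))"
      using b by (metis Suc_eq_plus1 card.remove)
    moreover have "card ?B + 1 = card B" using bB E(2) k by simp
    ultimately show False using ex C(2) unfolding extremal_def by (simp add: card_inverse)
  qed
  then consider "deg E a1 = 2" "3 \<le> deg E a2" | "deg E a2 = 2" "3 \<le> deg E a1"
    using ge by linarith
  then show ?thesis
  proof cases
    case 1 then show ?thesis using nb by blast
  next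
    case 2 then show ?thesis using nb by (metis insert_commute)
  qed
qed

section \<open>Bundles of paths of length three\<close>

text \<open>The paths \<open>b, l, m l, p\<close> for \<open>l \<in> L\<close> have inner vertices
  of degree two, and \<open>a\<close> is the one further neighbour of \<open>b\<close>. In a doubled
  Halin tree this occurs at a vertex \<open>b\<close> of degree at least three whose neighbours
  except \<open>a\<close> are leaves; \<open>p\<close> is then the copy of \<open>b\<close>, and
  \<open>m\<close> is the leaf matching.\<close>

definition cherry :: "('a \<times> 'b) set \<Rightarrow> 'b \<Rightarrow> 'a \<Rightarrow> 'a set \<Rightarrow> 'a \<Rightarrow> ('a \<Rightarrow> 'b) \<Rightarrow> bool" where
  "cherry E b a L p m \<longleftrightarrow> nb E {b} = insert a L \<and> a \<notin> L \<and> 2 \<le> card L \<and> p \<noteq> a \<and> p \<notin> L \<and>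
     (\<forall>l\<in>L. E `` {l} = {b, m l} \<and> m l \<noteq> b \<and> nb E {m l} = {l, p})"

text \<open>A vertex of degree two has exactly one neighbour of degree two. For \<open>l\<close>
  this is the neighbour other than \<open>b\<close>; for that neighbour it is \<open>l\<close>
  again, so the path ends in a vertex of degree at least three.\<close>

lemma extremal_deg2_path:
  assumes ex: "extremal A B E" and k: "3 \<le> card B"
    and l: "(l, b) \<in> E" "deg E l = 2" "3 \<le> codeg E b"
  shows "\<exists>l' p. E `` {l} = {b, l'} \<and> l' \<noteq> b \<and> nb E {l'} = {l, p} \<and> l \<noteq> p \<and> 3 \<le> deg E p"
proof -
  have el: "elementary A B E" using ex by (rule extremal_elementary)
  note E = elementaryD[OF el]
  have lA: "l \<in> deg2 A E" "b \<in> B" using l E(5) by (auto simp: deg2_def)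
  obtain b1 b2 where b12: "E `` {l} = {b1, b2}" "b1 \<noteq> b2" "codeg E b1 = 2" "3 \<le> codeg E b2"
    using extremal_deg2_nb[OF extremal_dual[OF ex], of l] k E(3) lA by auto
  have "b \<in> {b1, b2}" using l(1) b12(1) by blast
  then have bb: "b = b2" using b12 l by auto
  have "b1 \<in> B" using b12 E(8)[of "{l}"] by auto
  then have "b1 \<in> deg2 B (E\<inverse>)" using b12 by (auto simp: deg2_def)
  then obtain a1 a2 where a12: "nb E {b1} = {a1, a2}" "a1 \<noteq> a2" "deg E a1 = 2" "3 \<le> deg E a2"
    using extremal_deg2_nb[OF ex k] by blast
  have "b1 \<in> E `` {l}" using b12 by auto
  then have "l \<in> nb E {b1}" by auto
  then have "l \<in> {a1, a2}" using a12(1) by simp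
  then have "l = a1" using a12 l by auto
  moreover have "E `` {l} = {b, b1}" "b1 \<noteq> b" using b12 bb by auto
  ultimately show ?thesis using a12 by blast
qed

text \<open>Uncrossing against the smallest tight set \<open>Y\<close> shows that \<open>Y\<close> consists of \<open>b\<close>, of vertices of degree two, and of
  vertices of degree at least three with exactly one neighbour of degree at least three. Counting \<open>N(Y)\<close>
  then leaves room for only one common end \<open>p\<close>.\<close>
lemma minimal_tight_cherry:
  assumes ex: "extremal A B E" and k: "3 \<le> card B"
    and dab: "3 \<le> deg E a" "3 \<le> codeg E b"
    and t: "tight B E a b Y"
    and minB: "\<And>a' b' Z. 3 \<le> deg E a' \<Longrightarrow> 3 \<le> codeg E b' \<Longrightarrow> tight B E a' b' Z \<Longrightarrow> card Y \<le> card Z"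
    and minA: "\<And>a' b' P. 3 \<le> deg E a' \<Longrightarrow> 3 \<le> codeg E b' \<Longrightarrow> tight A (E\<inverse>) b' a' P \<Longrightarrow> card Y \<le> card P"
  shows "\<exists>L p m. cherry E b a L p m"
proof -
  note m = extremal_minimal[OF ex] and el = extremal_elementary[OF ex]
  note E = elementaryD[OF el] and T = tightD[OF el t]
  note el' = elementary_dual[OF el] and m' = minimal_elementary_dual[OF m]
  have Y: "Y \<subseteq> B" "b \<in> Y" "Y \<noteq> B" "E `` {a} \<inter> Y = {b}" "card (nb E Y) = Suc (card Y)"
    using t by (auto simp: tight_def)
  define W where "W = nb E Y - {a}"
  define X where "X = A - W"
  have tX: "tight A (E\<inverse>) b a X" and EX: "E `` X = insert b (B - Y)" and cX: "card X + card Y = card A"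
    using elementary_tight_dual[OF el t] unfolding X_def W_def by auto
  have cW: "card W = card Y" using T(6) unfolding W_def .
  have finW: "finite W" using E(9) unfolding W_def by simp
  have onlyb: "y = b" if "(a, y) \<in> E" "y \<in> Y" for y using that Y(4) by blast
  have inW: "x \<in> W" if "(x, y) \<in> E" "y \<in> Y" "x \<noteq> a" for x y using that unfolding W_def by auto
  have deg: "2 \<le> deg E x" "2 \<le> codeg E y" if "(x, y) \<in> E" for x y
    using elementary_degree[OF el] that E(5) by auto
  \<comment> \<open>A tight set in \<open>A\<close> with all its neighbours in \<open>Y\<close> is
    smaller than \<open>Y\<close>, against \<open>minA\<close>.\<close>
  have img_sub: "card P < card Y" if P: "tight A (E\<inverse>) y x P" and s: "E `` P \<subseteq> Y" for x y P
  proof -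
    have "card (E `` P) = Suc (card P)" using P by (simp add: tight_def)
    then show ?thesis using card_mono[OF T(3) s] by simp
  qed
  \<comment> \<open>At \<open>b\<close> the neighbourhoods of \<open>P\<close> and \<open>X\<close>
    share only \<open>b\<close>, so all neighbours of \<open>P\<close> lie in
    \<open>Y\<close>.\<close>
  have M1: "deg E x = 2" if x: "(x, b) \<in> E" "x \<noteq> a" for x
  proof (rule ccontr)
    assume "deg E x \<noteq> 2"
    then have d: "3 \<le> deg E x" using deg(1)[OF x(1)] by simp
    obtain P where P: "tight A (E\<inverse>) b x P" using minimal_imp_tight[OF m', of b x] x by auto
    have "nb (E\<inverse>) P \<inter> nb (E\<inverse>) X = {b}" using tight_disjoint[OF el' _ P tX x(2)] dab by simp
    then have "E `` P \<inter> insert b (B - Y) = {b}" using EX by simp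
    then have b_only: "y = b" if "y \<in> E `` P" "y \<in> insert b (B - Y)" for y
      using that by (metis IntI singletonD)
    have "E `` P \<subseteq> Y"
    proof
      fix y assume "y \<in> E `` P"
      then show "y \<in> Y" using b_only[of y] E(8)[of P] Y(2) by blast
    qed
    then show False using img_sub[OF P] minA[OF d dab(2) P] by simp
  qed
  \<comment> \<open>By uncrossing, \<open>Y \<inter> Z\<close> is again tight for \<open>wx\<close>,
    and \<open>minB\<close> prevents it from being smaller than \<open>Y\<close>.\<close>
  have inter: "Y \<subseteq> Z" if Z: "tight B E w x Z" "x \<in> Y" "3 \<le> deg E w" "3 \<le> codeg E x" "Y \<union> Z \<noteq> B"
    for w x Z
  proof -
    have Z': "Z \<subseteq> B" "card (nb E Z) = Suc (card Z)" "x \<in> Z" "E `` {w} \<inter> Z = {x}"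
      using Z(1) by (auto simp: tight_def)
    have "card (nb E (Y \<inter> Z)) = Suc (card (Y \<inter> Z))"
      using tight_inter_card[OF el t Z'(1,2) Z(5)] Z(2) Z'(3) by blast
    then have "tight B E w x (Y \<inter> Z)" using Z' Z(2) Y unfolding tight_def by auto
    then have "card Y \<le> card (Y \<inter> Z)" using minB Z(3,4) by blast
    then have "Y \<inter> Z = Y" using T(3) by (metis card_seteq inf_le1)
    then show ?thesis by blast
  qed
  \<comment> \<open>The witness outside both sets is a neighbour of \<open>a\<close> other than
    \<open>b\<close>.\<close>
  have un: "Y \<union> Z \<noteq> B" if "a \<notin> nb E Z" for Z
  proof -
    obtain y where "(a, y) \<in> E" "y \<noteq> b" using ex_other_nbr[OF deg(1)[OF T(1)], of b] by auto
    moreover have "y \<in> B" using calculation E(5) by auto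
    moreover have "y \<notin> Y" "y \<notin> Z" using calculation onlyb that by auto
    ultimately show ?thesis by blast
  qed
  \<comment> \<open>One of the tight sets of \<open>wc\<close> and \<open>wd\<close> has a
    neighbourhood avoiding \<open>a\<close>. It then includes \<open>Y\<close> and with it both
    \<open>c\<close> and \<open>d\<close>, but a tight set at \<open>w\<close> contains just one
    neighbour of \<open>w\<close>.\<close>
  have M2: "c = d" if w: "(w, c) \<in> E" "(w, d) \<in> E" "w \<noteq> a" "c \<in> Y" "d \<in> Y" "3 \<le> deg E w"
    "3 \<le> codeg E c" "3 \<le> codeg E d" for w c d
  proof (rule ccontr)
    assume ne: "c \<noteq> d"
    obtain Z1 where Z1: "tight B E w c Z1" using minimal_imp_tight[OF m w(1)] by blast
    obtain Z2 where Z2: "tight B E w d Z2" using minimal_imp_tight[OF m w(2)] by blast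
    have "nb E Z1 \<inter> nb E Z2 = {w}" using tight_disjoint[OF el w(6) Z1 Z2 ne] .
    then have "a \<notin> nb E Z1 \<or> a \<notin> nb E Z2" using w(3) by (metis IntI singletonD)
    then have "Y \<subseteq> Z1 \<or> Y \<subseteq> Z2" using inter[OF Z1] inter[OF Z2] un w by metis
    then have "d \<in> Z1 \<or> c \<in> Z2" using w(4,5) by blast
    moreover have "E `` {w} \<inter> Z1 = {c}" "E `` {w} \<inter> Z2 = {d}" using Z1 Z2 by (auto simp: tight_def)
    moreover have "c \<in> E `` {w}" "d \<in> E `` {w}" using w(1,2) by auto
    ultimately show False using ne by (metis IntI singletonD)
  qed
  \<comment> \<open>One of the two tight sets in \<open>A\<close> at \<open>y\<close> has no
    neighbour \<open>b\<close>. If its neighbourhood is disjoint from that of \<open>X\<close>, it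
    lies in \<open>Y\<close>. Otherwise the set can be added to \<open>X\<close>, and the dual of
    the enlarged set is a tight set of \<open>ab\<close> smaller than \<open>Y\<close>.\<close>
  have M3: "x1 = x2" if x: "(x1, y) \<in> E" "(x2, y) \<in> E" "y \<in> Y" "y \<noteq> b" "3 \<le> codeg E y"
    "3 \<le> deg E x1" "3 \<le> deg E x2" for x1 x2 y
  proof (rule ccontr)
    assume ne: "x1 \<noteq> x2"
    have False if P: "tight A (E\<inverse>) y x P" and bP: "b \<notin> E `` P" and xy: "(x, y) \<in> E" and dx: "3 \<le> deg E x" for x P
    proof (cases "E `` X \<inter> E `` P = {}")
      case True
      then have dis: "insert b (B - Y) \<inter> E `` P = {}" using EX by simp
      have "E `` P \<subseteq> Y"
      proof
        fix z assume z: "z \<in> E `` P"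
        then have "z \<in> B" using E(8) by (rule subsetD[rotated])
        moreover have "z \<notin> insert b (B - Y)" using z dis by (metis IntI empty_iff)
        ultimately show "z \<in> Y" by simp
      qed
      then show False using img_sub[OF P] minA[OF dx x(5) P] by simp
    next
      case False
      have P': "P \<subseteq> A" "card (E `` P) = Suc (card P)" "x \<in> P" using P by (auto simp: tight_def)
      have bP': "nb E {b} \<inter> P \<subseteq> {a}" using bP by auto
      have tXP: "tight A (E\<inverse>) b a (X \<union> P)"
        using tight_union[OF el' tX P'(1)] P'(2) False bP' by simp
      have "x \<noteq> a" using onlyb xy x(3,4) by blast
      then have "x \<notin> X" using inW[OF xy x(3)] unfolding X_def by blast
      then have "card X < card (X \<union> P)"
        using P' E(1) unfolding X_def by (intro psubset_card_mono) (auto intro: finite_subset)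
      moreover obtain Y' where "tight B E a b Y'" "card Y' + card (X \<union> P) = card B"
        using elementary_tight_dual(1,3)[OF el' tXP] by auto
      ultimately show False using minB[OF dab] cX E(3) by fastforce
    qed
    moreover obtain P1 where P1: "tight A (E\<inverse>) y x1 P1" using minimal_imp_tight[OF m', of y x1] x by auto
    moreover obtain P2 where P2: "tight A (E\<inverse>) y x2 P2" using minimal_imp_tight[OF m', of y x2] x by auto
    moreover have "nb (E\<inverse>) P1 \<inter> nb (E\<inverse>) P2 = {y}" using tight_disjoint[OF el' _ P1 P2 ne] x(5) by simp
    then have "b \<notin> E `` P1 \<or> b \<notin> E `` P2" using x(4) by (metis IntI singletonD converse_converse)
    ultimately show False using x by metis
  qed
  define L where "L = nb E {b} - {a}"
  have La: "nb E {b} = insert a L" "a \<notin> L" using T(1) unfolding L_def by auto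
  have "codeg E b = Suc (card L)" unfolding La(1) using La(2) E(9)[of "{b}"] La(1) by simp
  then have cL: "2 \<le> card L" using dab by simp
  have path: "\<exists>l' p. E `` {l} = {b, l'} \<and> l' \<noteq> b \<and> nb E {l'} = {l, p} \<and> l \<noteq> p \<and> 3 \<le> deg E p"
    if "l \<in> L" for l
  proof -
    have "(l, b) \<in> E" "l \<noteq> a" using that unfolding L_def by auto
    then show ?thesis using extremal_deg2_path[OF ex k _ M1 dab(2)] by blast
  qed
  then obtain mm pp where mp: "\<And>l. l \<in> L \<Longrightarrow> E `` {l} = {b, mm l} \<and> mm l \<noteq> b \<and> nb E {mm l} = {l, pp l} \<and> l \<noteq> pp l \<and> 3 \<le> deg E (pp l)"
    by metis
  \<comment> \<open>Otherwise removing \<open>b\<close> from \<open>Y\<close> would cost two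
    neighbours, \<open>a\<close> and \<open>l\<close>, and leave no surplus.\<close>
  have M4: "mm l \<in> Y" if l: "l \<in> L" for l
  proof (rule ccontr)
    assume no: "mm l \<notin> Y"
    have lE: "(l, b) \<in> E" "l \<noteq> a" using l unfolding L_def by auto
    have "l \<notin> nb E (Y - {b})" using mp[OF l] no by auto
    moreover have "a \<notin> nb E (Y - {b})" using onlyb by auto
    ultimately have "nb E (Y - {b}) \<subseteq> nb E Y - {a, l}" by auto
    then have "card (nb E (Y - {b})) \<le> card (nb E Y - {a, l})" using E(9) by (intro card_mono) auto
    also have "\<dots> = card (nb E Y) - card {a, l}"
      using lE T Y(2) by (intro card_Diff_subset) auto
    also have "\<dots> = card (Y - {b})" using Y(5) lE(2) T(3) Y(2) by simp
    finally have le: "card (nb E (Y - {b})) \<le> card (Y - {b})" .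
    have "Y \<noteq> {b}" using Y(5) dab(2) by auto
    then have "Y - {b} \<noteq> {}" using Y(2) by blast
    then have "card (Y - {b}) < card (nb E (Y - {b}))"
      using elementary_surplus[OF el, of "Y - {b}"] Y by blast
    then show False using le by simp
  qed
  \<comment> \<open>The tight set \<open>Z\<close> of \<open>wy\<close> cannot contain
    \<open>n\<close>, so \<open>Y \<union> Z = B\<close> and all neighbours of \<open>w\<close> lie
    in \<open>Y\<close>. They form a component of the forest, so by extremality each vertex of
    degree two in \<open>A\<close> is adjacent to one of them and \<open>X\<close> contains no such
    vertex. The forest at \<open>X\<close> is then too small for its degrees.\<close>
  have M5: False if w: "w \<noteq> a" "3 \<le> deg E w" "(w, y) \<in> E" "y \<in> Y" "3 \<le> codeg E y"
    "(w, n) \<in> E" "n \<in> Y" "codeg E n = 2" for w y n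
  proof -
    have yb: "y \<noteq> b" using M1[of w] w by auto
    obtain Z where Z: "tight B E w y Z" using minimal_imp_tight[OF m w(3)] by blast
    have ZZ: "E `` {w} \<inter> Z = {y}" using Z by (simp add: tight_def)
    have "n \<noteq> y" using w by auto
    then have "n \<notin> Z" using ZZ w(6) by auto
    have YZ: "Y \<union> Z = B"
    proof (rule ccontr)
      assume "Y \<union> Z \<noteq> B"
      from inter[OF Z w(4,2,5) this] w(7) show False using \<open>n \<notin> Z\<close> by (metis subsetD)
    qed
    have DY: "E `` {w} \<subseteq> Y"
    proof
      fix z assume z: "z \<in> E `` {w}"
      then have "z \<in> Y \<union> Z" using E(8) YZ by (metis subsetD)
      moreover have "z = y" if "z \<in> Z" using ZZ z that by (metis IntI singletonD)
      ultimately show "z \<in> Y" using w(4) by (metis UnE)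
    qed
    have D2: "codeg E y' = 2" if y': "(w, y') \<in> E" "y' \<noteq> y" for y'
    proof (rule ccontr)
      assume "codeg E y' \<noteq> 2"
      then have "3 \<le> codeg E y'" using deg(2)[OF y'(1)] by simp
      then show False using M2[OF y'(1) w(3) w(1) _ w(4,2) _ w(5)] y' DY by auto
    qed
    \<comment> \<open>A second vertex of degree at least three cannot share \<open>y\<close> with
      \<open>w\<close>, by \<open>M3\<close>, nor a vertex of degree two, since one of the two
      neighbours of that vertex has degree two.\<close>
    have cl: "E `` {x} \<subseteq> E `` {w} \<or> E `` {x} \<inter> E `` {w} = {}" if x: "x \<in> A - deg2 A E" for x
    proof (cases "x = w")
      case False
      have dx: "3 \<le> deg E x" using card_edges_split(5)[OF el x] .
      have False if z: "(x, z) \<in> E" "(w, z) \<in> E" for z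
      proof (cases "z = y")
        case True
        then show False using M3[of x y w] z w dx yb \<open>x \<noteq> w\<close> by auto
      next
        case zy: False
        have "z \<in> B" using z E(5) by auto
        then have "z \<in> deg2 B (E\<inverse>)" using D2[OF z(2) zy] by (simp add: deg2_def)
        then obtain a1 a2 where a12: "nb E {z} = {a1, a2}" "deg E a1 = 2"
          using extremal_deg2_nb[OF ex k] by blast
        have "x \<in> {a1, a2}" "w \<in> {a1, a2}" using z a12(1) by blast+
        then show False using a12(2) dx w(2) False by auto
      qed
      then show ?thesis by blast
    qed simp
    have "b \<notin> E `` {w}" using M1[of w] w by auto
    then have Dne: "E `` {w} \<subseteq> B" "E `` {w} \<noteq> {}" "E `` {w} \<noteq> B" using E(8) w(3) T(5) by auto
    have "X \<inter> deg2 A E = {}"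
    proof (rule ccontr)
      assume "X \<inter> deg2 A E \<noteq> {}"
      then obtain x where x: "x \<in> X" "x \<in> deg2 A E" by blast
      have "E `` {x} \<inter> E `` {w} \<noteq> {}" using extremal_closed[OF ex x(2) Dne cl] .
      then obtain z where "(x, z) \<in> E" "z \<in> E `` {w}" by blast
      moreover have "z \<in> Y" using DY calculation(2) by (rule subsetD)
      moreover have "x \<noteq> a" using x(2) dab by (auto simp: deg2_def)
      ultimately have "x \<in> W" using inW by metis
      then show False using x(1) unfolding X_def by blast
    qed
    then have XA: "X \<subseteq> A - deg2 A E" unfolding X_def by blast
    have fX: "finite X" "finite (E `` X)" using E(1,10) unfolding X_def by auto
    have aX: "a \<in> X" using T(4) unfolding X_def W_def by blast
    \<comment> \<open>\<open>X\<close> has \<open>card X + 1\<close> neighbours, so a forest at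
      \<open>X\<close> has at most \<open>2 * card X\<close> edges, whereas the degrees require
      \<open>3 * card X\<close>.\<close>
    have "\<not> cyclic_core C" if "C \<subseteq> E \<inter> X \<times> UNIV" for C
      using no_cyclic_core[OF m, of C a] that card_edges_split(5)[OF el] XA by blast
    then have "card (E \<inter> X \<times> UNIV) < card X + card (E `` X)"
      using card_no_cyclic_core[OF fX, of "E \<inter> X \<times> UNIV"] aX by auto
    moreover have "card (E `` X) = Suc (card X)" using tX by (simp add: tight_def)
    moreover have "3 * card X \<le> card (E \<inter> X \<times> UNIV)" using card_edges_split(4)[OF el XA] .
    moreover have "0 < card X" using aX fX by (auto simp: card_gt_0_iff)
    ultimately show False by linarith
  qed
  have "L \<noteq> {}" using cL by auto
  then obtain l0 where l0: "l0 \<in> L" by blast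
  have l0d: "l0 \<in> deg2 A E"
  proof -
    have "(l0, b) \<in> E" "l0 \<noteq> a" using l0 unfolding L_def by auto
    then show ?thesis using M1 E(5) by (auto simp: deg2_def)
  qed
  have m2: "codeg E (mm l) = 2" if "l \<in> L" for l using mp[OF that] by (simp add: card_2_iff)
  \<comment> \<open>Otherwise \<open>{y}\<close> is a component of the forest and \<open>l0\<close>
    must be adjacent to \<open>y\<close>. But the neighbours of \<open>l0\<close> are
    \<open>b\<close> and a vertex of degree two.\<close>
  have M6: "\<exists>x. (x, y) \<in> E \<and> 3 \<le> deg E x" if y: "y \<in> Y" "y \<noteq> b" "3 \<le> codeg E y" for y
  proof (rule ccontr)
    assume no: "\<not> ?thesis"
    have "E `` {x} \<subseteq> {y} \<or> E `` {x} \<inter> {y} = {}" if "x \<in> A - deg2 A E" for x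
      using no card_edges_split(5)[OF el that] by blast
    moreover have "{y} \<subseteq> B" "{y} \<noteq> B" using y Y k by auto
    ultimately have "E `` {l0} \<inter> {y} \<noteq> {}"
      using extremal_closed[OF ex l0d, of "{y}"] by blast
    then have "y = mm l0" using mp[OF l0] y(2) by auto
    then show False using m2[OF l0] y(3) by simp
  qed
  define Y3 where "Y3 = {y \<in> Y. y \<noteq> b \<and> 3 \<le> codeg E y}"
  define Y2 where "Y2 = {y \<in> Y. codeg E y = 2}"
  have "Y = insert b (Y3 \<union> Y2)"
  proof -
    have "y \<in> Y2 \<or> 3 \<le> codeg E y" if "y \<in> Y" for y
      using elementary_degree(2)[OF el, of y] that Y(1) unfolding Y2_def by force
    then show ?thesis using Y(2) unfolding Y3_def Y2_def by blast
  qed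
  moreover have fY: "finite Y3" "finite Y2" using T(3) unfolding Y3_def Y2_def by auto
  moreover have "Y3 \<inter> Y2 = {}" "b \<notin> Y3 \<union> Y2" using dab unfolding Y3_def Y2_def by auto
  \<comment> \<open>Thus \<open>W\<close> has \<open>1 + card Y3 + card Y2\<close> elements. The
    neighbours chosen below by \<open>g\<close> for \<open>Y3\<close> and by \<open>h\<close> for
    \<open>Y2\<close> are distinct and use up all but one of them, which leaves a single place for
    all the ends \<open>pp l\<close>.\<close>
  ultimately have cY: "card Y = Suc (card Y3 + card Y2)" by (simp add: card_Un_disjoint)
  have "\<forall>y\<in>Y3. \<exists>x. (x, y) \<in> E \<and> 3 \<le> deg E x" using M6 unfolding Y3_def by simp
  then obtain g where g: "\<And>y. y \<in> Y3 \<Longrightarrow> (g y, y) \<in> E \<and> 3 \<le> deg E (g y)"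
    by metis
  have ga: "g y \<noteq> a" if "y \<in> Y3" for y using g[OF that] onlyb that unfolding Y3_def by blast
  have ginj: "inj_on g Y3"
  proof (rule inj_onI)
    fix y z assume yz: "y \<in> Y3" "z \<in> Y3" "g y = g z"
    show "y = z" using M2[of "g y" y z] g[OF yz(1)] g[OF yz(2)] ga[OF yz(1)] yz unfolding Y3_def by auto
  qed
  have "\<exists>x. (x, y) \<in> E \<and> deg E x = 2" if "y \<in> Y2" for y
  proof -
    have "y \<in> deg2 B (E\<inverse>)" using that Y(1) unfolding Y2_def deg2_def by auto
    then show ?thesis using extremal_deg2_nb[OF ex k, of y] by blast
  qed
  then obtain h where h: "\<And>y. y \<in> Y2 \<Longrightarrow> (h y, y) \<in> E \<and> deg E (h y) = 2" by metis
  have hinj: "inj_on h Y2"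
  proof (rule inj_onI)
    fix y z assume yz: "y \<in> Y2" "z \<in> Y2" "h y = h z"
    have "h y \<in> deg2 A E" using h[OF yz(1)] E(5) by (auto simp: deg2_def)
    then obtain b1 b2 where b12: "E `` {h y} = {b1, b2}" "codeg E b1 = 2" "3 \<le> codeg E b2"
      using extremal_deg2_nb[OF extremal_dual[OF ex], of "h y"] k E(3) by auto
    have "y \<in> {b1, b2}" "z \<in> {b1, b2}" using h[OF yz(1)] h[OF yz(2)] yz(3) b12(1) by auto
    then show "y = z" using b12 yz unfolding Y2_def by auto
  qed
  have ppE: "(pp l, mm l) \<in> E" if "l \<in> L" for l
  proof -
    have "pp l \<in> nb E {mm l}" using mp[OF that] by simp
    then show ?thesis by simp
  qed
  have ppa: "pp l \<noteq> a" if "l \<in> L" for l using ppE[OF that] onlyb M4[OF that] mp[OF that] by metis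
  have disj: "g ` Y3 \<inter> pp ` L = {}"
  proof (rule ccontr)
    assume "\<not> ?thesis"
    then obtain y l where yl: "y \<in> Y3" "l \<in> L" "g y = pp l" by blast
    show False
      using M5[of "pp l" y "mm l"] yl g[OF yl(1)] ppE[OF yl(2)] ppa[OF yl(2)] M4[OF yl(2)] m2[OF yl(2)]
      unfolding Y3_def by auto
  qed
  have hdisj: "(g ` Y3 \<union> pp ` L) \<inter> h ` Y2 = {}"
  proof (rule ccontr)
    assume "\<not> ?thesis"
    then obtain x where x: "x \<in> g ` Y3 \<union> pp ` L" "x \<in> h ` Y2" by blast
    have "deg E x = 2" using x(2) h by auto
    moreover have "3 \<le> deg E x" using x(1) g mp by auto
    ultimately show False by simp
  qed
  have sub: "(g ` Y3 \<union> pp ` L) \<union> h ` Y2 \<subseteq> W"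
  proof -
    have "g y \<in> W" if "y \<in> Y3" for y using inW g[OF that] ga[OF that] that unfolding Y3_def by blast
    moreover have "pp l \<in> W" if "l \<in> L" for l using inW ppE[OF that] ppa[OF that] M4[OF that] by blast
    moreover have "h y \<in> W" if "y \<in> Y2" for y
    proof -
      have "h y \<noteq> a" using h[OF that] dab by auto
      then show ?thesis using inW h[OF that] that unfolding Y2_def by blast
    qed
    ultimately show ?thesis by blast
  qed
  have fpp: "finite (pp ` L)" using sub finW by (meson finite_subset Un_subset_iff)
  have "card ((g ` Y3 \<union> pp ` L) \<union> h ` Y2) = card Y3 + card (pp ` L) + card Y2"
    using card_Un_disjoint[OF _ _ hdisj] card_Un_disjoint[OF _ fpp disj] fY fpp card_image[OF ginj] card_image[OF hinj]
    by simp
  then have "card (pp ` L) \<le> 1" using card_mono[OF finW sub] cW cY by simp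
  then have "pp l = pp l0" if "l \<in> L" for l using that l0 fpp by (metis card_le_Suc0_iff_eq One_nat_def imageI)
  then have "\<forall>l\<in>L. E `` {l} = {b, mm l} \<and> mm l \<noteq> b \<and> nb E {mm l} = {l, pp l0}" using mp by metis
  moreover have "pp l0 \<notin> L"
  proof
    assume "pp l0 \<in> L"
    then have "deg E (pp l0) = 2" using M1 La unfolding L_def by auto
    then show False using mp[OF l0] by simp
  qed
  ultimately have "cherry E b a L (pp l0) mm" using La cL ppa[OF l0] unfolding cherry_def by simp
  then show ?thesis by blast
qed

text \<open>If all degrees in \<open>A\<close> were two, equality would read
  \<open>2 * card A + 2 = 3 * card A\<close>, which is the case of two vertices only.\<close>

lemma extremal_ex_deg3:
  assumes ex: "extremal A B E" and k: "3 \<le> card B"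
  shows "\<exists>a\<in>A. 3 \<le> deg E a"
proof (rule ccontr)
  assume no: "\<not> ?thesis"
  have el: "elementary A B E" using ex by (rule extremal_elementary)
  note S = card_edges_split[OF el]
  have *: "A - deg2 A E = {}" using no S(5) by blast
  have "card E = 2 * card A" "card A = card (deg2 A E)" using S(1,3) unfolding * by auto
  then show False using ex k elementaryD(3)[OF el] unfolding extremal_def by simp
qed

text \<open>For \<open>p\<close> of degree at least three, \<open>{p}\<close> is a component of the
  forest at the vertices of degree at least three in \<open>B\<close>, as none of these is adjacent
  to \<open>p\<close>. Hence every vertex of degree two in \<open>B\<close> is adjacent to
  \<open>p\<close>, and all paths leaving \<open>b\<close> end there; any neighbour of
  \<open>b\<close> can serve as \<open>a\<close>.\<close>

lemma extremal_ex_cherry_star: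
  assumes ex: "extremal A B E" and k: "3 \<le> card B"
    and no: "\<And>a b. (a, b) \<in> E \<Longrightarrow> \<not> (3 \<le> deg E a \<and> 3 \<le> codeg E b)"
  shows "\<exists>b a L p m. cherry E b a L p m"
proof -
  have el: "elementary A B E" using ex by (rule extremal_elementary)
  note E = elementaryD[OF el] and ex' = extremal_dual[OF ex]
  note el' = elementary_dual[OF el]
  have kA: "3 \<le> card A" using k E(3) by simp
  obtain p where p: "p \<in> A" "3 \<le> deg E p" using extremal_ex_deg3[OF ex k] by blast
  obtain b where b: "b \<in> B" "3 \<le> codeg E b" using extremal_ex_deg3[OF ex' kA] by auto
  have pall: "(p, y) \<in> E" if y: "y \<in> deg2 B (E\<inverse>)" for y
  proof -
    have "(E\<inverse>) `` {x} \<subseteq> {p} \<or> (E\<inverse>) `` {x} \<inter> {p} = {}" if x: "x \<in> B - deg2 B (E\<inverse>)" for x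
      using no[of p x] card_edges_split(5)[OF el' x] p by auto
    moreover have "{p} \<subseteq> A" "{p} \<noteq> A" using p kA by auto
    ultimately have "nb E {y} \<inter> {p} \<noteq> {}" using extremal_closed[OF ex' y, of "{p}"] by simp
    then show ?thesis by auto
  qed
  have deg: "deg E x = 2" if "(x, b) \<in> E" for x
    using no[OF that] b(2) elementary_degree(1)[OF el, of x] that E(5) by fastforce
  obtain a where a: "(a, b) \<in> E" using b by (metis Image_singleton_iff card.empty converse_iff ex_in_conv not_numeral_le_zero)
  define L where "L = nb E {b} - {a}"
  have La: "nb E {b} = insert a L" "a \<notin> L" using a unfolding L_def by auto
  have "codeg E b = Suc (card L)" unfolding La(1) using La(2) E(9)[of "{b}"] La(1) by simp
  then have cL: "2 \<le> card L" using b by simp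
  have "\<exists>l'. E `` {l} = {b, l'} \<and> l' \<noteq> b \<and> nb E {l'} = {l, p}" if l: "l \<in> L" for l
  proof -
    have lb: "(l, b) \<in> E" using l unfolding L_def by auto
    obtain l' q where q: "E `` {l} = {b, l'}" "l' \<noteq> b" "nb E {l'} = {l, q}" "l \<noteq> q"
      using extremal_deg2_path[OF ex k lb deg[OF lb] b(2)] by blast
    have "l' \<in> deg2 B (E\<inverse>)" using q E(8)[of "{l}"] by (auto simp: deg2_def)
    then have "p \<in> nb E {l'}" using pall by auto
    then have "p \<in> {l, q}" using q(3) by simp
    moreover have "p \<noteq> l" using deg[OF lb] p by auto
    ultimately show ?thesis using q by blast
  qed
  then obtain mm where "\<forall>l\<in>L. E `` {l} = {b, mm l} \<and> mm l \<noteq> b \<and> nb E {mm l} = {l, p}" by metis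
  moreover have "p \<noteq> a" "p \<notin> L" using deg[of p] p a unfolding L_def by auto
  ultimately have "cherry E b a L p mm" using La cL unfolding cherry_def by simp
  then show ?thesis by blast
qed

lemma extremal_ex_cherry:
  assumes ex: "extremal A B E" and k: "3 \<le> card B"
  shows "(\<exists>b a L p m. cherry E b a L p m) \<or> (\<exists>b a L p m. cherry (E\<inverse>) b a L p m)"
proof (cases "\<exists>a b. (a, b) \<in> E \<and> 3 \<le> deg E a \<and> 3 \<le> codeg E b")
  case False
  then show ?thesis using extremal_ex_cherry_star[OF ex k] by blast
next
  case True
  then obtain a b where ab: "(a, b) \<in> E" "3 \<le> deg E a" "3 \<le> codeg E b" by blast
  note m = extremal_minimal[OF ex] and el = extremal_elementary[OF ex]
  \<comment> \<open>One minimum is taken over both classes, because the argument for either class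
    appeals to tight sets in the other.\<close>
  let ?P = "\<lambda>n. \<exists>a b. 3 \<le> deg E a \<and> 3 \<le> codeg E b \<and>
    ((\<exists>Z. tight B E a b Z \<and> card Z = n) \<or> (\<exists>Z. tight A (E\<inverse>) b a Z \<and> card Z = n))"
  have "\<exists>n. ?P n" using minimal_imp_tight[OF m ab(1)] ab by blast
  then obtain n0 where "?P n0" by (rule exE)
  then obtain n where n: "?P n" and least: "\<And>i. ?P i \<Longrightarrow> n \<le> i"
    using LeastI[of ?P n0] Least_le[of ?P] by blast
  from n obtain a b where d: "3 \<le> deg E a" "3 \<le> codeg E b"
    and c: "(\<exists>Z. tight B E a b Z \<and> card Z = n) \<or> (\<exists>Z. tight A (E\<inverse>) b a Z \<and> card Z = n)" by blast
  have lB: "n \<le> card Z" if "3 \<le> deg E a'" "3 \<le> codeg E b'" "tight B E a' b' Z" for a' b' Z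
    using least that by blast
  have lA: "n \<le> card Z" if "3 \<le> deg E a'" "3 \<le> codeg E b'" "tight A (E\<inverse>) b' a' Z" for a' b' Z
    using least that by blast
  from c show ?thesis
  proof
    assume "\<exists>Z. tight B E a b Z \<and> card Z = n"
    then obtain Z where Z: "tight B E a b Z" "card Z = n" by blast
    show ?thesis using minimal_tight_cherry[OF ex k d Z(1)] lB lA Z(2) by blast
  next
    assume "\<exists>Z. tight A (E\<inverse>) b a Z \<and> card Z = n"
    then obtain Z where Z: "tight A (E\<inverse>) b a Z" "card Z = n" by blast
    have "\<exists>L p m. cherry (E\<inverse>) a b L p m"
      by (rule minimal_tight_cherry[OF extremal_dual[OF ex] _ _ _ Z(1)])
        (use lB lA Z(2) d k elementaryD(3)[OF el] in auto)
    then show ?thesis by blast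
  qed
qed

section \<open>Replacing an edge by paths of length three\<close>

text \<open>Degrees in an elementary graph are at least two, so an edge with an end of degree two is
  indispensable.\<close>

lemma not_elementary_remove:
  assumes e: "(x, y) \<in> E" and E: "E \<subseteq> A \<times> B" "finite E"
    and d: "deg E x \<le> 2 \<or> codeg E y \<le> 2"
  shows "\<not> elementary A B (E - {(x, y)})"
proof
  assume el: "elementary A B (E - {(x, y)})"
  have xy: "x \<in> A" "y \<in> B" using e E by auto
  have "(E - {(x, y)}) `` {x} = E `` {x} - {y}" "nb (E - {(x, y)}) {y} = nb E {y} - {x}" by auto
  moreover have "finite (E `` {x})" "finite (nb E {y})" "y \<in> E `` {x}" "x \<in> nb E {y}"
    using e E(2) by (auto intro: finite_Image)
  ultimately have "card ((E - {(x, y)}) `` {x}) < deg E x" "card (nb (E - {(x, y)}) {y}) < codeg E y"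
    by (metis card_Diff1_less)+
  then show False using elementary_degree[OF el] xy d by fastforce
qed

definition expand :: "('a \<times> 'b) set \<Rightarrow> 'a \<Rightarrow> 'b \<Rightarrow> 'a set \<Rightarrow> ('a \<Rightarrow> 'b) \<Rightarrow> ('a \<times> 'b) set" where
  "expand F p b L m = F \<union> L \<times> {b} \<union> (\<lambda>l. (l, m l)) ` L \<union> {p} \<times> m ` L"

text \<open>Replacing the edge \<open>p b\<close> by the paths \<open>p, m l, l, b\<close> for \<open>l \<in> L\<close>; on the two trees of a
  doubled tree this lets the children \<open>L\<close> and \<open>m ` L\<close> grow at the matched leaves \<open>b\<close> and \<open>p\<close>.\<close>
locale ear_expansion =
  fixes A :: "'a set" and B :: "'b set" and p :: 'a and b :: 'b and L :: "'a set" and m :: "'a \<Rightarrow> 'b"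
  assumes fin: "finite A" "finite B" "finite L"
    and pb: "p \<in> A" "b \<in> B"
    and L: "L \<inter> A = {}" "m ` L \<inter> B = {}" "inj_on m L" "L \<noteq> {}"
begin

lemma nb_expand_in:
  assumes "F \<subseteq> A \<times> B" "b \<in> Y" "Y \<subseteq> B"
  shows "nb (expand F p b L m) (Y \<union> m ` L) = nb (insert (p, b) F) Y \<union> L"
proof -
  have "(x, y) \<in> F \<Longrightarrow> y \<notin> m ` L" for x y using assms(1) L(2) by blast
  moreover have "l \<in> L \<Longrightarrow> m l \<notin> Y" for l using assms(3) L(2) by blast
  ultimately show ?thesis using assms(2) L(4) unfolding expand_def by auto
qed

lemma nb_expand_out:
  assumes "F \<subseteq> A \<times> B" "b \<notin> Y" "Y \<subseteq> B"
  shows "nb (expand F p b L m) Y = nb (insert (p, b) F) Y"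
  using assms L(2) unfolding expand_def by auto

lemma cards: "card (A \<union> L) = card A + card L" "card (B \<union> m ` L) = card B + card L"
  using fin L by (simp_all add: card_Un_disjoint card_image Int_commute)

text \<open>A test set consists of some \<open>Y\<close> in \<open>B\<close> and the new vertices
  \<open>m l\<close> for \<open>l \<in> K\<close>. If \<open>b \<in> Y\<close>, all of
  \<open>L\<close> is adjacent, so a new vertex missing from the set yields a unit of surplus that
  pays for the lost edge \<open>p b\<close>. If \<open>b \<notin> Y\<close>, each \<open>m l\<close>
  brings its own neighbour \<open>l\<close>.\<close>

lemma elementary_expand:
  assumes F: "F \<subseteq> A \<times> B" "(p, b) \<notin> F" and el: "elementary A B (insert (p, b) F)"
  shows "elementary (A \<union> L) (B \<union> m ` L) (expand F p b L m)"
proof -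
  let ?F' = "insert (p, b) F" and ?E = "expand F p b L m"
  note E = elementaryD[OF el]
  have sub: "?E \<subseteq> (A \<union> L) \<times> (B \<union> m ` L)" using F pb unfolding expand_def by auto
  have finE: "finite (nb ?E Y)" for Y
    by (rule finite_subset[of _ "A \<union> L"]) (use sub fin in auto)
  have finF: "finite (nb F Y)" for Y
    by (rule finite_subset[of _ A]) (use F fin in auto)
  have "card Z < card (nb ?E Z)" if Z: "Z \<subseteq> B \<union> m ` L" "Z \<noteq> {}" "Z \<noteq> B \<union> m ` L" for Z
  proof -
    define Y where "Y = Z \<inter> B"
    define K where "K = {l \<in> L. m l \<in> Z}"
    have K: "K \<subseteq> L" "finite K" using fin(3) unfolding K_def by auto
    have ZY: "Z = Y \<union> m ` K" using Z(1) unfolding Y_def K_def by auto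
    have finY: "finite Y" using fin(2) unfolding Y_def by auto
    have "Y \<inter> m ` K = {}" using L(2) K(1) unfolding Y_def by blast
    then have cZ: "card Z = card Y + card K"
      unfolding ZY using finY K card_image[of m K] inj_on_subset[OF L(3) K(1)] by (simp add: card_Un_disjoint)
    have YB: "Y \<subseteq> B" unfolding Y_def by auto
    have nbF: "nb F Y \<subseteq> nb ?E Z" unfolding expand_def ZY by auto
    have FL: "nb F Y \<inter> L = {}" using F(1) L(1) by auto
    have KE: "K \<subseteq> nb ?E Z" using K(1) unfolding expand_def ZY by auto
    have pE: "p \<in> nb ?E Z" if "K \<noteq> {}" using that K(1) unfolding expand_def ZY by auto
    show ?thesis
    proof (cases "b \<in> Y")
      case True
      have LE: "L \<subseteq> nb ?E Z" using True unfolding expand_def ZY by auto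
      have s1: "card (nb F Y \<union> L) = card (nb F Y) + card L"
        using finF fin(3) FL by (simp add: card_Un_disjoint)
      show ?thesis
      proof (cases "K = L")
        case KL: True
        then have "Z = Y \<union> m ` L" using ZY by simp
        then have nb: "nb ?E Z = nb ?F' Y \<union> L" using nb_expand_in[OF F(1) True YB] by simp
        have "Y \<noteq> B" using Z(3) KL ZY by auto
        then have "card Y < card (nb ?F' Y)" using elementary_surplus[OF el YB] True by blast
        moreover have "nb ?F' Y \<inter> L = {}" using E(7)[of Y] L(1) by blast
        ultimately show ?thesis unfolding nb cZ using KL fin(3) E(9) by (simp add: card_Un_disjoint)
      next
        case KL: False
        then have cK: "card K < card L" using K fin(3) by (simp add: psubset_card_mono psubset_eq)
        have le: "card (nb F Y) + card L \<le> card (nb ?E Z)"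
          unfolding s1[symmetric] using finE nbF LE by (intro card_mono) auto
        have "card Y \<le> card (nb F Y)"
        proof (cases "Y = B")
          \<comment> \<open>Every vertex of \<open>A\<close> has a neighbour other than
            \<open>b\<close>, so \<open>F\<close> alone still reaches all of
            \<open>A\<close>.\<close>
          case YB': True
          have "A \<subseteq> nb F B"
          proof
            fix x assume x: "x \<in> A"
            obtain y where y: "y \<in> ?F' `` {x}" "y \<noteq> b"
              using ex_other_nbr[OF elementary_degree(1)[OF el x]] by blast
            then have "(x, y) \<in> F" by auto
            then show "x \<in> nb F B" using F(1) by auto
          qed
          then have "card A \<le> card (nb F B)" using finF card_mono by metis
          then show ?thesis using YB' E(3) by simp
        next
          case False
          then have "card Y < card (nb ?F' Y)" using elementary_surplus[OF el YB] True by blast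
          moreover have "nb ?F' Y \<subseteq> insert p (nb F Y)" by auto
          then have "card (nb ?F' Y) \<le> card (insert p (nb F Y))" using finF by (intro card_mono) auto
          moreover have "card (insert p (nb F Y)) \<le> Suc (card (nb F Y))" by (rule card_insert_le_m1) auto
          ultimately show ?thesis by linarith
        qed
        then show ?thesis using le cZ cK by linarith
      qed
    next
      case False
      have nbY: "nb ?F' Y = nb F Y" using False by auto
      have "Y \<noteq> B" using False pb by auto
      then have sY: "Y \<noteq> {} \<Longrightarrow> card Y < card (nb F Y)" using elementary_surplus[OF el YB] nbY by simp
      have FK: "nb F Y \<inter> K = {}" using FL K(1) by blast
      show ?thesis
      proof (cases "Y = {}")
        case True
        then have "K \<noteq> {}" using Z(2) ZY by auto
        have "p \<notin> K" using K(1) L(1) pb by blast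
        then have "Suc (card K) = card (insert p K)" using K by simp
        also have "\<dots> \<le> card (nb ?E Z)" using finE KE pE \<open>K \<noteq> {}\<close> by (intro card_mono) auto
        finally show ?thesis using cZ True by simp
      next
        case False
        have "card (nb F Y) + card K = card (nb F Y \<union> K)" using finF K FK by (simp add: card_Un_disjoint)
        also have "\<dots> \<le> card (nb ?E Z)" using finE nbF KE by (intro card_mono) auto
        finally show ?thesis using cZ sY[OF False] by simp
      qed
    qed
  qed
  then show ?thesis using cards E(3,4) fin sub unfolding elementary_def by auto
qed

text \<open>A set with \<open>b\<close> is tested together with all new vertices of
  \<open>B\<close>, which adds \<open>card L\<close> members and at most \<open>card L\<close>
  neighbours; a set without \<open>b\<close> is tested as it stands.\<close>

lemma elementary_collapse:
  assumes F: "F \<subseteq> A \<times> B" "(p, b) \<notin> F" and k: "2 \<le> card B"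
    and el: "elementary (A \<union> L) (B \<union> m ` L) (expand F p b L m)"
  shows "elementary A B (insert (p, b) F)"
proof -
  let ?F' = "insert (p, b) F" and ?E = "expand F p b L m"
  note E = elementaryD[OF el]
  have sub: "?F' \<subseteq> A \<times> B" using F pb by auto
  have "card Y < card (nb ?F' Y)" if Y: "Y \<subseteq> B" "Y \<noteq> {}" "Y \<noteq> B" for Y
  proof (cases "b \<in> Y")
    case True
    have "Y \<inter> m ` L = {}" using Y(1) L(2) by blast
    then have "card (Y \<union> m ` L) = card Y + card L"
      using Y(1) fin L(3) by (simp add: card_Un_disjoint card_image finite_subset)
    moreover have "Y \<union> m ` L \<noteq> B \<union> m ` L" using Y L(2) by blast
    then have "card (Y \<union> m ` L) < card (nb ?E (Y \<union> m ` L))"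
      using elementary_surplus[OF el, of "Y \<union> m ` L"] Y by auto
    moreover have "nb ?E (Y \<union> m ` L) = nb ?F' Y \<union> L" using nb_expand_in[OF F(1) True Y(1)] .
    moreover have "card (nb ?F' Y \<union> L) \<le> card (nb ?F' Y) + card L" by (rule card_Un_le)
    ultimately show ?thesis by simp
  next
    case False
    have "Y \<noteq> B \<union> m ` L" using False pb by auto
    then have "card Y < card (nb ?E Y)" using elementary_surplus[OF el, of Y] Y by auto
    then show ?thesis using nb_expand_out[OF F(1) False Y(1)] by simp
  qed
  moreover have "card A = card B" using cards E(3) by simp
  ultimately show ?thesis using fin k sub unfolding elementary_def by auto
qed

section \<open>Edges, degrees and extremality under expansion\<close>

context
  fixes F assumes F: "F \<subseteq> A \<times> B" "(p, b) \<notin> F"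
begin

lemma card_expand: "card (expand F p b L m) = card F + 3 * card L" "card (insert (p, b) F) = Suc (card F)"
proof -
  have fF: "finite F" using F(1) fin by (meson finite_SigmaI finite_subset)
  show "card (insert (p, b) F) = Suc (card F)" using F(2) fF by simp
  have 1: "card (L \<times> {b}) = card L" by (simp add: card_cartesian_product)
  have 2: "card ((\<lambda>l. (l, m l)) ` L) = card L" by (rule card_image) (auto simp: inj_on_def)
  have 3: "card ({p} \<times> m ` L) = card L" using card_image[OF L(3)] by (simp add: card_cartesian_product)
  have d1: "F \<inter> L \<times> {b} = {}" using F L(1) by blast
  have d2: "(F \<union> L \<times> {b}) \<inter> (\<lambda>l. (l, m l)) ` L = {}" using F L(1,2) pb by auto
  have d3: "(F \<union> L \<times> {b} \<union> (\<lambda>l. (l, m l)) ` L) \<inter> {p} \<times> m ` L = {}" using F L(1,2) pb by auto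
  show "card (expand F p b L m) = card F + 3 * card L"
    unfolding expand_def using card_Un_disjoint[OF _ _ d1] card_Un_disjoint[OF _ _ d2] card_Un_disjoint[OF _ _ d3]
      fF fin(3) 1 2 3 by simp
qed

lemma expand_img:
  "x \<in> A \<Longrightarrow> x \<noteq> p \<Longrightarrow> expand F p b L m `` {x} = insert (p, b) F `` {x}"
  "l \<in> L \<Longrightarrow> expand F p b L m `` {l} = {b, m l}"
  "expand F p b L m `` {p} = F `` {p} \<union> m ` L"
  "y \<in> B \<Longrightarrow> y \<noteq> b \<Longrightarrow> nb (expand F p b L m) {y} = nb (insert (p, b) F) {y}"
  "l \<in> L \<Longrightarrow> nb (expand F p b L m) {m l} = {l, p}"
  "nb (expand F p b L m) {b} = nb F {b} \<union> L"
proof -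
  have FB: "(x, y) \<in> F \<Longrightarrow> x \<in> A \<and> y \<in> B" for x y using F(1) by auto
  have LA: "l \<in> L \<Longrightarrow> l \<notin> A" "l \<in> L \<Longrightarrow> m l \<notin> B" for l using L(1,2) by auto
  have mi: "l \<in> L \<Longrightarrow> l' \<in> L \<Longrightarrow> m l = m l' \<Longrightarrow> l = l'" for l l' using L(3) by (auto simp: inj_on_def)
  show "x \<in> A \<Longrightarrow> x \<noteq> p \<Longrightarrow> expand F p b L m `` {x} = insert (p, b) F `` {x}"
    using LA unfolding expand_def by auto
  show "l \<in> L \<Longrightarrow> expand F p b L m `` {l} = {b, m l}"
    using LA FB pb unfolding expand_def by blast
  show "expand F p b L m `` {p} = F `` {p} \<union> m ` L"
    using LA pb unfolding expand_def by blast
  show "y \<in> B \<Longrightarrow> y \<noteq> b \<Longrightarrow> nb (expand F p b L m) {y} = nb (insert (p, b) F) {y}"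
    using LA unfolding expand_def by auto
  show "l \<in> L \<Longrightarrow> nb (expand F p b L m) {m l} = {l, p}"
    using LA FB pb mi unfolding expand_def by blast
  show "nb (expand F p b L m) {b} = nb F {b} \<union> L"
    using LA pb unfolding expand_def by blast
qed

text \<open>\<open>p\<close> and \<open>b\<close> had degree at least two and exchange one edge for
  at least two, so they leave the set of vertices of degree two; old vertices other than these keep
  their degree.\<close>

lemma expand_degree:
  assumes k: "2 \<le> card L" and el: "elementary A B (insert (p, b) F)"
  shows "deg2 (A \<union> L) (expand F p b L m) = (deg2 A (insert (p, b) F) - {p}) \<union> L"
    and "deg2 (B \<union> m ` L) ((expand F p b L m)\<inverse>) = (deg2 B ((insert (p, b) F)\<inverse>) - {b}) \<union> m ` L"
proof -
  have FB: "(x, y) \<in> F \<Longrightarrow> x \<in> A \<and> y \<in> B" for x y using F(1) by auto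
  have LA: "l \<in> L \<Longrightarrow> l \<notin> A" "l \<in> L \<Longrightarrow> m l \<notin> B" for l using L(1,2) by auto
  have fF: "finite F" using F(1) fin by (meson finite_SigmaI finite_subset)
  have d2: "card (expand F p b L m `` {l}) = 2" "card (nb (expand F p b L m) {m l}) = 2" if "l \<in> L" for l
  proof -
    have "b \<noteq> m l" "l \<noteq> p" using LA that pb by auto
    then show "card (expand F p b L m `` {l}) = 2" "card (nb (expand F p b L m) {m l}) = 2"
      unfolding expand_img(2,5)[OF that] by auto
  qed
  have "F `` {p} \<noteq> {}"
  proof -
    obtain y where "y \<in> insert (p, b) F `` {p}" "y \<noteq> b"
      using ex_other_nbr[OF elementary_degree(1)[OF el pb(1)]] by blast
    then show ?thesis by auto
  qed
  moreover have fFp: "finite (F `` {p})" using fF by (rule finite_Image)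
  ultimately have "0 < deg F p" by (simp only: card_gt_0_iff simp_thms)
  moreover have "F `` {p} \<inter> m ` L = {}" using FB LA by blast
  ultimately have p3: "card (expand F p b L m `` {p}) \<noteq> 2"
    unfolding expand_img(3) using k fin(3) fFp card_image[OF L(3)] by (simp add: card_Un_disjoint)
  have "nb F {b} \<noteq> {}"
  proof -
    obtain y where "y \<in> nb (insert (p, b) F) {b}" "y \<noteq> p"
      using ex_other_nbr[OF elementary_degree(2)[OF el pb(2)]] by blast
    then show ?thesis by auto
  qed
  moreover have fFb: "finite (nb F {b})" using fF by (intro finite_Image) simp
  ultimately have "0 < codeg F b" by (simp only: card_gt_0_iff simp_thms)
  moreover have "nb F {b} \<inter> L = {}" using FB LA by blast
  ultimately have b3: "card (nb (expand F p b L m) {b}) \<noteq> 2"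
    unfolding expand_img(6) using k fin(3) fFb by (simp add: card_Un_disjoint)
  show "deg2 (A \<union> L) (expand F p b L m) = (deg2 A (insert (p, b) F) - {p}) \<union> L"
  proof (rule set_eqI)
    fix x
    consider "x = p" | "x \<in> L" "x \<noteq> p" | "x \<in> A" "x \<noteq> p" | "x \<notin> A \<union> L" "x \<noteq> p" by blast
    then show "x \<in> deg2 (A \<union> L) (expand F p b L m) \<longleftrightarrow> x \<in> (deg2 A (insert (p, b) F) - {p}) \<union> L"
      using p3 d2 LA pb expand_img(1) by cases (auto simp: deg2_def)
  qed
  show "deg2 (B \<union> m ` L) ((expand F p b L m)\<inverse>) = (deg2 B ((insert (p, b) F)\<inverse>) - {b}) \<union> m ` L"
  proof (rule set_eqI)
    fix y
    consider "y = b" | "y \<in> m ` L" "y \<noteq> b" | "y \<in> B" "y \<noteq> b" | "y \<notin> B \<union> m ` L" "y \<noteq> b" by blast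
    then show "y \<in> deg2 (B \<union> m ` L) ((expand F p b L m)\<inverse>) \<longleftrightarrow> y \<in> (deg2 B ((insert (p, b) F)\<inverse>) - {b}) \<union> m ` L"
    proof cases
      case 3
      then show ?thesis using expand_img(4)[OF 3] LA by (auto simp: deg2_def)
    qed (use b3 d2 LA pb in \<open>auto simp: deg2_def\<close>)
  qed
qed

text \<open>Expansion preserves and reflects being elementary for every subset of \<open>F\<close>,
  so an edge of \<open>F\<close> is deletable in both graphs or in neither. All other edges,
  \<open>p b\<close> included, have an end of degree two.\<close>

lemma minimal_expand_iff:
  assumes b2: "card (nb (insert (p, b) F) {b}) = 2" and k: "2 \<le> card B"
  shows "minimal_elementary (A \<union> L) (B \<union> m ` L) (expand F p b L m) \<longleftrightarrow> minimal_elementary A B (insert (p, b) F)"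
proof -
  let ?F' = "insert (p, b) F" and ?E = "expand F p b L m"
  have fF: "finite F" using F(1) fin by (meson finite_SigmaI finite_subset)
  have subE: "?E \<subseteq> (A \<union> L) \<times> (B \<union> m ` L)" using F(1) pb unfolding expand_def by auto
  have fE: "finite ?E" using subE fin by (meson finite_SigmaI finite_subset finite_UnI finite_imageI)
  have iff: "elementary (A \<union> L) (B \<union> m ` L) (expand G p b L m) \<longleftrightarrow> elementary A B (insert (p, b) G)" if "G \<subseteq> F" for G
    using elementary_expand[of G] elementary_collapse[of G] F that k by blast
  have LA: "l \<in> L \<Longrightarrow> l \<notin> A" "l \<in> L \<Longrightarrow> m l \<notin> B" for l using L(1,2) by auto
  have old: "elementary (A \<union> L) (B \<union> m ` L) (?E - {e}) \<longleftrightarrow> elementary A B (?F' - {e})" if e: "e \<in> F" for e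
  proof -
    have "e \<noteq> (p, b)" "e \<in> A \<times> B" using e F by auto
    then have "?E - {e} = expand (F - {e}) p b L m" "?F' - {e} = insert (p, b) (F - {e})"
      using LA unfolding expand_def by auto
    then show ?thesis using iff[of "F - {e}"] by auto
  qed
  have new: "\<not> elementary (A \<union> L) (B \<union> m ` L) (?E - {e})" if "e \<in> ?E" "e \<notin> F" for e
  proof -
    obtain x y where xy: "e = (x, y)" by (cases e)
    have "x \<in> L \<or> y \<in> m ` L" using that xy unfolding expand_def by auto
    then have "deg ?E x \<le> 2 \<or> codeg ?E y \<le> 2"
    proof
      assume "x \<in> L"
      then show ?thesis unfolding expand_img(2)[OF \<open>x \<in> L\<close>] by (simp add: card_insert_if)
    next
      assume "y \<in> m ` L"
      then obtain l where l: "l \<in> L" "y = m l" by blast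
      show ?thesis unfolding l(2) expand_img(5)[OF l(1)] by (simp add: card_insert_if)
    qed
    then show ?thesis unfolding xy using not_elementary_remove[OF _ subE fE] that xy by blast
  qed
  have pbn: "\<not> elementary A B (?F' - {(p, b)})"
    using not_elementary_remove[of p b ?F' A B] F(1) pb fF b2 by auto
  have FE: "F \<subseteq> ?E" unfolding expand_def by auto
  show ?thesis unfolding minimal_elementary_def using iff[of F] old new pbn FE by blast
qed

text \<open>The edges increase by \<open>3 * card L - 1\<close>, each class by
  \<open>card L\<close>, and its vertices of degree two by \<open>card L - 1\<close>; these changes
  balance in both equations.\<close>

lemma extremal_expand:
  assumes k: "2 \<le> card L" and ex: "extremal A B (insert (p, b) F)"
    and p2: "p \<in> deg2 A (insert (p, b) F)" and b2: "b \<in> deg2 B ((insert (p, b) F)\<inverse>)"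
  shows "extremal (A \<union> L) (B \<union> m ` L) (expand F p b L m)"
proof -
  let ?F' = "insert (p, b) F" and ?E = "expand F p b L m"
  have el: "elementary A B ?F'" using ex by (rule extremal_elementary)
  have "minimal_elementary (A \<union> L) (B \<union> m ` L) ?E"
    using minimal_expand_iff elementaryD(4)[OF el] b2 ex by (simp add: deg2_def extremal_def)
  moreover have f2: "finite (deg2 A ?F')" "finite (deg2 B (?F'\<inverse>))" using fin by (auto simp: deg2_def)
  moreover have "(deg2 A ?F' - {p}) \<inter> L = {}" "(deg2 B (?F'\<inverse>) - {b}) \<inter> m ` L = {}"
    using L(1,2) by (auto simp: deg2_def)
  then have "card (deg2 (A \<union> L) ?E) + 1 = card (deg2 A ?F') + card L"
    "card (deg2 (B \<union> m ` L) (?E\<inverse>)) + 1 = card (deg2 B (?F'\<inverse>)) + card L"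
    unfolding expand_degree[OF k el] using f2 fin(3) card_image[OF L(3)] card.remove[OF f2(1) p2] card.remove[OF f2(2) b2]
    by (simp_all add: card_Un_disjoint)
  ultimately show ?thesis using ex card_expand cards unfolding extremal_def by auto
qed

text \<open>The degree of \<open>p\<close> is forced by the lower bound: if \<open>p\<close> kept
  degree at least three, the smaller graph would have one vertex of degree two too few in
  \<open>A\<close>.\<close>

lemma extremal_collapse:
  assumes k: "2 \<le> card L" "2 \<le> card B" and ex: "extremal (A \<union> L) (B \<union> m ` L) (expand F p b L m)"
    and b2: "card (nb (insert (p, b) F) {b}) = 2"
  shows "extremal A B (insert (p, b) F)" "p \<in> deg2 A (insert (p, b) F)"
proof -
  let ?F' = "insert (p, b) F" and ?E = "expand F p b L m"
  have mi: "minimal_elementary A B ?F'" using minimal_expand_iff[OF b2 k(2)] ex by (simp add: extremal_def)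
  then have el: "elementary A B ?F'" by (simp add: minimal_elementary_def)
  have b2': "b \<in> deg2 B (?F'\<inverse>)" using b2 pb by (simp add: deg2_def)
  have f2: "finite (deg2 A ?F')" "finite (deg2 B (?F'\<inverse>))" using fin by (auto simp: deg2_def)
  have disj: "(deg2 A ?F' - {p}) \<inter> L = {}" "(deg2 B (?F'\<inverse>) - {b}) \<inter> m ` L = {}"
    using L(1,2) by (auto simp: deg2_def)
  have cA: "card (deg2 (A \<union> L) ?E) = card (deg2 A ?F' - {p}) + card L"
    and cB: "card (deg2 (B \<union> m ` L) (?E\<inverse>)) + 1 = card (deg2 B (?F'\<inverse>)) + card L"
    unfolding expand_degree[OF k(1) el] using disj f2 fin(3) card_image[OF L(3)] card.remove[OF f2(2) b2']
    by (simp_all add: card_Un_disjoint)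
  have bd: "card ?F' + 2 \<le> 2 * card A + card (deg2 A ?F')" using minimal_elementary_bound[OF mi] .
  have ext: "card ?E + 2 = 2 * card (A \<union> L) + card (deg2 (A \<union> L) ?E)"
    "card ?E + 2 = 2 * card (B \<union> m ` L) + card (deg2 (B \<union> m ` L) (?E\<inverse>))"
    using ex by (auto simp: extremal_def)
  show p2: "p \<in> deg2 A ?F'"
  proof (rule ccontr)
    assume "p \<notin> deg2 A ?F'"
    then have "card (deg2 (A \<union> L) ?E) = card (deg2 A ?F') + card L" using cA by simp
    then show False using bd ext(1) card_expand cards by linarith
  qed
  have "card (deg2 A ?F' - {p}) + 1 = card (deg2 A ?F')" using card.remove[OF f2(1) p2] by simp
  then show "extremal A B ?F'" using mi ext cA cB card_expand cards unfolding extremal_def by auto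
qed

end

end

section \<open>Doubled Halin trees\<close>

definition incident :: "'v set set \<Rightarrow> 'v \<Rightarrow> 'v set set" where
  "incident S v = {e \<in> S. v \<in> e}"

definition leaf_set :: "'v set \<Rightarrow> 'v set set \<Rightarrow> 'v set" where
  "leaf_set V S = {v \<in> V. card (incident S v) = 1}"

abbreviation star :: "'v \<Rightarrow> 'v set \<Rightarrow> 'v set set" where
  "star x L \<equiv> (\<lambda>l. {x, l}) ` L"

text \<open>A leaf with at least two new neighbours jumps from degree one to at least three, so
  growth never creates degree two. Edges are plain vertex pairs, as a tree has no parallel
  edges.\<close>

inductive halin :: "'v set \<Rightarrow> 'v set set \<Rightarrow> bool" where
  edge: "x \<noteq> y \<Longrightarrow> halin {x, y} {{x, y}}"
| grow: "halin V S \<Longrightarrow> x \<in> leaf_set V S \<Longrightarrow> finite L \<Longrightarrow> 2 \<le> card L \<Longrightarrow> L \<inter> V = {} \<Longrightarrow>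
    halin (V \<union> L) (S \<union> star x L)"

lemma leaf_set_edge: "leaf_set {x, y} {{x, y}} = {x, y}"
proof -
  have "incident {{x, y}} x = {{x, y}}" "incident {{x, y}} y = {{x, y}}" by (auto simp: incident_def)
  then show ?thesis by (auto simp: leaf_set_def)
qed

lemma incident_grow:
  assumes S: "\<And>e. e \<in> S \<Longrightarrow> e \<subseteq> V" and x: "x \<in> V" and L: "L \<inter> V = {}"
  shows "incident (S \<union> star x L) x = incident S x \<union> star x L"
    and "l \<in> L \<Longrightarrow> incident (S \<union> star x L) l = {{x, l}}"
    and "v \<in> V \<Longrightarrow> v \<noteq> x \<Longrightarrow> incident (S \<union> star x L) v = incident S v"
    and "incident S x \<inter> star x L = {}"
    and "inj_on (\<lambda>l. {x, l}) L"
  using assms unfolding incident_def inj_on_def by (auto simp: doubleton_eq_iff)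

lemma halin_props:
  assumes "halin V S"
  shows "finite V \<and> finite S \<and> (\<forall>e\<in>S. e \<subseteq> V \<and> card e = 2) \<and>
    (\<forall>v\<in>V. card (incident S v) \<noteq> 2 \<and> card (incident S v) \<noteq> 0)"
  using assms
proof induction
  case (edge x y)
  then have "incident {{x, y}} x = {{x, y}}" "incident {{x, y}} y = {{x, y}}" by (auto simp: incident_def)
  then show ?case using edge by simp
next
  case (grow V S x L)
  let ?S = "S \<union> star x L"
  have x: "x \<in> V" "card (incident S x) = 1" using grow by (auto simp: leaf_set_def)
  have S: "\<And>e. e \<in> S \<Longrightarrow> e \<subseteq> V" using grow.IH by auto
  note I = incident_grow[of S V x L, OF S x(1) grow.hyps(5)]
  have "finite (incident S x)" using grow.IH by (simp add: incident_def)
  then have "card (incident ?S x) = 1 + card L"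
    using I(1) I(4) grow.hyps(3) card_image[OF I(5)] x(2) by (simp add: card_Un_disjoint)
  then have "card (incident ?S v) \<noteq> 2 \<and> card (incident ?S v) \<noteq> 0" if "v \<in> V \<union> L" for v
    using that I(2)[of v] I(3)[of v] grow.IH grow.hyps(4) by (cases "v = x"; cases "v \<in> L") auto
  moreover have "card {x, l} = 2" if "l \<in> L" for l
  proof -
    have "x \<noteq> l" using that x grow.hyps(5) by auto
    then show ?thesis by simp
  qed
  ultimately show ?case using grow x by auto
qed

lemma leaf_set_grow:
  assumes h: "halin V S" and x: "x \<in> leaf_set V S" and L: "finite L" "2 \<le> card L" "L \<inter> V = {}"
  shows "leaf_set (V \<union> L) (S \<union> star x L) = (leaf_set V S - {x}) \<union> L"
proof -
  let ?S = "S \<union> star x L"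
  have xV: "x \<in> V" "card (incident S x) = 1" using x by (auto simp: leaf_set_def)
  have S: "\<And>e. e \<in> S \<Longrightarrow> e \<subseteq> V" "finite (incident S x)" using halin_props[OF h] by (auto simp: incident_def)
  note I = incident_grow[of S V x L, OF S(1) xV(1) L(3)]
  have "card (incident ?S x) = 1 + card L"
    using I(1) I(4) S(2) L(1) card_image[OF I(5)] xV(2) by (simp add: card_Un_disjoint)
  then have cx: "card (incident ?S x) \<noteq> 1" using L(2) by simp
  show ?thesis
  proof (rule set_eqI)
    fix v
    consider "v = x" | "v \<in> L" "v \<noteq> x" | "v \<in> V" "v \<noteq> x" "v \<notin> L" | "v \<notin> V \<union> L" "v \<noteq> x" by blast
    then show "v \<in> leaf_set (V \<union> L) ?S \<longleftrightarrow> v \<in> (leaf_set V S - {x}) \<union> L"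
    proof cases
      case 1 then show ?thesis using cx xV L(3) by (auto simp: leaf_set_def)
    next
      case 2 then show ?thesis using I(2)[of v] by (auto simp: leaf_set_def)
    next
      case 3 then show ?thesis using I(3)[of v] by (auto simp: leaf_set_def)
    next
      case 4 then show ?thesis by (auto simp: leaf_set_def)
    qed
  qed
qed

section \<open>Growth and degrees of the doubled tree\<close>

definition doubled :: "'v set \<Rightarrow> 'v set set \<Rightarrow> ('v \<Rightarrow> 'v) \<Rightarrow> 'v set set" where
  "doubled V S f = S \<union> (`) f ` S \<union> (\<lambda>v. {v, f v}) ` leaf_set V S"

lemma doubled_cong:
  assumes "halin V S" "\<And>v. v \<in> V \<Longrightarrow> f v = g v"
  shows "doubled V S f = doubled V S g"
proof -
  have "f ` e = g ` e" if "e \<in> S" for e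
    using halin_props[OF assms(1)] that assms(2) by (intro image_cong) auto
  then have "(`) f ` S = (`) g ` S" by (rule image_cong[OF refl])
  moreover have "(\<lambda>v. {v, f v}) ` leaf_set V S = (\<lambda>v. {v, g v}) ` leaf_set V S"
    using assms(2) by (intro image_cong) (auto simp: leaf_set_def)
  ultimately show ?thesis unfolding doubled_def by simp
qed

text \<open>\<open>x\<close> ceases to be a leaf and loses its matching edge. The pair
  \<open>{x, f x}\<close> really vanishes, since it is an edge of neither tree and \<open>f\<close>
  sends \<open>V\<close> outside \<open>V\<close>.\<close>

lemma doubled_grow:
  assumes h: "halin V S" and x: "x \<in> leaf_set V S" and L: "finite L" "2 \<le> card L" "L \<inter> V = {}"
    and disj: "f ` V \<inter> V = {}"
  shows "doubled (V \<union> L) (S \<union> star x L) f =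
    (doubled V S f - {{x, f x}}) \<union> star x L \<union> (\<lambda>l. {f x, f l}) ` L \<union> (\<lambda>l. {l, f l}) ` L"
proof -
  have xV: "x \<in> V" using x by (auto simp: leaf_set_def)
  have S: "\<And>e. e \<in> S \<Longrightarrow> e \<subseteq> V" using halin_props[OF h] by auto
  have fx: "f x \<notin> V" "\<And>v. v \<in> V \<Longrightarrow> x \<noteq> f v" using disj xV by auto
  have n1: "{x, f x} \<notin> S" using S fx by blast
  have n2: "{x, f x} \<notin> (`) f ` S"
  proof
    assume "{x, f x} \<in> (`) f ` S"
    then obtain e where "e \<in> S" "{x, f x} = f ` e" by blast
    then have "x \<in> f ` V" using S[of e] by blast
    then show False using fx(2) by blast
  qed
  have n3: "{v, f v} = {x, f x} \<longleftrightarrow> v = x" if "v \<in> leaf_set V S" for v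
    using that fx unfolding leaf_set_def by (auto simp: doubleton_eq_iff)
  have im: "(\<lambda>v. {v, f v}) ` (leaf_set V S - {x}) = (\<lambda>v. {v, f v}) ` leaf_set V S - {{x, f x}}"
    using n3 by blast
  have "(`) f ` (S \<union> star x L) = (`) f ` S \<union> (\<lambda>l. {f x, f l}) ` L"
    by (simp add: image_Un image_image)
  then show ?thesis
    unfolding doubled_def leaf_set_grow[OF h x L] image_Un[of "\<lambda>v. {v, f v}"] im using n1 n2 by auto
qed

definition is_double :: "'v set \<Rightarrow> 'v set set \<Rightarrow> 'v set \<Rightarrow> 'v set set \<Rightarrow> ('v \<Rightarrow> 'v) \<Rightarrow> bool" where
  "is_double U H V S f \<longleftrightarrow> halin V S \<and> inj_on f V \<and> f ` V \<inter> V = {} \<and> U = V \<union> f ` V \<and> H = doubled V S f"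

text \<open>The isomorphism is extended to the new leaves by any injection \<open>g\<close> into
  fresh vertices. This freedom allows the expansion of a matching edge to be read as simultaneous
  growth of both trees.\<close>

lemma is_double_grow:
  assumes d: "is_double U H V S f" and x: "x \<in> leaf_set V S"
    and L: "finite L" "2 \<le> card L" "L \<inter> U = {}" and g: "inj_on g L" "g ` L \<inter> U = {}" "g ` L \<inter> L = {}"
  shows "\<exists>V S f'. is_double (U \<union> (L \<union> g ` L))
    ((H - {{x, f x}}) \<union> star x L \<union> (\<lambda>l. {f x, g l}) ` L \<union> (\<lambda>l. {l, g l}) ` L) V S f'"
proof -
  have h: "halin V S" "inj_on f V" "f ` V \<inter> V = {}" "U = V \<union> f ` V" "H = doubled V S f"
    using d by (auto simp: is_double_def)
  have xV: "x \<in> V" using x by (auto simp: leaf_set_def)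
  have LV: "L \<inter> V = {}" using L h(4) by blast
  define f' where "f' v = (if v \<in> L then g v else f v)" for v
  have fV: "f' v = f v" if "v \<in> V" for v using that LV unfolding f'_def by auto
  have fL: "f' l = g l" if "l \<in> L" for l using that unfolding f'_def by auto
  have imV: "f' ` V = f ` V" using fV by (intro image_cong) auto
  have imL: "f' ` L = g ` L" using fL by (intro image_cong) auto
  have "doubled (V \<union> L) (S \<union> star x L) f' =
    (doubled V S f' - {{x, f' x}}) \<union> star x L \<union> (\<lambda>l. {f' x, f' l}) ` L \<union> (\<lambda>l. {l, f' l}) ` L"
    using doubled_grow[OF h(1) x L(1,2) LV] imV h(3) by simp
  also have "doubled V S f' = H" using doubled_cong[OF h(1), of f' f] fV h(5) by simp
  also have "(\<lambda>l. {f' x, f' l}) ` L = (\<lambda>l. {f x, g l}) ` L" using fV[OF xV] fL by (intro image_cong) auto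
  also have "(\<lambda>l. {l, f' l}) ` L = (\<lambda>l. {l, g l}) ` L" using fL by (intro image_cong) auto
  also have "f' x = f x" using fV xV by simp
  finally have 1: "doubled (V \<union> L) (S \<union> star x L) f' =
    (H - {{x, f x}}) \<union> star x L \<union> (\<lambda>l. {f x, g l}) ` L \<union> (\<lambda>l. {l, g l}) ` L" .
  have 2: "inj_on f' (V \<union> L)"
  proof -
    have "inj_on f' V" using h(2) fV by (simp cong: inj_on_cong)
    moreover have "inj_on f' L" using g(1) fL by (simp cong: inj_on_cong)
    moreover have "f' ` V \<inter> f' ` L = {}" unfolding imV imL using g(2) h(4) by blast
    ultimately show ?thesis by (meson inj_on_Un Diff_subset image_mono disjoint_iff subsetD)
  qed
  have 3: "f' ` (V \<union> L) \<inter> (V \<union> L) = {}"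
  proof -
    have "f ` V \<inter> L = {}" "g ` L \<inter> V = {}" using h(4) L(3) g(2) by auto
    then show ?thesis unfolding image_Un imV imL using h(3) g(3) by (simp add: Int_Un_distrib Int_Un_distrib2)
  qed
  have 4: "U \<union> (L \<union> g ` L) = (V \<union> L) \<union> f' ` (V \<union> L)" unfolding image_Un imV imL using h(4) by blast
  have "is_double (U \<union> (L \<union> g ` L))
    ((H - {{x, f x}}) \<union> star x L \<union> (\<lambda>l. {f x, g l}) ` L \<union> (\<lambda>l. {l, g l}) ` L)
    (V \<union> L) (S \<union> star x L) f'"
    unfolding is_double_def by (intro conjI halin.grow[OF h(1) x L(1,2) LV] 1[symmetric] 2 3 4)
  then show ?thesis by blast
qed

text \<open>A leaf has one tree edge and one matching edge; every other vertex keeps its tree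
  degree, which is never two.\<close>

lemma card_incident_doubled:
  assumes d: "is_double U H V S f" and v: "v \<in> V"
  shows "card (incident H v) = 2 \<longleftrightarrow> v \<in> leaf_set V S"
    and "card (incident H (f v)) = 2 \<longleftrightarrow> v \<in> leaf_set V S"
proof -
  have h: "halin V S" "inj_on f V" "f ` V \<inter> V = {}" "H = doubled V S f"
    using d by (auto simp: is_double_def)
  have S: "\<And>e. e \<in> S \<Longrightarrow> e \<subseteq> V" "finite S" using halin_props[OF h(1)] by auto
  have fvV: "f w \<notin> V" "w \<notin> f ` V" if "w \<in> V" for w using h(3) that by auto
  have fin: "finite (incident S v)" using S(2) by (simp add: incident_def)
  let ?X = "if v \<in> leaf_set V S then {{v, f v}} else {}"
  have lV: "leaf_set V S \<subseteq> V" by (auto simp: leaf_set_def)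
  have inc: "incident H w = incident S w \<union> incident ((`) f ` S) w \<union> incident ((\<lambda>v. {v, f v}) ` leaf_set V S) w" for w
    unfolding h(4) doubled_def incident_def by blast
  have "incident ((`) f ` S) v = {}" using S(1) fvV(2)[OF v] unfolding incident_def by blast
  moreover have "incident ((\<lambda>v. {v, f v}) ` leaf_set V S) v = ?X"
    using lV fvV(2)[OF v] unfolding incident_def by auto
  ultimately have 1: "incident H v = incident S v \<union> ?X" unfolding inc by simp
  have "incident S (f v) = {}" using S(1) fvV(1)[OF v] unfolding incident_def by blast
  moreover have "incident ((`) f ` S) (f v) = (`) f ` incident S v"
  proof -
    have "f v \<in> f ` e \<longleftrightarrow> v \<in> e" if "e \<in> S" for e
      using inj_on_image_mem_iff[OF h(2) v S(1)[OF that]] .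
    then show ?thesis unfolding incident_def by blast
  qed
  moreover have "incident ((\<lambda>v. {v, f v}) ` leaf_set V S) (f v) = ?X"
  proof -
    have "f v \<in> {w, f w} \<longleftrightarrow> w = v" if "w \<in> leaf_set V S" for w
      using that lV v fvV(1)[OF v] h(2) by (auto simp: inj_on_def)
    then have "{w \<in> leaf_set V S. f v \<in> {w, f w}} = {w \<in> leaf_set V S. w = v}" by blast
    moreover have "incident ((\<lambda>w. {w, f w}) ` leaf_set V S) (f v) =
      (\<lambda>w. {w, f w}) ` {w \<in> leaf_set V S. f v \<in> {w, f w}}" unfolding incident_def by blast
    ultimately show ?thesis by auto
  qed
  ultimately have 2: "incident H (f v) = (`) f ` incident S v \<union> ?X" unfolding inc by simp
  have vf: "{v, f v} \<notin> incident S v" "{v, f v} \<notin> (`) f ` incident S v"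
    using S(1) fvV v unfolding incident_def by blast+
  have "inj_on ((`) f) (incident S v)"
    by (rule inj_on_subset[OF inj_on_image_Pow[OF h(2)]]) (use S(1) in \<open>auto simp: incident_def\<close>)
  then have ci: "card ((`) f ` incident S v) = card (incident S v)" by (rule card_image)
  have n2: "card (incident S v) \<noteq> 2" using halin_props[OF h(1)] v by blast
  have l1: "v \<in> leaf_set V S \<longleftrightarrow> card (incident S v) = 1" using v by (simp add: leaf_set_def)
  show "card (incident H v) = 2 \<longleftrightarrow> v \<in> leaf_set V S"
    unfolding 1 using n2 l1 fin vf by (auto split: if_splits)
  show "card (incident H (f v)) = 2 \<longleftrightarrow> v \<in> leaf_set V S"
    unfolding 2 using n2 l1 fin vf ci by (auto split: if_splits)
qed

section \<open>Passage between bipartite relations and sets of vertex pairs\<close>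

definition undirected :: "('v \<times> 'v) set \<Rightarrow> 'v set set" where
  "undirected E = (\<lambda>(a, b). {a, b}) ` E"

lemma undirected_converse: "undirected (E\<inverse>) = undirected E"
  unfolding undirected_def by (force simp: insert_commute)

lemma undirected_mem:
  assumes "A \<inter> B = {}" "E \<subseteq> A \<times> B" "a \<in> A" "b \<in> B"
  shows "{a, b} \<in> undirected E \<longleftrightarrow> (a, b) \<in> E"
proof
  assume "{a, b} \<in> undirected E"
  then obtain x y where "(x, y) \<in> E" "{a, b} = {x, y}" unfolding undirected_def by auto
  then show "(a, b) \<in> E" using assms by (auto simp: doubleton_eq_iff)
qed (auto simp: undirected_def)

lemma card_incident_undirected:
  assumes "A \<inter> B = {}" "E \<subseteq> A \<times> B" "a \<in> A"
  shows "card (incident (undirected E) a) = deg E a"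
proof -
  have "incident (undirected E) a = (\<lambda>b. {a, b}) ` (E `` {a})"
    using assms unfolding incident_def undirected_def by auto
  moreover have "inj_on (\<lambda>b. {a, b}) (E `` {a})" by (auto simp: inj_on_def doubleton_eq_iff)
  ultimately show ?thesis by (simp add: card_image)
qed

lemma card_incident_undirected':
  assumes "A \<inter> B = {}" "E \<subseteq> A \<times> B" "b \<in> B"
  shows "card (incident (undirected E) b) = codeg E b"
proof -
  have "B \<inter> A = {}" "E\<inverse> \<subseteq> B \<times> A" using assms by auto
  from card_incident_undirected[OF this assms(3)] show ?thesis by (simp add: undirected_converse)
qed

lemma undirected_expand:
  assumes "A \<inter> B = {}" "F \<subseteq> A \<times> B" "p \<in> A" "b \<in> B" "(p, b) \<notin> F"
  shows "undirected (expand F p b L m) = (undirected (insert (p, b) F) - {{p, b}}) \<union>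
    star b L \<union> (\<lambda>l. {p, m l}) ` L \<union> (\<lambda>l. {l, m l}) ` L"
proof -
  have "undirected (insert (p, b) F) - {{p, b}} = undirected F"
    using undirected_mem[OF assms(1-4)] assms(5) by (auto simp: undirected_def)
  moreover have "undirected (L \<times> {b}) = star b L" unfolding undirected_def by (force simp: insert_commute)
  moreover have "undirected ({p} \<times> m ` L) = (\<lambda>l. {p, m l}) ` L" unfolding undirected_def by force
  moreover have "undirected ((\<lambda>l. (l, m l)) ` L) = (\<lambda>l. {l, m l}) ` L" unfolding undirected_def by force
  ultimately show ?thesis unfolding expand_def undirected_def by (auto simp: image_Un)
qed

lemma extremal_K22:
  assumes "card A = 2" "card B = 2"
  shows "extremal A B (A \<times> B)"
proof -
  have fin: "finite A" "finite B" using assms by (metis card.infinite zero_neq_numeral)+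
  have img: "(A \<times> B) `` {x} = B" if "x \<in> A" for x using that by auto
  have img': "nb (A \<times> B) {y} = A" if "y \<in> B" for y using that by auto
  have el: "elementary A B (A \<times> B)"
    unfolding elementary_def
  proof (intro conjI allI impI)
    fix Y assume Y: "Y \<subseteq> B" "Y \<noteq> {}" "Y \<noteq> B"
    have "card Y < card B" using Y fin by (simp add: psubset_card_mono psubset_eq)
    moreover have "nb (A \<times> B) Y = A" using Y by auto
    ultimately show "card Y < card (nb (A \<times> B) Y)" using assms by simp
  qed (use assms fin in auto)
  have "\<not> elementary A B (A \<times> B - {e})" if "e \<in> A \<times> B" for e
    using that not_elementary_remove[of "fst e" "snd e" "A \<times> B" A B] fin assms img by auto
  moreover have "deg2 A (A \<times> B) = A" "deg2 B ((A \<times> B)\<inverse>) = B"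
    using assms img img' by (auto simp: deg2_def)
  ultimately show ?thesis
    using el assms unfolding extremal_def minimal_elementary_def by (simp add: card_cartesian_product)
qed

lemma elementary_K22:
  assumes el: "elementary A B E" and "card B = 2"
  shows "E = A \<times> B"
proof -
  note E = elementaryD[OF el]
  have "E `` {a} = B" if "a \<in> A" for a
    using card_seteq[OF E(2) E(8)[of "{a}"]] elementary_degree(1)[OF el that] assms(2) by simp
  then show ?thesis using E(5) by blast
qed

lemma doubled_imp_extremal:
  assumes "halin V S" "inj_on f V" "f ` V \<inter> V = {}"
  shows "\<exists>A B E. A \<inter> B = {} \<and> A \<union> B = V \<union> f ` V \<and> undirected E = doubled V S f \<and> extremal A B E"
  using assms
proof induction
  case (edge x y)
  \<comment> \<open>The double of a single edge is the 4-cycle \<open>x, y, f y, f x\<close>. Its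
    classes are the diagonals, so each class meets both copies of the tree.\<close>
  let ?A = "{x, f y}" and ?B = "{y, f x}"
  have ne: "x \<noteq> f y" "y \<noteq> f x" "f x \<noteq> f y" "x \<noteq> f x" "y \<noteq> f y" using edge by (auto simp: inj_on_def)
  have "leaf_set {x, y} {{x, y}} = {x, y}"
    by (rule leaf_set_edge)
  then have "undirected (?A \<times> ?B) = doubled {x, y} {{x, y}} f"
    unfolding doubled_def undirected_def by auto
  moreover have "extremal ?A ?B (?A \<times> ?B)" using ne edge.hyps by (intro extremal_K22) auto
  moreover have "?A \<inter> ?B = {}" "?A \<union> ?B = {x, y} \<union> f ` {x, y}" using ne edge.hyps by auto
  ultimately show ?case by blast
next
  case (grow V S x L)
  let ?V = "V \<union> L" and ?S = "S \<union> star x L"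
  have xV: "x \<in> V" using grow.hyps by (auto simp: leaf_set_def)
  have fV: "inj_on f V" "f ` V \<inter> V = {}" using grow.prems by (auto simp: inj_on_def)
  obtain A B E where AB: "A \<inter> B = {}" "A \<union> B = V \<union> f ` V" "undirected E = doubled V S f" "extremal A B E"
    using grow.IH fV by blast
  \<comment> \<open>Exchanging the classes if necessary, the growing leaf \<open>x\<close> takes the
    role of \<open>b\<close> in the expansion and \<open>f x\<close> that of
    \<open>p\<close>.\<close>
  have "\<exists>A B E. A \<inter> B = {} \<and> A \<union> B = V \<union> f ` V \<and> undirected E = doubled V S f \<and> extremal A B E \<and> x \<in> B"
  proof (cases "x \<in> B")
    case False
    then have "x \<in> A" using AB(2) xV by auto
    moreover have "B \<inter> A = {}" "B \<union> A = V \<union> f ` V" using AB by auto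
    ultimately show ?thesis using AB extremal_dual[OF AB(4)] undirected_converse by metis
  qed (use AB in blast)
  then obtain A B E where AB: "A \<inter> B = {}" "A \<union> B = V \<union> f ` V" "undirected E = doubled V S f" "extremal A B E" "x \<in> B"
    by blast
  have el: "elementary A B E" using AB(4) by (rule extremal_elementary)
  note E = elementaryD[OF el]
  have dbl: "is_double (A \<union> B) (undirected E) V S f"
    unfolding is_double_def using AB grow.hyps(1) fV by auto
  have "{x, f x} \<in> undirected E" using AB(3) grow.hyps(2) by (auto simp: doubled_def)
  then obtain u v where uv: "(u, v) \<in> E" "{x, f x} = {u, v}" unfolding undirected_def by auto
  have "u \<in> A" "v \<in> B" using uv(1) E(5) by auto
  then have fxE: "(f x, x) \<in> E" "f x \<in> A" using uv AB(1,5) by (auto simp: doubleton_eq_iff)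
  let ?F = "E - {(f x, x)}"
  have F: "?F \<subseteq> A \<times> B" "(f x, x) \<notin> ?F" "insert (f x, x) ?F = E" using E(5) fxE by auto
  have fLV: "f ` L \<inter> f ` V = {}" using grow.prems(1) grow.hyps(5) by (auto simp: inj_on_def)
  have L1: "L \<inter> (A \<union> B) = {}" "f ` L \<inter> (A \<union> B) = {}"
    unfolding AB(2) using grow.prems(2) grow.hyps(5) fLV by auto
  have ear: "ear_expansion A B (f x) x L f"
  proof
    show "L \<noteq> {}" using grow.hyps(4) by auto
    show "inj_on f L" using grow.prems(1) by (auto simp: inj_on_def)
  qed (use E grow.hyps AB fxE L1 in auto)
  have "card (incident (undirected E) x) = 2" "card (incident (undirected E) (f x)) = 2"
    using card_incident_doubled[OF dbl xV] grow.hyps(2) by auto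
  then have "f x \<in> deg2 A E" "x \<in> deg2 B (E\<inverse>)"
    using card_incident_undirected[OF AB(1) E(5) fxE(2)] card_incident_undirected'[OF AB(1) E(5) AB(5)] fxE AB(5)
    by (auto simp: deg2_def)
  then have "extremal (A \<union> L) (B \<union> f ` L) (expand ?F (f x) x L f)"
    using ear_expansion.extremal_expand[OF ear F(1,2) grow.hyps(4)] AB(4) F(3) by simp
  moreover have "undirected (expand ?F (f x) x L f) = doubled ?V ?S f"
    unfolding undirected_expand[OF AB(1) F(1) fxE(2) AB(5) F(2)] F(3) AB(3)
      doubled_grow[OF grow.hyps(1-5) fV(2)] by (simp add: insert_commute)
  moreover have "(A \<union> L) \<inter> (B \<union> f ` L) = {}" using AB(1) L1 grow.prems(2) by blast
  moreover have "(A \<union> L) \<union> (B \<union> f ` L) = ?V \<union> f ` ?V" using AB(2) by auto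
  ultimately show ?case by blast
qed

text \<open>Both ends of a matching edge have degree two, and \<open>b\<close> has only one
  neighbour of degree two, so its partner is \<open>p\<close>. Either end may lie in the copy of the
  tree, hence the disjunction.\<close>

lemma extremal_double_leaf:
  assumes ex: "extremal A B E" and k: "3 \<le> card B" and AB: "A \<inter> B = {}"
    and d: "is_double (A \<union> B) (undirected E) V S f"
    and pb: "(p, b) \<in> E" "deg E p = 2" "codeg E b = 2"
  shows "b \<in> leaf_set V S \<and> f b = p \<or> p \<in> leaf_set V S \<and> f p = b"
proof -
  have el: "elementary A B E" using ex by (rule extremal_elementary)
  note E = elementaryD[OF el]
  have pA: "p \<in> A" "b \<in> B" using pb E(5) by auto
  have "b \<in> deg2 B (E\<inverse>)" using pb pA by (simp add: deg2_def)
  then obtain a1 a2 where a12: "nb E {b} = {a1, a2}" "deg E a1 = 2" "3 \<le> deg E a2"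
    using extremal_deg2_nb[OF ex k] by blast
  have uniq: "x = p" if "(x, b) \<in> E" "deg E x = 2" for x
  proof -
    have "x \<in> {a1, a2}" "p \<in> {a1, a2}" using that(1) pb(1) a12(1) by blast+
    then show ?thesis using a12 that(2) pb(2) by auto
  qed
  have partner: "x = p" if x: "{x, b} \<in> undirected E" "card (incident (undirected E) x) = 2" for x
  proof -
    obtain u v where uv: "(u, v) \<in> E" "{x, b} = {u, v}" using x(1) unfolding undirected_def by auto
    then have "(x, b) \<in> E" "x \<in> A" using E(5) AB pA by (auto simp: doubleton_eq_iff)
    then show ?thesis using uniq card_incident_undirected[OF AB E(5)] x(2) by metis
  qed
  have b2: "card (incident (undirected E) b) = 2"
    using card_incident_undirected'[OF AB E(5) pA(2)] pb(3) by simp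
  have h: "undirected E = doubled V S f" "A \<union> B = V \<union> f ` V" using d by (auto simp: is_double_def)
  have lf: "{v, f v} \<in> undirected E" if "v \<in> leaf_set V S" for v using that h(1) by (auto simp: doubled_def)
  show ?thesis
  proof (cases "b \<in> V")
    case True
    then have bl: "b \<in> leaf_set V S" using card_incident_doubled(1)[OF d True] b2 by simp
    then have "card (incident (undirected E) (f b)) = 2" using card_incident_doubled(2)[OF d True] by simp
    then have "f b = p" using partner[of "f b"] lf[OF bl] by (simp add: insert_commute)
    then show ?thesis using bl by simp
  next
    case False
    then obtain x where x: "x \<in> V" "b = f x" using pA h(2) by blast
    then have xl: "x \<in> leaf_set V S" using card_incident_doubled(2)[OF d x(1)] b2 by simp
    then have "card (incident (undirected E) x) = 2" using card_incident_doubled(1)[OF d x(1)] by simp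
    then have "x = p" using partner[of x] lf[OF xl] x(2) by simp
    then show ?thesis using xl x by simp
  qed
qed

text \<open>In the 4-cycle both neighbours of \<open>b\<close> have degree two, so the degrees do
  not single out the matching edges; the double is built so that \<open>p b\<close> is one of
  them.\<close>

lemma K22_double:
  assumes "card A = 2" "card B = 2" "A \<inter> B = {}" "p \<in> A" "b \<in> B"
  shows "\<exists>V S f. is_double (A \<union> B) (undirected (A \<times> B)) V S f \<and> b \<in> leaf_set V S \<and> f b = p"
proof -
  obtain x where x: "A = {p, x}" "x \<noteq> p" using assms(1,4) by (metis card_2_iff insertE insert_commute singletonD)
  obtain y where y: "B = {b, y}" "y \<noteq> b" using assms(2,5) by (metis card_2_iff insertE insert_commute singletonD)
  have ne: "b \<noteq> x" "p \<noteq> b" "p \<noteq> y" "x \<noteq> y" using assms(3) x y by auto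
  define f where "f v = (if v = b then p else y)" for v
  have f: "f b = p" "f x = y" using ne by (auto simp: f_def)
  have lf: "leaf_set {b, x} {{b, x}} = {b, x}" by (rule leaf_set_edge)
  have "undirected (A \<times> B) = doubled {b, x} {{b, x}} f"
    unfolding doubled_def undirected_def lf x y using f by auto
  moreover have "inj_on f {b, x}" using f ne by auto
  moreover have "f ` {b, x} \<inter> {b, x} = {}" "A \<union> B = {b, x} \<union> f ` {b, x}" using f ne x y by auto
  ultimately have "is_double (A \<union> B) (undirected (A \<times> B)) {b, x} {{b, x}} f"
    using halin.edge[OF ne(1)] unfolding is_double_def by simp
  then show ?thesis using lf f by blast
qed

lemma cherry_double:
  fixes E :: "('v \<times> 'v) set"
  assumes ex: "extremal A B E" and AB: "A \<inter> B = {}" and ch: "cherry E b a L p m"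
    and IH: "\<And>A' B' (E' :: ('v \<times> 'v) set). card B' < card B \<Longrightarrow> extremal A' B' E' \<Longrightarrow> A' \<inter> B' = {} \<Longrightarrow>
      \<exists>V S f. is_double (A' \<union> B') (undirected E') V S f"
  shows "\<exists>V S f. is_double (A \<union> B) (undirected E) V S f"
proof -
  have el: "elementary A B E" using ex by (rule extremal_elementary)
  note E = elementaryD[OF el]
  have c: "nb E {b} = insert a L" "a \<notin> L" "2 \<le> card L" "p \<noteq> a" "p \<notin> L"
    and cl: "\<And>l. l \<in> L \<Longrightarrow> E `` {l} = {b, m l}" "\<And>l. l \<in> L \<Longrightarrow> m l \<noteq> b" "\<And>l. l \<in> L \<Longrightarrow> nb E {m l} = {l, p}"
    using ch by (auto simp: cherry_def)
  let ?A = "A - L" and ?B = "B - m ` L"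
  let ?F = "E \<inter> ?A \<times> ?B"
  have edges: "(a, b) \<in> E" "\<And>l. l \<in> L \<Longrightarrow> (l, b) \<in> E" "\<And>l. l \<in> L \<Longrightarrow> (l, m l) \<in> E" "\<And>l. l \<in> L \<Longrightarrow> (p, m l) \<in> E"
    using c(1) cl(1,3) by blast+
  obtain l0 where l0: "l0 \<in> L" using c(3) by fastforce
  have LA: "L \<subseteq> A" "m ` L \<subseteq> B" using edges E(5) by auto
  then have LA: "L \<subseteq> A" "m ` L \<subseteq> B" "finite L" using E(1) finite_subset by auto
  have mem: "a \<in> ?A" "p \<in> ?A" "b \<in> ?B" using edges l0 E(5) c cl(2) by auto
  have minj: "inj_on m L"
  proof (rule inj_onI)
    fix l l' assume l: "l \<in> L" "l' \<in> L" "m l = m l'"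
    then have "{l, p} = {l', p}" using cl(3)[OF l(1)] cl(3)[OF l(2)] by simp
    then show "l = l'" using c(5) l by (auto simp: doubleton_eq_iff)
  qed
  have pbE: "(p, b) \<notin> E"
  proof
    assume "(p, b) \<in> E"
    then have "p \<in> insert a L" using c(1) by blast
    then show False using c(4,5) by simp
  qed
  have ear: "ear_expansion ?A ?B p b L m"
    by unfold_locales (use E(1,2) LA mem minj l0 in auto)
  have Un: "?A \<union> L = A" "?B \<union> m ` L = B" using LA by auto
  have F: "?F \<subseteq> ?A \<times> ?B" "(p, b) \<notin> ?F" using pbE by auto
  have Eexp: "E = expand ?F p b L m"
  proof
    show "expand ?F p b L m \<subseteq> E" unfolding expand_def using edges by auto
    show "E \<subseteq> expand ?F p b L m"
    proof
      fix e assume e: "e \<in> E"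
      obtain x y where xy: "e = (x, y)" by (cases e)
      consider "x \<in> L" | "x \<notin> L" "y \<in> m ` L" | "x \<notin> L" "y \<notin> m ` L" by blast
      then show "e \<in> expand ?F p b L m"
      proof cases
        case 1
        then have "y \<in> {b, m x}" using cl(1)[OF 1] e xy by blast
        then show ?thesis using 1 xy unfolding expand_def by auto
      next
        case 2
        then obtain l where l: "l \<in> L" "y = m l" by blast
        then have "x \<in> {l, p}" using cl(3)[OF l(1)] e xy by blast
        then show ?thesis using 2 l xy unfolding expand_def by auto
      next
        case 3
        then show ?thesis using e xy E(5) unfolding expand_def by auto
      qed
    qed
  qed
  let ?E = "insert (p, b) ?F"
  have "nb ?E {b} = {p, a}"
  proof -
    have "nb ?F {b} = nb E {b} \<inter> ?A" using mem(3) by auto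
    also have "\<dots> = {a}" using c(1) mem(1) by auto
    finally show ?thesis by auto
  qed
  then have b2: "codeg ?E b = 2" using c(4) by simp
  have cards: "card A = card ?A + card L" "card B = card ?B + card L"
    using ear_expansion.cards[OF ear] Un by auto
  \<comment> \<open>The distinct vertices \<open>a\<close> and \<open>p\<close> survive the collapse
    and keep the classes from becoming too small.\<close>
  have "card {a, p} \<le> card ?A" using mem E(1) by (intro card_mono) auto
  then have k: "2 \<le> card ?B" using c(4) cards E(3) by simp
  have ex': "extremal (?A \<union> L) (?B \<union> m ` L) (expand ?F p b L m)" using ex Un Eexp by simp
  note col = ear_expansion.extremal_collapse[OF ear F c(3) k ex' b2]
  have el': "elementary ?A ?B ?E" using col(1) by (simp add: extremal_def minimal_elementary_def)
  have AB': "?A \<inter> ?B = {}" using AB by auto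
  have "\<exists>V S f. is_double (?A \<union> ?B) (undirected ?E) V S f \<and>
    (b \<in> leaf_set V S \<and> f b = p \<or> p \<in> leaf_set V S \<and> f p = b)"
  proof (cases "card ?B = 2")
    case True
    then have "card ?A = 2" "?E = ?A \<times> ?B" using elementary_K22[OF el'] elementaryD(3)[OF el'] by auto
    then show ?thesis using K22_double[OF _ True AB' mem(2,3)] by metis
  next
    case False
    then have k3: "3 \<le> card ?B" using k by simp
    have "card ?B < card B" using cards c(3) by simp
    then obtain V S f where d: "is_double (?A \<union> ?B) (undirected ?E) V S f"
      using IH col(1) AB' by metis
    have p2: "deg ?E p = 2" using col(2) by (simp add: deg2_def)
    show ?thesis using extremal_double_leaf[OF col(1) k3 AB' d _ p2 b2] d by blast
  qed
  then obtain V S f where d: "is_double (?A \<union> ?B) (undirected ?E) V S f"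
    and lf: "b \<in> leaf_set V S \<and> f b = p \<or> p \<in> leaf_set V S \<and> f p = b" by blast
  have und: "undirected E = (undirected ?E - {{p, b}}) \<union> star b L \<union> (\<lambda>l. {p, m l}) ` L \<union> (\<lambda>l. {l, m l}) ` L"
    using undirected_expand[OF AB' F(1) mem(2,3) F(2), of L m] Eexp by simp
  have LU: "L \<inter> (?A \<union> ?B) = {}" "m ` L \<inter> (?A \<union> ?B) = {}" "m ` L \<inter> L = {}" using LA AB by auto
  have U: "(?A \<union> ?B) \<union> (L \<union> m ` L) = A \<union> B" using LA by auto
  from lf show ?thesis
  proof
    assume b: "b \<in> leaf_set V S \<and> f b = p"
    then have "{b, f b} = {p, b}" by auto
    then show ?thesis
      using is_double_grow[OF d conjunct1[OF b] LA(3) c(3) LU(1) minj LU(2,3)] b unfolding U und by simp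
  next
    \<comment> \<open>Here \<open>p\<close> lies in the tree and \<open>b\<close> in its copy, so
      the vertices \<open>m l\<close> become the new leaves of the tree and the matching is the
      inverse of \<open>m\<close>.\<close>
    assume p: "p \<in> leaf_set V S \<and> f p = b"
    let ?g = "inv_into L m"
    have g: "?g ` m ` L = L" "inj_on ?g (m ` L)" using minj by (auto simp: inj_on_inv_into image_image inv_into_f_f)
    have g': "?g (m l) = l" if "l \<in> L" for l using minj that by simp
    have c2: "2 \<le> card (m ` L)" using c(3) card_image[OF minj] by simp
    have "(\<lambda>l. {f p, ?g l}) ` m ` L = star b L" "(\<lambda>l. {l, ?g l}) ` m ` L = (\<lambda>l. {l, m l}) ` L"
      "(\<lambda>l. {p, l}) ` m ` L = (\<lambda>l. {p, m l}) ` L"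
      unfolding image_image using g' p by (auto intro!: image_cong simp: insert_commute)
    moreover have "?g ` m ` L \<inter> (?A \<union> ?B) = {}" "?g ` m ` L \<inter> m ` L = {}" unfolding g(1) using LU by auto
    moreover have "{p, f p} = {p, b}" using p by simp
    moreover have "(?A \<union> ?B) \<union> (m ` L \<union> ?g ` m ` L) = A \<union> B" unfolding g(1) using U by auto
    moreover have "undirected E = (undirected ?E - {{p, b}}) \<union> (\<lambda>l. {p, m l}) ` L \<union> star b L \<union> (\<lambda>l. {l, m l}) ` L"
      unfolding und by auto
    ultimately show ?thesis
      using is_double_grow[OF d conjunct1[OF p] finite_imageI[OF LA(3)] c2 LU(2) g(2)] by simp
  qed
qed

lemma extremal_imp_doubled:
  fixes E :: "('v \<times> 'v) set"
  assumes "extremal A B E" "A \<inter> B = {}"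
  shows "\<exists>V S f. is_double (A \<union> B) (undirected E) V S f"
  using assms
proof (induction "card B" arbitrary: A B E rule: less_induct)
  case less
  note ex = less.prems(1) and AB = less.prems(2)
  have el: "elementary A B E" using ex by (rule extremal_elementary)
  note E = elementaryD[OF el]
  show ?case
  proof (cases "card B = 2")
    case True
    then have "A \<noteq> {}" "B \<noteq> {}" using E(3) by (metis card.empty zero_neq_numeral)+
    then obtain p b where "p \<in> A" "b \<in> B" by blast
    then show ?thesis
      using K22_double[OF _ True AB] elementary_K22[OF el True] E(3) True by metis
  next
    case False
    then have k: "3 \<le> card B" using E(4) by simp
    from extremal_ex_cherry[OF ex k] show ?thesis
    proof
      assume "\<exists>b a L p m. cherry E b a L p m"
      then obtain b a L p m where "cherry E b a L p m" by blast
      from cherry_double[OF ex AB this less.hyps] show ?thesis by blast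
    next
      assume "\<exists>b a L p m. cherry (E\<inverse>) b a L p m"
      then obtain b a L p m where ch: "cherry (E\<inverse>) b a L p m" by blast
      have "B \<inter> A = {}" using AB by auto
      have "\<exists>V S f. is_double (B \<union> A) (undirected (E\<inverse>)) V S f"
      proof (rule cherry_double[OF extremal_dual[OF ex] \<open>B \<inter> A = {}\<close> ch])
        fix A' B' and E' :: "('v \<times> 'v) set"
        assume "card B' < card A" "extremal A' B' E'" "A' \<inter> B' = {}"
        then show "\<exists>V S f. is_double (A' \<union> B') (undirected E') V S f"
          using less.hyps[of B' A' E'] E(3) by simp
      qed
      then show ?thesis by (simp add: undirected_converse Un_commute)
    qed
  qed
qed

section \<open>Matching covered multigraphs\<close>

text \<open>The vertices reachable from a given one form a set that no edge leaves. Cuts replace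
  walks from here on, because neighbourhood counts speak of edges leaving a set.\<close>

lemma connected_graph_iff_cut:
  assumes "multigraph G"
  shows "connected_graph G \<longleftrightarrow> verts G \<noteq> {} \<and>
    (\<forall>U\<subseteq>verts G. U \<noteq> {} \<longrightarrow> U \<noteq> verts G \<longrightarrow> (\<exists>e\<in>edges G. ends G e \<inter> U \<noteq> {} \<and> ends G e \<inter> (verts G - U) \<noteq> {}))"
    (is "_ \<longleftrightarrow> _ \<and> ?cut")
proof -
  have E: "ends G e \<subseteq> verts G" "card (ends G e) = 2" if "e \<in> edges G" for e
    using assms that by (auto simp: multigraph_def)
  have "?cut" if con: "connected_graph G"
  proof (intro allI impI)
    fix U assume U: "U \<subseteq> verts G" "U \<noteq> {}" "U \<noteq> verts G"
    then obtain u v where uv: "u \<in> U" "v \<in> verts G" "v \<notin> U" by blast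
    show "\<exists>e\<in>edges G. ends G e \<inter> U \<noteq> {} \<and> ends G e \<inter> (verts G - U) \<noteq> {}"
    proof (rule ccontr)
      assume no: "\<not> ?thesis"
      have "w \<in> U" if "(u, w) \<in> (adjacency G)\<^sup>*" for w
        using that
      proof induction
        case (step w z)
        then obtain e where e: "e \<in> edges G" "ends G e = {w, z}" by (auto simp: adjacency_def)
        then show ?case using no step.IH E(1)[OF e(1)] by blast
      qed (use uv in auto)
      moreover have "(u, v) \<in> (adjacency G)\<^sup>*" using con uv U by (auto simp: connected_graph_def)
      ultimately show False using uv by blast
    qed
  qed
  moreover have "(u, v) \<in> (adjacency G)\<^sup>*" if cut: ?cut and u: "u \<in> verts G" and v: "v \<in> verts G" for u v
  proof (rule ccontr)
    assume no: "(u, v) \<notin> (adjacency G)\<^sup>*"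
    let ?U = "{w \<in> verts G. (u, w) \<in> (adjacency G)\<^sup>*}"
    have "?U \<subseteq> verts G" "u \<in> ?U" "v \<notin> ?U" using no u by auto
    then obtain e where e: "e \<in> edges G" "ends G e \<inter> ?U \<noteq> {}" "ends G e \<inter> (verts G - ?U) \<noteq> {}"
      using cut v by (metis (no_types, lifting) empty_iff)
    then obtain x y where xy: "x \<in> ends G e" "x \<in> ?U" "y \<in> ends G e" "y \<in> verts G" "y \<notin> ?U" by blast
    obtain s t where "ends G e = {s, t}" using E(2)[OF e(1)] by (meson card_2_iff)
    then have "ends G e = {x, y}" using xy by auto
    then have "(x, y) \<in> adjacency G" using e(1) by (auto simp: adjacency_def)
    then have "y \<in> ?U" using xy by (auto intro: rtrancl_into_rtrancl)
    then show False using xy by blast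
  qed
  moreover have "verts G \<noteq> {}" if "connected_graph G" using that by (simp add: connected_graph_def)
  ultimately show ?thesis unfolding connected_graph_def by (metis (no_types, lifting))
qed

text \<open>Hall's theorem. A nonempty proper set with equality is matched by itself and the rest is
  matched outside its neighbourhood; if there is none, all such sets have slack one and an arbitrary
  edge may be fixed.\<close>

lemma hall:
  assumes "finite B" "finite E" "\<And>Y. Y \<subseteq> B \<Longrightarrow> card Y \<le> card (nb E Y)"
  shows "\<exists>g. inj_on g B \<and> (\<forall>y\<in>B. (g y, y) \<in> E)"
  using assms
proof (induction "card B" arbitrary: B E rule: less_induct)
  case less
  note fin = less.prems(1,2) and le = less.prems(3)
  have finE: "finite (nb F Y)" if "F \<subseteq> E" for F Y
    using finite_Image[of "F\<inverse>" Y] finite_subset[OF that fin(2)] by simp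
  show ?case
  proof (cases "\<exists>Y\<subseteq>B. Y \<noteq> {} \<and> Y \<noteq> B \<and> card (nb E Y) = card Y")
    case True
    then obtain Y0 where Y0: "Y0 \<subseteq> B" "Y0 \<noteq> {}" "Y0 \<noteq> B" "card (nb E Y0) = card Y0" by blast
    have f0: "finite Y0" using Y0 fin finite_subset by blast
    have lt: "card Y0 < card B" "card (B - Y0) < card B"
      using Y0 fin by (auto intro!: psubset_card_mono)
    obtain g1 where g1: "inj_on g1 Y0" "\<forall>y\<in>Y0. (g1 y, y) \<in> E"
      using less.hyps[OF lt(1) f0 fin(2)] le Y0(1) by (meson subset_trans)
    let ?F = "E - nb E Y0 \<times> UNIV"
    have "card Y \<le> card (nb ?F Y)" if Y: "Y \<subseteq> B - Y0" for Y
    proof -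
      have fY: "finite Y" using Y fin(1) by (meson finite_Diff finite_subset)
      have "Y \<inter> Y0 = {}" using Y by blast
      then have "card Y + card Y0 = card (Y \<union> Y0)" using fY f0 by (simp add: card_Un_disjoint)
      also have "\<dots> \<le> card (nb E (Y \<union> Y0))" using le[of "Y \<union> Y0"] Y Y0(1) by blast
      also have "\<dots> \<le> card (nb ?F Y \<union> nb E Y0)" using finE[of E] finE[of ?F] by (intro card_mono) auto
      also have "\<dots> \<le> card (nb ?F Y) + card (nb E Y0)" by (rule card_Un_le)
      finally show ?thesis using Y0(4) by simp
    qed
    moreover have "finite (B - Y0)" "finite ?F" using fin by auto
    ultimately obtain g2 where g2: "inj_on g2 (B - Y0)" "\<forall>y\<in>B - Y0. (g2 y, y) \<in> ?F"
      using less.hyps[OF lt(2), of ?F] by (metis (no_types, lifting))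
    let ?g = "\<lambda>y. if y \<in> Y0 then g1 y else g2 y"
    have ne: "g1 y \<noteq> g2 z" if "y \<in> Y0" "z \<in> B - Y0" for y z
    proof -
      have "g1 y \<in> nb E Y0" using g1(2) that(1) by auto
      moreover have "g2 z \<notin> nb E Y0" using g2(2) that(2) by auto
      ultimately show ?thesis by metis
    qed
    have "inj_on ?g B"
    proof (rule inj_onI)
      fix y z assume "y \<in> B" "z \<in> B" "?g y = ?g z"
      then show "y = z" using g1(1) g2(1) ne[of y z] ne[of z y] by (auto simp: inj_on_def split: if_splits)
    qed
    moreover have "\<forall>y\<in>B. (?g y, y) \<in> E" using g1(2) g2(2) by auto
    ultimately show ?thesis by blast
  next
    case False
    show ?thesis
    proof (cases "B = {}")
      case ne: False
      then obtain y where y: "y \<in> B" by blast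
      have "card {y} \<le> codeg E y" using le[of "{y}"] y by simp
      then have "nb E {y} \<noteq> {}" by (metis card.empty card_insert_disjoint empty_iff finite.emptyI not_less_eq_eq zero_le)
      then obtain x where x: "(x, y) \<in> E" by auto
      let ?F = "E - {x} \<times> UNIV"
      have "card Y \<le> card (nb ?F Y)" if Y: "Y \<subseteq> B - {y}" for Y
      proof (cases "Y = {}")
        case Yn: False
        have "Y \<subseteq> B" "Y \<noteq> B" using Y y by auto
        then have "card Y < card (nb E Y)" using le[of Y] False Yn by (metis le_neq_implies_less)
        also have "\<dots> \<le> card (insert x (nb ?F Y))" using finE[of ?F] by (intro card_mono) auto
        also have "\<dots> \<le> Suc (card (nb ?F Y))" by (rule card_insert_le_m1) auto
        finally show ?thesis by simp
      qed simp
      moreover have "card (B - {y}) < card B" using y fin(1) by (intro psubset_card_mono) auto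
      moreover have "finite (B - {y})" "finite ?F" using fin by auto
      ultimately obtain g where g: "inj_on g (B - {y})" "\<forall>z\<in>B - {y}. (g z, z) \<in> ?F"
        using less.hyps by blast
      have "inj_on (g(y := x)) B" using g by (auto simp: inj_on_def)
      moreover have "\<forall>z\<in>B. ((g(y := x)) z, z) \<in> E" using g(2) x by auto
      ultimately show ?thesis by blast
    qed simp
  qed
qed

section \<open>Perfect matchings and the surplus condition\<close>

definition bipartition :: "('v, 'e) graph \<Rightarrow> 'v set \<Rightarrow> 'v set \<Rightarrow> bool" where
  "bipartition G A B \<longleftrightarrow> A \<union> B = verts G \<and> A \<inter> B = {} \<and>
     (\<forall>e\<in>edges G. \<exists>a\<in>A. \<exists>b\<in>B. ends G e = {a, b})"

definition edge_rel :: "('v, 'e) graph \<Rightarrow> 'v set \<Rightarrow> 'v set \<Rightarrow> ('v \<times> 'v) set" where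
  "edge_rel G A B = {(a, b) \<in> A \<times> B. {a, b} \<in> ends G ` edges G}"

lemma perfect_matching_bij:
  assumes bp: "bipartition G A B" and M: "perfect_matching G M"
  shows "\<exists>g. bij_betw g B A \<and> (\<forall>y\<in>B. (g y, y) \<in> edge_rel G A B) \<and>
    (\<forall>e\<in>M. \<forall>a\<in>A. \<forall>b\<in>B. ends G e = {a, b} \<longrightarrow> g b = a)"
proof -
  have AB: "A \<union> B = verts G" "A \<inter> B = {}" "\<And>e. e \<in> edges G \<Longrightarrow> \<exists>a\<in>A. \<exists>b\<in>B. ends G e = {a, b}"
    using bp by (auto simp: bipartition_def)
  have Me: "M \<subseteq> edges G" and Mu: "\<And>v. v \<in> verts G \<Longrightarrow> \<exists>!e. e \<in> M \<and> v \<in> ends G e"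
    using M by (auto simp: perfect_matching_def)
  have "\<exists>a. a \<in> A \<and> (\<exists>e\<in>M. ends G e = {a, b})" if b: "b \<in> B" for b
  proof -
    obtain e where e: "e \<in> M" "b \<in> ends G e" using Mu[of b] b AB(1) by blast
    then obtain a b' where "a \<in> A" "b' \<in> B" "ends G e = {a, b'}" using AB(3) Me by blast
    then show ?thesis using e b AB(2) by auto
  qed
  then obtain g where g: "\<And>b. b \<in> B \<Longrightarrow> g b \<in> A \<and> (\<exists>e\<in>M. ends G e = {g b, b})" by metis
  have uniq: "g b = a" if e: "e \<in> M" "a \<in> A" "b \<in> B" "ends G e = {a, b}" for e a b
  proof -
    obtain e' where e': "e' \<in> M" "ends G e' = {g b, b}" using g[OF e(3)] by blast
    have "e' = e" using Mu[of b] e e' AB(1) by blast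
    then show ?thesis using e e' g[OF e(3)] by (auto simp: doubleton_eq_iff)
  qed
  have inj: "inj_on g B"
  proof (rule inj_onI)
    fix b b' assume b: "b \<in> B" "b' \<in> B" "g b = g b'"
    obtain e e' where e: "e \<in> M" "ends G e = {g b, b}" "e' \<in> M" "ends G e' = {g b', b'}"
      using g b(1,2) by meson
    have "g b \<in> verts G" using g[OF b(1)] AB(1) by blast
    then have "e = e'" using Mu[of "g b"] e b(3) by blast
    then show "b = b'" using e b(3) by (auto simp: doubleton_eq_iff)
  qed
  have "A \<subseteq> g ` B"
  proof
    fix a assume a: "a \<in> A"
    then obtain e where e: "e \<in> M" "a \<in> ends G e" using Mu[of a] AB(1) by blast
    then obtain a' b where ab: "a' \<in> A" "b \<in> B" "ends G e = {a', b}" using AB(3) Me by blast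
    then have "a = a'" using e(2) a AB(2) by auto
    then show "a \<in> g ` B" using uniq[OF e(1) ab] ab(2) by blast
  qed
  then have "bij_betw g B A" using inj g by (auto simp: bij_betw_def)
  moreover have "\<forall>y\<in>B. (g y, y) \<in> edge_rel G A B" using g Me unfolding edge_rel_def by fastforce
  ultimately show ?thesis using uniq by blast
qed

text \<open>If \<open>Y\<close> has no surplus, every perfect matching pairs \<open>Y\<close> with
  its whole neighbourhood, so an edge from there to \<open>B - Y\<close> lies in none; connectedness
  supplies such an edge. Conversely, a surplus of one absorbs the removal of \<open>a\<close>, so
  Hall's condition lets \<open>ab\<close> be extended to a perfect matching.\<close>

lemma matching_covered_iff_elementary:
  assumes mg: "multigraph G" and bp: "bipartition G A B"
  shows "matching_covered G \<longleftrightarrow> elementary A B (edge_rel G A B)"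
proof
  let ?E = "edge_rel G A B"
  have AB: "A \<union> B = verts G" "A \<inter> B = {}" "\<And>e. e \<in> edges G \<Longrightarrow> \<exists>a\<in>A. \<exists>b\<in>B. ends G e = {a, b}"
    using bp by (auto simp: bipartition_def)
  have fin: "finite A" "finite B" "finite (verts G)" using mg AB(1) unfolding multigraph_def by (metis finite_Un)+
  have EAB: "?E \<subseteq> A \<times> B" by (auto simp: edge_rel_def)
  then have finE: "finite ?E" using fin by (meson finite_SigmaI finite_subset)
  have edge: "(a, b) \<in> ?E" if "e \<in> edges G" "a \<in> A" "b \<in> B" "ends G e = {a, b}" for e a b
    using that unfolding edge_rel_def by force
  have cV: "card (verts G) = card A + card B" using AB fin card_Un_disjoint by metis
  {
    assume mc: "matching_covered G"
    then have cut: "\<exists>e\<in>edges G. ends G e \<inter> U \<noteq> {} \<and> ends G e \<inter> (verts G - U) \<noteq> {}"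
      if "U \<subseteq> verts G" "U \<noteq> {}" "U \<noteq> verts G" for U
      using that connected_graph_iff_cut[OF mg] by (auto simp: matching_covered_def)
    have c4: "4 \<le> card (verts G)" and pm: "\<And>e. e \<in> edges G \<Longrightarrow> \<exists>M. perfect_matching G M \<and> e \<in> M"
      using mc by (auto simp: matching_covered_def)
    obtain v where v: "v \<in> verts G" using c4 by fastforce
    have "card {v} \<noteq> card (verts G)" using c4 by simp
    then have "{v} \<noteq> verts G" by metis
    then obtain e0 where "e0 \<in> edges G" using cut[of "{v}"] v by blast
    then obtain M where "perfect_matching G M" using pm by blast
    then obtain g where g: "bij_betw g B A" "\<forall>y\<in>B. (g y, y) \<in> ?E"
      using perfect_matching_bij[OF bp] by blast
    have cAB: "card A = card B" using bij_betw_same_card[OF g(1)] by simp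
    have "card Y < card (nb ?E Y)" if Y: "Y \<subseteq> B" "Y \<noteq> {}" "Y \<noteq> B" for Y
    proof (rule ccontr)
      assume nl: "\<not> ?thesis"
      have finY: "finite (nb ?E Y)" using finE by (intro finite_Image) simp
      have onto: "g' ` Y = nb ?E Y" if g': "bij_betw g' B A" "\<forall>y\<in>B. (g' y, y) \<in> ?E" for g'
      proof -
        have "g' ` Y \<subseteq> nb ?E Y" using g'(2) Y(1) by auto
        moreover have "card (g' ` Y) = card Y"
          using g'(1) Y(1) by (intro card_image) (auto simp: bij_betw_def intro: inj_on_subset)
        ultimately show ?thesis using nl finY by (intro card_seteq) auto
      qed
      let ?U = "nb ?E Y \<union> Y"
      have "nb ?E Y \<subseteq> A" using EAB by auto
      then have "?U \<inter> B = Y" "?U \<subseteq> verts G" using Y(1) AB(1,2) by auto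
      moreover have "verts G \<inter> B = B" using AB(1) by auto
      ultimately have "?U \<subseteq> verts G" "?U \<noteq> {}" "?U \<noteq> verts G" using Y(2,3) by auto
      then obtain e where e: "e \<in> edges G" "ends G e \<inter> ?U \<noteq> {}" "ends G e \<inter> (verts G - ?U) \<noteq> {}"
        using cut by meson
      obtain a b where ab: "a \<in> A" "b \<in> B" "ends G e = {a, b}" using AB(3)[OF e(1)] by blast
      have abE: "(a, b) \<in> ?E" using edge[OF e(1) ab] .
      have aU: "a \<in> ?U \<longleftrightarrow> a \<in> nb ?E Y" "b \<in> ?U \<longleftrightarrow> b \<in> Y"
        using ab Y(1) AB(2) \<open>nb ?E Y \<subseteq> A\<close> by auto
      have "b \<in> Y \<Longrightarrow> a \<in> nb ?E Y" using abE by auto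
      then have cr: "a \<in> nb ?E Y" "b \<notin> Y" using e(2,3) ab(3) aU by auto
      obtain M' where M': "perfect_matching G M'" "e \<in> M'" using pm[OF e(1)] by blast
      obtain g' where g': "bij_betw g' B A" "\<forall>y\<in>B. (g' y, y) \<in> ?E"
        "\<forall>e\<in>M'. \<forall>a\<in>A. \<forall>b\<in>B. ends G e = {a, b} \<longrightarrow> g' b = a"
        using perfect_matching_bij[OF bp M'(1)] by blast
      have "g' b = a" using g'(3) M'(2) ab by blast
      moreover have "a \<in> g' ` Y" using onto[OF g'(1,2)] cr(1) by simp
      then obtain y where "y \<in> Y" "g' y = a" by blast
      ultimately have "y = b" using g'(1) ab(2) Y(1) unfolding bij_betw_def inj_on_def by blast
      then show False using \<open>y \<in> Y\<close> cr(2) by blast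
    qed
    then show "elementary A B ?E" using fin cAB EAB c4 cV unfolding elementary_def by auto
  next
    assume el: "elementary A B ?E"
    note E = elementaryD[OF el]
    have ne: "verts G \<noteq> {}" using E(4) AB(1) by auto
    have cut: "\<exists>e\<in>edges G. ends G e \<inter> U \<noteq> {} \<and> ends G e \<inter> (verts G - U) \<noteq> {}"
      if U: "U \<subseteq> verts G" "U \<noteq> {}" "U \<noteq> verts G" for U
    proof (rule ccontr)
      assume no: "\<not> ?thesis"
      have same: "a \<in> U \<longleftrightarrow> b \<in> U" if "(a, b) \<in> ?E" for a b
      proof -
        obtain e where "e \<in> edges G" "ends G e = {a, b}" using \<open>(a, b) \<in> ?E\<close> unfolding edge_rel_def by fastforce
        moreover have "a \<in> verts G" "b \<in> verts G" using that EAB AB(1) by auto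
        ultimately show ?thesis using no by blast
      qed
      \<comment> \<open>If no edge leaves \<open>U\<close>, the two parts of \<open>B\<close> have
        disjoint neighbourhoods, and two strict surpluses do not fit into
        \<open>card A = card B\<close>.\<close>
      have sub: "nb ?E (U \<inter> B) \<subseteq> U \<inter> A" "nb ?E (B - U) \<subseteq> A - U" using same EAB by auto
      have "U \<inter> B \<noteq> {}"
      proof
        assume n: "U \<inter> B = {}"
        then obtain a where a: "a \<in> U" "a \<in> A" using U AB(1) by blast
        have "2 \<le> deg ?E a" using elementary_degree(1)[OF el a(2)] .
        then obtain b where b: "(a, b) \<in> ?E" using ex_other_nbr[of "?E `` {a}"] by auto
        then have "b \<in> U" "b \<in> B" using same[OF b] a(1) EAB by auto
        then show False using n by blast
      qed
      moreover have "U \<inter> B \<noteq> B"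
      proof
        assume "U \<inter> B = B"
        then have "A \<subseteq> U" "B \<subseteq> U" using sub(1) elementary_nb_all[OF el] by auto
        then show False using U AB(1) by blast
      qed
      ultimately have "card (U \<inter> B) < card (nb ?E (U \<inter> B))" "card (B - U) < card (nb ?E (B - U))"
        using elementary_surplus[OF el, of "U \<inter> B"] elementary_surplus[OF el, of "B - U"] by auto
      moreover have "card (nb ?E (U \<inter> B)) \<le> card (U \<inter> A)" "card (nb ?E (B - U)) \<le> card (A - U)"
        using sub fin by (auto intro!: card_mono)
      moreover have "card B = card (U \<inter> B) + card (B - U)" "card A = card (U \<inter> A) + card (A - U)"
        using fin by (simp_all add: Int_commute card_Int_Diff)
      ultimately show False using E(3) by linarith
    qed
    have "connected_graph G"
      by (intro iffD2[OF connected_graph_iff_cut[OF mg]] conjI allI impI ne cut)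
    moreover have "4 \<le> card (verts G)" using cV E(3,4) by simp
    moreover have "\<exists>M. perfect_matching G M \<and> e \<in> M" if e: "e \<in> edges G" for e
    proof -
      obtain a b where ab: "a \<in> A" "b \<in> B" "ends G e = {a, b}" using AB(3)[OF e] by blast
      let ?F = "?E - {a} \<times> UNIV"
      have "card Y \<le> card (nb ?F Y)" if Y: "Y \<subseteq> B - {b}" for Y
      proof (cases "Y = {}")
        case False
        have "Y \<subseteq> B" "Y \<noteq> B" using Y ab by auto
        then have "card Y < card (nb ?E Y)" using elementary_surplus[OF el] False by blast
        also have "\<dots> \<le> card (insert a (nb ?F Y))"
          using finite_Image[of "?F\<inverse>" Y] finE by (intro card_mono) auto
        also have "\<dots> \<le> Suc (card (nb ?F Y))" by (rule card_insert_le_m1) auto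
        finally show ?thesis by simp
      qed simp
      moreover have "finite (B - {b})" "finite ?F" using fin finE by auto
      ultimately obtain g0 where g0: "inj_on g0 (B - {b})" "\<forall>y\<in>B - {b}. (g0 y, y) \<in> ?F"
        using hall[of "B - {b}" ?F] by blast
      define g where "g = g0(b := a)"
      have gE: "(g y, y) \<in> ?E" if "y \<in> B" for y using that g0(2) edge[OF e ab] unfolding g_def by auto
      have ginj: "inj_on g B" using g0 unfolding g_def by (auto simp: inj_on_def)
      have "g ` B \<subseteq> A" using gE EAB by blast
      then have gsurj: "g ` B = A" using card_seteq[OF fin(1)] card_image[OF ginj] E(3) by simp
      have "\<exists>d\<in>edges G. ends G d = {g y, y} \<and> (y = b \<longrightarrow> d = e)" if "y \<in> B" for y
      proof (cases "y = b")
        case True then show ?thesis using e ab by (auto simp: g_def)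
      next
        case False
        then show ?thesis using gE[OF that] unfolding edge_rel_def by fastforce
      qed
      then obtain d where d: "\<And>y. y \<in> B \<Longrightarrow> d y \<in> edges G \<and> ends G (d y) = {g y, y} \<and> (y = b \<longrightarrow> d y = e)" by metis
      have gA: "g y \<in> A" if "y \<in> B" for y using gsurj that by blast
      have "perfect_matching G (d ` B)"
        unfolding perfect_matching_def
      proof (intro conjI ballI)
        show "d ` B \<subseteq> edges G" using d by auto
        fix v assume "v \<in> verts G"
        then consider "v \<in> B" "v \<notin> A" | "v \<in> A" "v \<notin> B" using AB(1,2) by blast
        then have "\<exists>y\<in>B. \<forall>z\<in>B. v \<in> ends G (d z) \<longleftrightarrow> z = y"
        proof cases
          case 1 then show ?thesis using d gA by (intro bexI[of _ v]) auto
        next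
          case 2
          then obtain y where "y \<in> B" "v = g y" using gsurj by blast
          then show ?thesis using d ginj 2 by (intro bexI[of _ y]) (auto simp: inj_on_def)
        qed
        then obtain y where y: "y \<in> B" "\<And>z. z \<in> B \<Longrightarrow> v \<in> ends G (d z) \<longleftrightarrow> z = y" by blast
        then show "\<exists>!e. e \<in> d ` B \<and> v \<in> ends G e" by (intro ex1I[of _ "d y"]) auto
      qed
      moreover have "e \<in> d ` B" using d[OF ab(2)] ab(2) by force
      ultimately show ?thesis by blast
    qed
    ultimately show "matching_covered G" unfolding matching_covered_def by blast
  }
qed

lemma edge_rel_undirected:
  assumes "bipartition G A B"
  shows "undirected (edge_rel G A B) = ends G ` edges G"
proof
  show "undirected (edge_rel G A B) \<subseteq> ends G ` edges G" unfolding undirected_def edge_rel_def by auto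
  show "ends G ` edges G \<subseteq> undirected (edge_rel G A B)"
  proof
    fix s assume s: "s \<in> ends G ` edges G"
    then obtain a b where "a \<in> A" "b \<in> B" "s = {a, b}" using assms unfolding bipartition_def by blast
    then show "s \<in> undirected (edge_rel G A B)" using s unfolding undirected_def edge_rel_def by auto
  qed
qed

text \<open>Deleting one of two parallel edges leaves \<open>edge_rel\<close> unchanged, so a
  minimal graph is simple. In a simple graph deleting an edge removes one pair from the
  relation.\<close>

lemma minimal_matching_covered_iff:
  assumes mg: "multigraph G" and bp: "bipartition G A B"
  shows "minimal_matching_covered G \<longleftrightarrow> inj_on (ends G) (edges G) \<and> minimal_elementary A B (edge_rel G A B)"
proof -
  let ?E = "edge_rel G A B"
  have del: "multigraph (delete_edge G e)" "bipartition (delete_edge G e) A B" for e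
    using mg bp by (auto simp: multigraph_def bipartition_def delete_edge_def)
  have iff: "matching_covered (delete_edge G e) \<longleftrightarrow> elementary A B (edge_rel (delete_edge G e) A B)" for e
    using matching_covered_iff_elementary[OF del] .
  have iff0: "matching_covered G \<longleftrightarrow> elementary A B ?E" using matching_covered_iff_elementary[OF mg bp] .
  have AB: "A \<inter> B = {}" "\<And>e. e \<in> edges G \<Longrightarrow> \<exists>a\<in>A. \<exists>b\<in>B. ends G e = {a, b}"
    using bp by (auto simp: bipartition_def)
  have rel_del: "edge_rel (delete_edge G e) A B = ?E - {(a, b)}"
    if inj: "inj_on (ends G) (edges G)" and e: "e \<in> edges G" "a \<in> A" "b \<in> B" "ends G e = {a, b}" for e a b
  proof -
    have "ends G ` (edges G - {e}) = ends G ` edges G - {{a, b}}"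
      using inj_on_image_set_diff[OF inj, of "edges G" "{e}"] e by auto
    moreover have "{x, y} = {a, b} \<longleftrightarrow> (x, y) = (a, b)" if "x \<in> A" "y \<in> B" for x y
      using that e AB(1) by (auto simp: doubleton_eq_iff)
    ultimately have "{x, y} \<in> ends G ` (edges G - {e}) \<longleftrightarrow> {x, y} \<in> ends G ` edges G \<and> (x, y) \<noteq> (a, b)"
      if "x \<in> A" "y \<in> B" for x y using that by simp
    then have "(x, y) \<in> edge_rel (delete_edge G e) A B \<longleftrightarrow> (x, y) \<in> ?E - {(a, b)}" for x y
      unfolding edge_rel_def delete_edge_def by (cases "x \<in> A \<and> y \<in> B") auto
    then show ?thesis by (simp add: set_eq_iff split_paired_All)
  qed
  show ?thesis
  proof
    assume m: "minimal_matching_covered G"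
    then have el: "elementary A B ?E" and no: "\<And>e. e \<in> edges G \<Longrightarrow> \<not> elementary A B (edge_rel (delete_edge G e) A B)"
      using iff iff0 by (auto simp: minimal_matching_covered_def)
    have inj: "inj_on (ends G) (edges G)"
    proof (rule inj_onI, rule ccontr)
      fix e d assume ed: "e \<in> edges G" "d \<in> edges G" "ends G e = ends G d" "e \<noteq> d"
      have "ends G x \<in> ends G ` (edges G - {e})" if "x \<in> edges G" for x
        using that ed by (cases "x = e") auto
      then have "ends G ` (edges G - {e}) = ends G ` edges G" by auto
      then have "edge_rel (delete_edge G e) A B = ?E" unfolding edge_rel_def delete_edge_def by simp
      then show False using no[OF ed(1)] el by simp
    qed
    have "\<not> elementary A B (?E - {x})" if x: "x \<in> ?E" for x
    proof -
      obtain a b e where "x = (a, b)" "a \<in> A" "b \<in> B" "e \<in> edges G" "ends G e = {a, b}"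
        using x unfolding edge_rel_def by fastforce
      then show ?thesis using no rel_del[OF inj] by metis
    qed
    then show "inj_on (ends G) (edges G) \<and> minimal_elementary A B ?E"
      using inj el by (auto simp: minimal_elementary_def)
  next
    assume a: "inj_on (ends G) (edges G) \<and> minimal_elementary A B ?E"
    have "\<not> matching_covered (delete_edge G e)" if e: "e \<in> edges G" for e
    proof -
      obtain x y where xy: "x \<in> A" "y \<in> B" "ends G e = {x, y}" using AB(2)[OF e] by blast
      then have "{x, y} \<in> ends G ` edges G" using e by (metis imageI)
      then have "(x, y) \<in> ?E" using xy unfolding edge_rel_def by simp
      then show ?thesis using a iff rel_del[OF _ e xy] by (auto simp: minimal_elementary_def)
    qed
    then show "minimal_matching_covered G"
      using a iff0 by (auto simp: minimal_matching_covered_def minimal_elementary_def)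
  qed
qed

lemma degree_incident:
  assumes "inj_on (ends G) (edges G)"
  shows "degree G v = card (incident (ends G ` edges G) v)"
proof -
  have "incident (ends G ` edges G) v = ends G ` {e \<in> edges G. v \<in> ends G e}" by (auto simp: incident_def)
  moreover have "inj_on (ends G) {e \<in> edges G. v \<in> ends G e}" using assms by (rule inj_on_subset) auto
  ultimately show ?thesis by (simp add: degree_def card_image)
qed

text \<open>The extremal equation is the sum of the bounds of the two classes, and a sum of two
  valid inequalities is tight only if both are.\<close>

lemma extremal_iff:
  assumes mg: "multigraph G" and bp: "bipartition G A B"
  shows "minimal_matching_covered G \<and> two_vertex_extremal G \<longleftrightarrow>
    inj_on (ends G) (edges G) \<and> extremal A B (edge_rel G A B)"
proof (cases "inj_on (ends G) (edges G) \<and> minimal_elementary A B (edge_rel G A B)")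
  case False
  then show ?thesis using minimal_matching_covered_iff[OF mg bp] by (auto simp: extremal_def)
next
  case True
  let ?E = "edge_rel G A B"
  have inj: "inj_on (ends G) (edges G)" and m: "minimal_elementary A B ?E" using True by auto
  have el: "elementary A B ?E" using m by (simp add: minimal_elementary_def)
  note E = elementaryD[OF el]
  have AB: "A \<union> B = verts G" "A \<inter> B = {}" using bp by (auto simp: bipartition_def)
  note und = edge_rel_undirected[OF bp]
  have "inj_on (\<lambda>(a, b). {a, b}) ?E"
  proof (rule inj_onI)
    fix s t assume st: "s \<in> ?E" "t \<in> ?E" "(\<lambda>(a, b). {a, b}) s = (\<lambda>(a, b). {a, b}) t"
    obtain a b x y where ab: "s = (a, b)" "t = (x, y)" by (metis surj_pair)
    then have "a \<in> A" "b \<in> B" "x \<in> A" "y \<in> B" using st E(5) by auto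
    then show "s = t" using st(3) AB(2) ab by (auto simp: doubleton_eq_iff)
  qed
  then have "card (ends G ` edges G) = card ?E" unfolding und[symmetric] undirected_def by (rule card_image)
  then have cE: "card (edges G) = card ?E" using card_image[OF inj] by simp
  have dA: "degree G v = deg ?E v" if "v \<in> A" for v
    using degree_incident[OF inj] card_incident_undirected[OF AB(2) E(5) that] und by simp
  have dB: "degree G v = codeg ?E v" if "v \<in> B" for v
    using degree_incident[OF inj] card_incident_undirected'[OF AB(2) E(5) that] und by simp
  have "degree_two_verts G = deg2 A ?E \<union> deg2 B (?E\<inverse>)"
    unfolding degree_two_verts_def deg2_def AB(1)[symmetric] using dA dB by auto
  moreover have "deg2 A ?E \<inter> deg2 B (?E\<inverse>) = {}" using AB(2) by (auto simp: deg2_def)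
  moreover have "finite (deg2 A ?E)" "finite (deg2 B (?E\<inverse>))" using E(1,2) by (auto simp: deg2_def)
  ultimately have c2: "card (degree_two_verts G) = card (deg2 A ?E) + card (deg2 B (?E\<inverse>))"
    by (simp add: card_Un_disjoint)
  have cV: "card (verts G) = card A + card B" using AB E(1,2) card_Un_disjoint by metis
  have "card ?E + 2 \<le> 2 * card A + card (deg2 A ?E)" using minimal_elementary_bound[OF m] .
  moreover have "card ?E + 2 \<le> 2 * card B + card (deg2 B (?E\<inverse>))"
    using minimal_elementary_bound[OF minimal_elementary_dual[OF m]] by (simp add: card_inverse)
  ultimately have "two_vertex_extremal G \<longleftrightarrow> extremal A B ?E"
    unfolding two_vertex_extremal_def extremal_def c2 cV cE using E(3) m by auto
  then show ?thesis using True minimal_matching_covered_iff[OF mg bp] by blast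
qed

section \<open>Halin trees\<close>

definition path_in :: "('v, 'e) graph \<Rightarrow> 'e set \<Rightarrow> 'v list \<Rightarrow> 'e list \<Rightarrow> bool" where
  "path_in G C vs es \<longleftrightarrow> length vs = Suc (length es) \<and> es \<noteq> [] \<and> distinct vs \<and> set vs \<subseteq> verts G \<and>
     set es \<subseteq> C \<and> (\<forall>i<length es. ends G (es ! i) = {vs ! i, vs ! Suc i})"

text \<open>The first vertex of a longest path in \<open>C\<close> has a further \<open>C\<close>-edge, which closes a cycle.\<close>
lemma ex_cycle:
  assumes mg: "multigraph G" and C: "C \<subseteq> edges G" "C \<noteq> {}"
    and core: "\<And>e v. e \<in> C \<Longrightarrow> v \<in> ends G e \<Longrightarrow> \<exists>e'\<in>C. e' \<noteq> e \<and> v \<in> ends G e'"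
  shows "\<exists>vs es. is_cycle G vs es"
proof -
  have E: "ends G e \<subseteq> verts G" "\<exists>x y. ends G e = {x, y} \<and> x \<noteq> y" if "e \<in> C" for e
    using mg C(1) that unfolding multigraph_def by (auto simp: card_2_iff)
  have finV: "finite (verts G)" using mg by (simp add: multigraph_def)
  let ?P = "\<lambda>n. \<exists>vs es. path_in G C vs es \<and> length es = n"
  obtain e where e: "e \<in> C" using C(2) by blast
  then obtain x y where xy: "ends G e = {x, y}" "x \<noteq> y" using E(2) by blast
  have "path_in G C [x, y] [e]" using e xy E(1)[OF e] by (auto simp: path_in_def)
  then have ex: "?P 1" by (metis length_Cons list.size(3) One_nat_def)
  have bd: "n \<le> card (verts G)" if Pn: "?P n" for n
  proof -
    obtain vs es where p: "path_in G C vs es" "length es = n" using Pn by blast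
    have "card (set vs) \<le> card (verts G)" using p finV by (intro card_mono) (auto simp: path_in_def)
    then show ?thesis using p by (simp add: path_in_def distinct_card)
  qed
  obtain n where n: "?P n" "\<And>k. ?P k \<Longrightarrow> k \<le> n"
    using GreatestI_nat[of ?P 1 "card (verts G)"] Greatest_le_nat[of ?P _ "card (verts G)"] ex bd by blast
  then obtain vs es where p: "path_in G C vs es" "length es = n" by blast
  have P: "length vs = Suc (length es)" "es \<noteq> []" "distinct vs" "set vs \<subseteq> verts G" "set es \<subseteq> C"
    "\<And>i. i < length es \<Longrightarrow> ends G (es ! i) = {vs ! i, vs ! Suc i}"
    using p(1) by (auto simp: path_in_def)
  have e0: "es ! 0 \<in> C" "vs ! 0 \<in> ends G (es ! 0)" using P(2,5) P(6)[of 0] by auto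
  obtain d where d: "d \<in> C" "d \<noteq> es ! 0" "vs ! 0 \<in> ends G d" using core[OF e0] by blast
  obtain u where u: "ends G d = {u, vs ! 0}" "u \<noteq> vs ! 0"
  proof -
    obtain x y where "ends G d = {x, y}" "x \<noteq> y" using E(2)[OF d(1)] by blast
    then show ?thesis using d(3) that by (metis insert_commute insert_iff singletonD)
  qed
  have "u \<in> set vs"
  proof (rule ccontr)
    assume un: "u \<notin> set vs"
    have "ends G ((d # es) ! i) = {(u # vs) ! i, (u # vs) ! Suc i}" if "i < length (d # es)" for i
      using that P(6) u by (cases i) auto
    then have "path_in G C (u # vs) (d # es)"
      unfolding path_in_def using P u un d E(1)[OF d(1)] by auto
    then have "Suc n \<le> n" using n(2)[of "Suc n"] p(2) by (metis length_Cons)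
    then show False by simp
  qed
  then obtain j where j: "j < length vs" "vs ! j = u" by (auto simp: in_set_conv_nth)
  then have j0: "0 < j" "j \<le> length es" using u(2) P(1) by (auto intro: gr0I)
  \<comment> \<open>The initial part of the path up to \<open>u\<close> is closed by
    \<open>d\<close>. For \<open>j = 1\<close> this is the cycle of length two formed by parallel
    edges.\<close>
  let ?vs = "take (Suc j) vs" and ?es = "take j es @ [d]"
  have idx: "i = k" if "es ! i = es ! k" "i < length es" "k < length es" for i k
  proof -
    have "{vs ! i, vs ! Suc i} = {vs ! k, vs ! Suc k}" using P(6) that by metis
    then show ?thesis using that P(1,3) by (auto simp: doubleton_eq_iff nth_eq_iff_index_eq)
  qed
  have "distinct (take j es)" using idx unfolding distinct_conv_nth by auto
  moreover have "d \<notin> set (take j es)"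
  proof
    assume "d \<in> set (take j es)"
    then obtain i where i: "i < j" "es ! i = d" using j0 by (auto simp: in_set_conv_nth)
    then have "vs ! 0 \<in> {vs ! i, vs ! Suc i}" using P(6)[of i] d(3) j0 by auto
    then have "i = 0" using P(1,3) i j0 by (auto simp: nth_eq_iff_index_eq)
    then show False using d(2) i by simp
  qed
  moreover have "ends G (?es ! i) = {?vs ! i, ?vs ! (Suc i mod length ?vs)}" if "i < length ?es" for i
  proof (cases "i = j")
    case True
    then show ?thesis using j j0 P(1) u by (auto simp: nth_append)
  next
    case False
    then show ?thesis using that j0 P(1) P(6)[of i] by (auto simp: nth_append)
  qed
  moreover have "set (take j es) \<subseteq> edges G" "set ?vs \<subseteq> verts G"
    using P(4,5) C(1) set_take_subset by fastforce+
  ultimately have "is_cycle G ?vs ?es"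
    unfolding is_cycle_def using j0 P(1,3) d(1) C(1) by auto
  then show ?thesis by blast
qed

section \<open>Forests of vertex pairs and the generation of Halin trees\<close>

definition forest_core :: "'v set set \<Rightarrow> bool" where
  "forest_core C \<longleftrightarrow> C \<noteq> {} \<and> (\<forall>e\<in>C. \<forall>v\<in>e. \<exists>e'\<in>C. e' \<noteq> e \<and> v \<in> e')"

lemma not_forest_core:
  "\<not> forest_core C \<Longrightarrow> C \<noteq> {} \<Longrightarrow> \<exists>e\<in>C. \<exists>v\<in>e. \<forall>e'\<in>C. v \<in> e' \<longrightarrow> e' = e"
  unfolding forest_core_def by blast

definition cut_connected :: "'v set \<Rightarrow> 'v set set \<Rightarrow> bool" where
  "cut_connected V S \<longleftrightarrow> (\<forall>U\<subseteq>V. U \<noteq> {} \<longrightarrow> U \<noteq> V \<longrightarrow> (\<exists>e\<in>S. e \<inter> U \<noteq> {} \<and> e \<inter> (V - U) \<noteq> {}))"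

text \<open>The edges between non-leaves form a forest again. An edge \<open>e0\<close> pendant in
  it leads to a non-leaf \<open>b\<close> whose other neighbours are all leaves, at least two of
  them by the degree condition; removing these makes \<open>b\<close> a leaf and undoes one growth
  step. If there are no edges between non-leaves, any non-leaf and any edge at it will do.\<close>

lemma halinI:
  assumes "finite V" "2 \<le> card V" "\<And>e. e \<in> S \<Longrightarrow> e \<subseteq> V \<and> card e = 2"
    and "cut_connected V S" "\<And>C. C \<subseteq> S \<Longrightarrow> \<not> forest_core C"
    and "\<And>v. v \<in> V \<Longrightarrow> card (incident S v) \<noteq> 2"
  shows "halin V S"
  using assms
proof (induction "card V" arbitrary: V S rule: less_induct)
  case less
  note fin = less.prems(1) and S = less.prems(3) and nc = less.prems(5) and deg = less.prems(6)
  have cut: "\<exists>e\<in>S. e \<inter> U \<noteq> {} \<and> e \<inter> (V - U) \<noteq> {}" if "U \<subseteq> V" "U \<noteq> {}" "U \<noteq> V" for U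
    using less.prems(4) that by (auto simp: cut_connected_def)
  have "S \<subseteq> Pow V" using S by auto
  then have finS: "finite S" using fin finite_subset by auto
  have ed: "\<exists>y. e = {v, y} \<and> y \<noteq> v \<and> y \<in> V" if ev: "e \<in> S" "v \<in> e" for e v
  proof -
    obtain a b where "e = {a, b}" "a \<noteq> b" using S[OF ev(1)] by (meson card_2_iff)
    then show ?thesis using ev S[OF ev(1)] by auto
  qed
  show ?case
  proof (cases "card V = 2")
    case True
    then obtain x y where xy: "V = {x, y}" "x \<noteq> y" by (meson card_2_iff)
    have "e = V" if "e \<in> S" for e using card_subset_eq[OF fin] S[OF that] True by simp
    moreover have "S \<noteq> {}" using cut[of "{x}"] xy by blast
    ultimately have "S = {{x, y}}" using xy by auto
    then show ?thesis using halin.edge[OF xy(2)] xy(1) by simp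
  next
    case False
    then have V3: "3 \<le> card V" using less.prems(2) by simp
    have ne: "{v} \<noteq> V" "{v, w} \<noteq> V" for v w
    proof -
      have "card {v} < card V" "card {v, w} < card V" using V3 by (auto simp: card_insert_if)
      then show "{v} \<noteq> V" "{v, w} \<noteq> V" by auto
    qed
    have finI: "finite (incident S v)" for v using finS by (simp add: incident_def)
    have inc: "incident S v \<noteq> {}" if "v \<in> V" for v
      using cut[of "{v}"] ne(1) that unfolding incident_def by blast
    have nonleaf: "3 \<le> card (incident S v)" if "v \<in> V" "v \<notin> leaf_set V S" for v
    proof -
      have "card (incident S v) \<noteq> 0" using inc[OF that(1)] finI by simp
      then show ?thesis using deg[OF that(1)] that by (auto simp: leaf_set_def)
    qed
    have leaf1: "e = e'" if "v \<in> leaf_set V S" "e \<in> S" "e' \<in> S" "v \<in> e" "v \<in> e'" for v e e'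
    proof -
      have "card (incident S v) = 1" using that(1) by (simp add: leaf_set_def)
      then obtain s where "incident S v = {s}" by (meson card_1_singletonE)
      moreover have "e \<in> incident S v" "e' \<in> incident S v" using that by (auto simp: incident_def)
      ultimately show ?thesis by simp
    qed
    let ?C = "{e \<in> S. e \<inter> leaf_set V S = {}}"
    have "\<exists>b e0. b \<in> V \<and> b \<notin> leaf_set V S \<and> e0 \<in> incident S b \<and> (\<forall>e\<in>incident S b. e \<noteq> e0 \<longrightarrow> e \<inter> leaf_set V S \<noteq> {})"
    proof (cases "?C = {}")
      case True
      have "\<exists>b\<in>V. b \<notin> leaf_set V S"
      proof (rule ccontr)
        \<comment> \<open>If all vertices were leaves, no edge would leave the two ends of a single
          edge, against connectedness with at least three vertices.\<close>
        assume all: "\<not> ?thesis"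
        obtain v where v: "v \<in> V" using V3 by fastforce
        then obtain e where e: "e \<in> S" "v \<in> e" using inc by (auto simp: incident_def)
        then obtain y where y: "e = {v, y}" "y \<in> V" using ed by blast
        obtain e' where e': "e' \<in> S" "e' \<inter> {v, y} \<noteq> {}" "e' \<inter> (V - {v, y}) \<noteq> {}"
          using cut[of "{v, y}"] v y(2) ne(2) by blast
        then obtain z where "z \<in> e'" "z \<in> {v, y}" by blast
        then have "e' = e" using leaf1[of z e' e] all v y e(1) e'(1) by blast
        then show False using e'(3) y(1) by blast
      qed
      then show ?thesis using inc True unfolding incident_def by blast
    next
      case False
      have "\<not> forest_core ?C" by (rule nc) auto
      from not_forest_core[OF this False]
      obtain e0 b where eb: "e0 \<in> ?C" "b \<in> e0" "\<forall>e'\<in>?C. b \<in> e' \<longrightarrow> e' = e0" by (elim bexE) (rule that)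
      have e0: "e0 \<in> S" "e0 \<inter> leaf_set V S = {}" using eb(1) by blast+
      then have "b \<in> V" "b \<notin> leaf_set V S" "e0 \<in> incident S b"
        using S[OF e0(1)] eb(2) by (auto simp: incident_def)
      moreover have "\<forall>e\<in>incident S b. e \<noteq> e0 \<longrightarrow> e \<inter> leaf_set V S \<noteq> {}"
      proof (intro ballI impI notI)
        fix e assume e: "e \<in> incident S b" "e \<noteq> e0" "e \<inter> leaf_set V S = {}"
        then have "e \<in> ?C" "b \<in> e" by (auto simp: incident_def)
        then show False using bspec[OF eb(3)] e(2) by simp
      qed
      ultimately show ?thesis by (intro exI[of _ b] exI[of _ e0] conjI)
    qed
    then obtain b e0 where b: "b \<in> V" "b \<notin> leaf_set V S" "e0 \<in> incident S b"
      and lf': "\<forall>e\<in>incident S b. e \<noteq> e0 \<longrightarrow> e \<inter> leaf_set V S \<noteq> {}" by (elim exE conjE) (rule that)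
    have lf: "e \<inter> leaf_set V S \<noteq> {}" if "e \<in> incident S b" "e \<noteq> e0" for e
      using bspec[OF lf' that(1)] that(2) by simp
    define L where "L = {l. {b, l} \<in> S \<and> {b, l} \<noteq> e0}"
    have Lleaf: "l \<in> leaf_set V S" if "l \<in> L" for l
    proof -
      have "{b, l} \<in> incident S b" "{b, l} \<noteq> e0" using that by (auto simp: L_def incident_def)
      then show ?thesis using lf[of "{b, l}"] b(2) by blast
    qed
    have LV: "L \<subseteq> V" "b \<notin> L" using Lleaf b(2) by (auto simp: leaf_set_def)
    have finL: "finite L" using LV fin finite_subset by blast
    have img: "incident S b - {e0} = star b L"
    proof
      show "star b L \<subseteq> incident S b - {e0}" unfolding L_def incident_def by auto
      show "incident S b - {e0} \<subseteq> star b L"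
      proof
        fix e assume e: "e \<in> incident S b - {e0}"
        then have "e \<in> S" "b \<in> e" "e \<noteq> e0" by (auto simp: incident_def)
        moreover obtain y where "e = {b, y}" using ed[of e b] calculation by blast
        ultimately show "e \<in> star b L" unfolding L_def by blast
      qed
    qed
    have injL: "inj_on (\<lambda>l. {b, l}) L" by (auto simp: inj_on_def doubleton_eq_iff)
    have "card (incident S b) = Suc (card L)"
      using card.remove[OF finI b(3)] img card_image[OF injL] by simp
    then have cL: "2 \<le> card L" using nonleaf[OF b(1,2)] by simp
    obtain a where a: "e0 = {b, a}" "a \<noteq> b" "a \<in> V" using ed[of e0 b] b(3) by (auto simp: incident_def)
    have aL: "a \<notin> L" using a(1) by (auto simp: L_def)
    let ?V = "V - L" and ?S = "S - star b L"
    have S0: "e \<subseteq> ?V \<and> card e = 2" if e: "e \<in> ?S" for e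
    proof -
      have "l \<notin> e" if l: "l \<in> L" for l
      proof
        assume "l \<in> e"
        then have "e = {b, l}" using leaf1[OF Lleaf[OF l], of e "{b, l}"] e l by (auto simp: L_def)
        then show False using e l by blast
      qed
      then show ?thesis using S[of e] e by blast
    qed
    have cut0: "cut_connected ?V ?S"
      unfolding cut_connected_def
    proof (intro allI impI)
      fix U assume U: "U \<subseteq> ?V" "U \<noteq> {}" "U \<noteq> ?V"
      show "\<exists>e\<in>?S. e \<inter> U \<noteq> {} \<and> e \<inter> (?V - U) \<noteq> {}"
      proof (cases "b \<in> U")
        case True
        \<comment> \<open>The removed leaves join the side of \<open>b\<close>, so the edges to them
          do not cross the cut.\<close>
        have "U \<union> L \<subseteq> V" "U \<union> L \<noteq> {}" "U \<union> L \<noteq> V" using U LV by auto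
        then obtain e where e: "e \<in> S" "e \<inter> (U \<union> L) \<noteq> {}" "e \<inter> (V - (U \<union> L)) \<noteq> {}" using cut by meson
        have "e \<in> ?S" using e(1,3) True by auto
        moreover have "e \<inter> U \<noteq> {}" using e(2) S0[OF calculation] by blast
        ultimately show ?thesis using e(3) by blast
      next
        case False
        have "U \<subseteq> V" "U \<noteq> V" using U b(1) False by auto
        then obtain e where e: "e \<in> S" "e \<inter> U \<noteq> {}" "e \<inter> (V - U) \<noteq> {}" using cut U(2) by meson
        have "e \<in> ?S" using e(1,2) False U(1) by auto
        then show ?thesis using e S0[of e] by blast
      qed
    qed
    have incb: "incident ?S b = {e0}" using img b(3) unfolding incident_def by blast
    have deg0: "card (incident ?S v) \<noteq> 2" if v: "v \<in> ?V" for v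
    proof (cases "v = b")
      case False
      then have "incident ?S v = incident S v" using v unfolding incident_def by auto
      then show ?thesis using deg v by simp
    qed (simp add: incb)
    have "card {a, b} \<le> card ?V" using a aL b(1) LV fin by (intro card_mono) auto
    then have c2: "2 \<le> card ?V" using a(2) by simp
    have "L \<noteq> {}" using cL by auto
    then have "card ?V < card V" using LV fin by (intro psubset_card_mono) auto
    then have h: "halin ?V ?S"
    proof (rule less.hyps)
      show "finite ?V" using fin by simp
      show "\<not> forest_core C" if "C \<subseteq> ?S" for C using that by (intro nc) blast
    qed (fact c2 S0 cut0 deg0)+
    have "b \<in> leaf_set ?V ?S" using incb b(1) LV by (simp add: leaf_set_def)
    from halin.grow[OF h this finL cL]
    have "halin (?V \<union> L) (?S \<union> star b L)" by blast
    moreover have "?V \<union> L = V" "?S \<union> star b L = S" using LV by (auto simp: L_def)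
    ultimately show ?thesis by simp
  qed
qed

lemma halin_cut_connected: "halin V S \<Longrightarrow> cut_connected V S"
proof (induction rule: halin.induct)
  case (edge x y)
  have "U = {x} \<or> U = {y}" if "U \<subseteq> {x, y}" "U \<noteq> {}" "U \<noteq> {x, y}" for U using that by blast
  then show ?case using edge unfolding cut_connected_def by (metis Diff_iff IntI empty_iff insertCI singletonD)
next
  case (grow V S x L)
  have x: "x \<in> V" "\<And>e. e \<in> S \<Longrightarrow> e \<subseteq> V"
    using grow.hyps(2) halin_props[OF grow.hyps(1)] by (auto simp: leaf_set_def)
  show ?case
    unfolding cut_connected_def
  proof (intro allI impI)
    fix U assume U: "U \<subseteq> V \<union> L" "U \<noteq> {}" "U \<noteq> V \<union> L"
    show "\<exists>e\<in>S \<union> star x L. e \<inter> U \<noteq> {} \<and> e \<inter> (V \<union> L - U) \<noteq> {}"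
    proof (cases "\<exists>l\<in>L. (x \<in> U) \<noteq> (l \<in> U)")
      case True
      then obtain l where l: "l \<in> L" "(x \<in> U) \<noteq> (l \<in> U)" by blast
      then have "{x, l} \<inter> U \<noteq> {} \<and> {x, l} \<inter> (V \<union> L - U) \<noteq> {}" using x(1) by auto
      moreover have "{x, l} \<in> S \<union> star x L" using l(1) by simp
      ultimately show ?thesis by (rule bexI)
    next
      case False
      then have "U \<inter> V \<noteq> {}" "U \<inter> V \<noteq> V" using U x(1) by auto
      then obtain e where "e \<in> S" "e \<inter> (U \<inter> V) \<noteq> {}" "e \<inter> (V - U \<inter> V) \<noteq> {}"
        using grow.IH unfolding cut_connected_def by (meson inf_le2)
      then show ?thesis by blast
    qed
  qed
qed

text \<open>A new leaf lies on one edge only, so that edge belongs to no core, and a core would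
  already exist before the growth step.\<close>

lemma halin_no_core: "halin V S \<Longrightarrow> C \<subseteq> S \<Longrightarrow> \<not> forest_core C"
proof (induction arbitrary: C rule: halin.induct)
  case (edge x y)
  then show ?case unfolding forest_core_def by blast
next
  case (grow V S x L)
  have x: "x \<in> V" "\<And>e. e \<in> S \<Longrightarrow> e \<subseteq> V"
    using grow.hyps(2) halin_props[OF grow.hyps(1)] by (auto simp: leaf_set_def)
  show ?case
  proof
    assume core: "forest_core C"
    have "{x, l} \<notin> C" if l: "l \<in> L" for l
    proof
      assume "{x, l} \<in> C"
      then obtain e where e: "e \<in> C" "e \<noteq> {x, l}" "l \<in> e" using core unfolding forest_core_def by blast
      have "l \<notin> V" using l grow.hyps(5) by blast
      then show False using e x grow.prems by blast
    qed
    then have "C \<subseteq> S" using grow.prems by blast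
    then show False using grow.IH core by blast
  qed
qed

lemma halin_card: "halin V S \<Longrightarrow> 2 \<le> card V"
proof (induction rule: halin.induct)
  case (grow V S x L)
  have "finite (V \<union> L)" using halin_props[OF grow.hyps(1)] grow.hyps(3) by simp
  then show ?case using grow.IH card_mono[of "V \<union> L" V] by simp
qed simp

text \<open>Two parallel edges already satisfy the hypotheses of \<open>ex_cycle\<close>, and so do
  the named edges behind a core of pairs. So a tree is simple and its pairs form a forest.\<close>

lemma halin_tree_imp_halin:
  assumes "halin_tree T"
  shows "inj_on (ends T) (edges T)" "halin (verts T) (ends T ` edges T)"
proof -
  have mg: "multigraph T" and con: "connected_graph T" and nc: "\<nexists>vs es. is_cycle T vs es"
    and c2: "2 \<le> card (verts T)" and deg: "\<And>v. v \<in> verts T \<Longrightarrow> degree T v \<noteq> 2"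
    using assms by (auto simp: halin_tree_def tree_def)
  have E: "ends T e \<subseteq> verts T" "card (ends T e) = 2" if "e \<in> edges T" for e
    using mg that by (auto simp: multigraph_def)
  show inj: "inj_on (ends T) (edges T)"
  proof (rule inj_onI, rule ccontr)
    fix e d assume ed: "e \<in> edges T" "d \<in> edges T" "ends T e = ends T d" "e \<noteq> d"
    have "\<exists>vs es. is_cycle T vs es"
      by (rule ex_cycle[OF mg, of "{e, d}"]) (use ed in auto)
    then show False using nc by blast
  qed
  show "halin (verts T) (ends T ` edges T)"
  proof (rule halinI)
    show "finite (verts T)" using mg by (simp add: multigraph_def)
    show "cut_connected (verts T) (ends T ` edges T)"
      using con connected_graph_iff_cut[OF mg] unfolding cut_connected_def by simp
    show "card (incident (ends T ` edges T) v) \<noteq> 2" if "v \<in> verts T" for v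
      using deg[OF that] degree_incident[OF inj] by simp
    show "\<not> forest_core C" if C: "C \<subseteq> ends T ` edges T" for C
    proof
      assume core: "forest_core C"
      let ?C = "{e \<in> edges T. ends T e \<in> C}"
      have "\<exists>vs es. is_cycle T vs es"
      proof (rule ex_cycle[OF mg])
        obtain s where "s \<in> C" using core unfolding forest_core_def by auto
        moreover obtain e where "e \<in> edges T" "s = ends T e" using C calculation by auto
        ultimately show "?C \<noteq> {}" by auto
        fix e v assume e: "e \<in> ?C" "v \<in> ends T e"
        then obtain s where s: "s \<in> C" "s \<noteq> ends T e" "v \<in> s" using core unfolding forest_core_def by blast
        then obtain d where "d \<in> edges T" "s = ends T d" using C by blast
        then show "\<exists>e'\<in>?C. e' \<noteq> e \<and> v \<in> ends T e'" using s by (intro bexI[of _ d]) auto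
      qed auto
      then show False using nc by blast
    qed
  qed (use c2 E in auto)
qed

text \<open>The end sets of the edges of a cycle form a core, since each vertex of the cycle lies on
  the edges before and after it.\<close>

lemma halin_imp_halin_tree:
  assumes h: "halin (verts T) (ends T ` edges T)" and inj: "inj_on (ends T) (edges T)" and fin: "finite (edges T)"
  shows "halin_tree T"
proof -
  note P = halin_props[OF h]
  have mg: "multigraph T" using P fin by (simp add: multigraph_def)
  have "connected_graph T"
    using connected_graph_iff_cut[OF mg] halin_cut_connected[OF h] halin_card[OF h]
    unfolding cut_connected_def by auto
  moreover have "\<not> is_cycle T vs es" for vs es
  proof
    assume cyc: "is_cycle T vs es"
    let ?n = "length es"
    have n: "length vs = ?n" "2 \<le> ?n" "distinct es" "set es \<subseteq> edges T"
      "\<And>i. i < ?n \<Longrightarrow> ends T (es ! i) = {vs ! i, vs ! (Suc i mod ?n)}"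
      using cyc by (auto simp: is_cycle_def)
    let ?C = "ends T ` set es"
    have "\<exists>k<?n. k \<noteq> i \<and> v \<in> ends T (es ! k)" if i: "i < ?n" "v \<in> ends T (es ! i)" for i v
    proof (cases "v = vs ! i")
      case True
      show ?thesis
      proof (cases i)
        \<comment> \<open>The edge before index 0 is the last one, which closes the cycle.\<close>
        case 0
        have "Suc (?n - 1) = ?n" using n(2) by simp
        then have "Suc (?n - 1) mod ?n = 0" by simp
        then have "v \<in> ends T (es ! (?n - 1))" using n(5)[of "?n - 1"] n(2) True 0 by auto
        then show ?thesis using n(2) 0 by (intro exI[of _ "?n - 1"]) auto
      next
        case (Suc k)
        then have "v \<in> ends T (es ! k)" using n(5)[of k] i True by auto
        then show ?thesis using Suc i by (intro exI[of _ k]) auto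
      qed
    next
      case False
      then have v: "v = vs ! (Suc i mod ?n)" using n(5)[OF i(1)] i(2) by auto
      have lt: "Suc i mod ?n < ?n" using i(1) by (intro mod_less_divisor) auto
      have "Suc i mod ?n \<noteq> i" using n(2) i(1) by (cases "Suc i = ?n") auto
      then show ?thesis using n(5)[OF lt] v lt by (intro exI[of _ "Suc i mod ?n"]) auto
    qed
    moreover have "ends T (es ! k) \<noteq> ends T (es ! i)" if "k \<noteq> i" "k < ?n" "i < ?n" for k i
      using that n(3,4) inj by (metis inj_onD nth_eq_iff_index_eq nth_mem subsetD)
    ultimately have "\<exists>e'\<in>?C. e' \<noteq> ends T (es ! i) \<and> v \<in> e'" if "i < ?n" "v \<in> ends T (es ! i)" for i v
      using that by (metis imageI nth_mem)
    moreover have "?C \<noteq> {}" using n(2) by auto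
    ultimately have "forest_core ?C" unfolding forest_core_def by (auto simp: in_set_conv_nth)
    moreover have "?C \<subseteq> ends T ` edges T" using n(4) by auto
    ultimately show False using halin_no_core[OF h] by blast
  qed
  ultimately have "tree T" using mg by (simp add: tree_def)
  then show ?thesis
    using halin_card[OF h] P degree_incident[OF inj] by (simp add: halin_tree_def)
qed

lemma leaves_leaf_set:
  "inj_on (ends T) (edges T) \<Longrightarrow> leaves T = leaf_set (verts T) (ends T ` edges T)"
  by (auto simp: leaves_def leaf_set_def degree_incident)

section \<open>Transfer to graphs with named edges\<close>

lemma leaf_matching_imp_extremal:
  assumes mg: "multigraph G" and T: "halin_tree T" and ilm: "isomorphic_leaf_matching T G"
  shows "minimal_bipartite_matching_covered G \<and> two_vertex_extremal G"
proof -
  let ?S = "ends T ` edges T" and ?V = "verts T"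
  have inj: "inj_on (ends T) (edges T)" and h: "halin ?V ?S" using halin_tree_imp_halin[OF T] by auto
  note P = halin_props[OF h]
  obtain T' f g hh where I: "?V \<inter> verts T' = {}" "edges T \<inter> edges T' = {}" "graph_isomorphism f g T T'"
    "inj_on hh (leaves T)" "hh ` leaves T \<inter> (edges T \<union> edges T') = {}"
    "verts G = ?V \<union> verts T'" "edges G = edges T \<union> edges T' \<union> hh ` leaves T"
    "\<forall>e\<in>edges T. ends G e = ends T e" "\<forall>e\<in>edges T'. ends G e = ends T' e"
    "\<forall>v\<in>leaves T. ends G (hh v) = {v, f v}"
    using ilm unfolding isomorphic_leaf_matching_def by (elim exE conjE) (rule that)
  have f: "inj_on f ?V" "f ` ?V = verts T'" and g: "inj_on g (edges T)" "g ` edges T = edges T'"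
    and fg: "\<And>e. e \<in> edges T \<Longrightarrow> ends T' (g e) = f ` ends T e"
    using I(3) by (auto simp: graph_isomorphism_def bij_betw_def)
  have lV: "leaves T \<subseteq> ?V" by (auto simp: leaves_def)
  have fV: "f v \<notin> ?V" if "v \<in> ?V" for v using f(2) I(1) that by auto
  have eT: "ends G e \<subseteq> ?V \<and> ends G e \<noteq> {}" if "e \<in> edges T" for e
    using P that bspec[OF I(8) that] by (metis card.empty image_eqI zero_neq_numeral)
  have eT': "\<exists>d\<in>edges T. e = g d \<and> ends G e = f ` ends T d" if "e \<in> edges T'" for e
    using that g(2) I(9) fg by force
  have eT'V: "ends G e \<subseteq> f ` ?V \<and> ends G e \<noteq> {}" if e: "e \<in> edges T'" for e
  proof -
    obtain d where d: "d \<in> edges T" "ends G e = f ` ends T d" using eT'[OF e] by blast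
    then show ?thesis using eT[OF d(1)] bspec[OF I(8) d(1)] by auto
  qed
  have disj: "f ` ?V \<inter> ?V = {}" using f(2) I(1) by auto
  have im: "ends G ` edges G = doubled ?V ?S f"
  proof -
    have "ends G ` edges T = ?S" using I(8) by (intro image_cong) auto
    moreover have "ends G ` edges T' = (`) f ` ?S"
    proof -
      have "ends G (g e) = f ` ends T e" if e: "e \<in> edges T" for e
      proof -
        have "g e \<in> edges T'" using g(2) e by auto
        then show ?thesis using bspec[OF I(9)] fg[OF e] by simp
      qed
      then show ?thesis unfolding g(2)[symmetric] image_image by (intro image_cong refl)
    qed
    moreover have "ends G ` hh ` leaves T = (\<lambda>v. {v, f v}) ` leaf_set ?V ?S"
      unfolding image_image leaves_leaf_set[OF inj, symmetric] using I(10) by (intro image_cong) auto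
    ultimately show ?thesis unfolding I(7) doubled_def by (simp add: image_Un)
  qed
  \<comment> \<open>Edges of the tree, of its copy and of the matching have their ends in
    \<open>verts T\<close>, in its image under \<open>f\<close>, or one in each, so no two of the
    three groups share an end set.\<close>
  have injG: "inj_on (ends G) (edges G)"
  proof -
    have 1: "inj_on (ends G) (edges T)" using inj I(8) by (auto simp: inj_on_def)
    have 2: "inj_on (ends G) (edges T')"
    proof (rule inj_onI)
      fix e d assume ed: "e \<in> edges T'" "d \<in> edges T'" "ends G e = ends G d"
      obtain e1 d1 where e1: "e1 \<in> edges T" "e = g e1" "ends G e = f ` ends T e1"
        and d1: "d1 \<in> edges T" "d = g d1" "ends G d = f ` ends T d1" using eT' ed by meson
      have "ends T e1 \<subseteq> ?V" "ends T d1 \<subseteq> ?V" using P e1 d1 by auto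
      then have "ends T e1 = ends T d1" using ed(3) e1 d1 inj_on_image_eq_iff[OF f(1)] by simp
      then show "e = d" using inj e1 d1 by (auto simp: inj_on_def)
    qed
    have 3: "inj_on (ends G) (hh ` leaves T)"
    proof (rule inj_onI)
      fix e d assume ed: "e \<in> hh ` leaves T" "d \<in> hh ` leaves T" "ends G e = ends G d"
      then obtain v w where vw: "v \<in> leaves T" "e = hh v" "w \<in> leaves T" "d = hh w" by blast
      then have "{v, f v} = {w, f w}" using ed(3) I(10) by simp
      then have "v = w" using fV lV vw by (auto simp: doubleton_eq_iff)
      then show "e = d" using vw by simp
    qed
    have 4: "ends G e \<noteq> ends G d" if "e \<in> edges T" "d \<in> edges T'" for e d
      using eT[OF that(1)] eT'V[OF that(2)] disj by blast
    have 5: "ends G e \<noteq> ends G d" if ed: "e \<in> edges T \<union> edges T'" "d \<in> hh ` leaves T" for e d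
    proof -
      obtain v where v: "v \<in> leaves T" "ends G d = {v, f v}" using ed(2) I(10) by blast
      then have "v \<in> ?V" "f v \<notin> ?V" "v \<notin> f ` ?V" using lV fV disj by auto
      then show ?thesis using ed(1) eT[of e] eT'V[of e] v(2) by auto
    qed
    have 6: "inj_on (ends G) (edges T \<union> edges T')"
      using 1 2 4 unfolding inj_on_def by (metis UnE)
    show ?thesis unfolding I(7) using 6 3 5 unfolding inj_on_def by (metis UnE)
  qed
  obtain A B E where AB: "A \<inter> B = {}" "A \<union> B = ?V \<union> f ` ?V" "undirected E = doubled ?V ?S f" "extremal A B E"
    using doubled_imp_extremal[OF h f(1) disj] by blast
  have EAB: "E \<subseteq> A \<times> B"
    using AB(4) elementaryD(5) by (auto simp: extremal_def minimal_elementary_def)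
  have bp: "bipartition G A B"
    unfolding bipartition_def
  proof (intro conjI ballI)
    show "A \<union> B = verts G" using AB(2) I(6) f(2) by simp
    fix e assume "e \<in> edges G"
    then have "ends G e \<in> undirected E" using im AB(3) by auto
    then show "\<exists>a\<in>A. \<exists>b\<in>B. ends G e = {a, b}" using EAB unfolding undirected_def by auto
  qed (rule AB(1))
  have "edge_rel G A B = E"
    using undirected_mem[OF AB(1) EAB] EAB unfolding edge_rel_def im AB(3)[symmetric] by auto
  then have "minimal_matching_covered G \<and> two_vertex_extremal G"
    using extremal_iff[OF mg bp] injG AB(4) by simp
  moreover have "bipartite G" using bp unfolding bipartition_def bipartite_def by blast
  ultimately show ?thesis by (simp add: minimal_bipartite_matching_covered_def)
qed

lemma extremal_imp_leaf_matching:
  fixes G :: "('v, 'e) graph"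
  assumes mg: "multigraph G" and m: "minimal_bipartite_matching_covered G" and x: "two_vertex_extremal G"
  shows "\<exists>T :: ('v, 'e) graph. halin_tree T \<and> isomorphic_leaf_matching T G"
proof -
  obtain A B where bp: "bipartition G A B"
    using m unfolding minimal_bipartite_matching_covered_def bipartite_def bipartition_def by blast
  then have AB: "A \<union> B = verts G" "A \<inter> B = {}" by (auto simp: bipartition_def)
  have inj: "inj_on (ends G) (edges G)" and ex: "extremal A B (edge_rel G A B)"
    using extremal_iff[OF mg bp] m x by (auto simp: minimal_bipartite_matching_covered_def)
  obtain V S f where d: "is_double (A \<union> B) (undirected (edge_rel G A B)) V S f"
    using extremal_imp_doubled[OF ex AB(2)] by blast
  have h: "halin V S" and f: "inj_on f V" "f ` V \<inter> V = {}" and V: "verts G = V \<union> f ` V"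
    and im: "ends G ` edges G = doubled V S f"
    using d AB(1) edge_rel_undirected[OF bp] by (auto simp: is_double_def)
  note P = halin_props[OF h]
  \<comment> \<open>Tree and copy reuse the edge names of \<open>G\<close>, so both live in its
    type; as \<open>ends G\<close> is injective on the edges, \<open>r\<close> recovers the name
    from the end set.\<close>
  define T where "T = \<lparr>verts = V, edges = {e \<in> edges G. ends G e \<in> S}, ends = ends G\<rparr>"
  define T' where "T' = \<lparr>verts = f ` V, edges = {e \<in> edges G. ends G e \<in> (`) f ` S}, ends = ends G\<rparr>"
  have T: "verts T = V" "edges T = {e \<in> edges G. ends G e \<in> S}" "ends T = ends G"
    and T': "verts T' = f ` V" "edges T' = {e \<in> edges G. ends G e \<in> (`) f ` S}" "ends T' = ends G"
    by (auto simp: T_def T'_def)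
  define r where "r s = the_inv_into (edges G) (ends G) s" for s
  have r: "r s \<in> edges G" "ends G (r s) = s" if "s \<in> doubled V S f" for s
    using that im the_inv_into_into[OF inj, of s "edges G"] f_the_inv_into_f[OF inj, of s] unfolding r_def by auto
  have r': "r (ends G e) = e" if "e \<in> edges G" for e
    using the_inv_into_f_f[OF inj that] unfolding r_def .
  have sub: "S \<subseteq> doubled V S f" "(`) f ` S \<subseteq> doubled V S f" "(\<lambda>v. {v, f v}) ` leaf_set V S \<subseteq> doubled V S f"
    unfolding doubled_def by auto
  have imT: "ends T ` edges T = S"
  proof
    show "S \<subseteq> ends T ` edges T"
    proof
      fix s assume s: "s \<in> S"
      then have "r s \<in> edges T" "s = ends T (r s)" using r[of s] sub(1) unfolding T by auto
      then show "s \<in> ends T ` edges T" by (rule rev_image_eqI)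
    qed
  qed (auto simp: T)
  have injT: "inj_on (ends T) (edges T)" unfolding T using inj by (rule inj_on_subset) auto
  have tree: "halin_tree T"
  proof (rule halin_imp_halin_tree[OF _ injT])
    show "halin (verts T) (ends T ` edges T)" using h imT T(1) by simp
    show "finite (edges T)" using mg unfolding T multigraph_def by simp
  qed
  have lv: "leaves T = leaf_set V S" using leaves_leaf_set[OF injT] imT T(1) by simp
  have lV: "leaf_set V S \<subseteq> V" by (auto simp: leaf_set_def)
  have SV: "s \<subseteq> V \<and> s \<noteq> {}" if "s \<in> S" for s using P that by (metis card.empty zero_neq_numeral)
  have fS: "s \<subseteq> f ` V \<and> s \<noteq> {}" if "s \<in> (`) f ` S" for s using that SV by blast
  have disj: "S \<inter> (`) f ` S = {}"
  proof (rule ccontr)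
    assume "\<not> ?thesis"
    then obtain s where "s \<in> S" "s \<in> (`) f ` S" by blast
    then show False using SV[of s] fS[of s] f(2) by blast
  qed
  have cross: "{v, f v} \<notin> S \<union> (`) f ` S" if "v \<in> leaf_set V S" for v
  proof
    assume "{v, f v} \<in> S \<union> (`) f ` S"
    then have "{v, f v} \<subseteq> V \<or> {v, f v} \<subseteq> f ` V" using SV fS by blast
    then show False using that lV f(2) by blast
  qed
  let ?g = "\<lambda>e. r (f ` ends G e)" and ?h = "\<lambda>v. r {v, f v}"
  have rh: "?h v \<in> edges G" "ends G (?h v) = {v, f v}" if "v \<in> leaf_set V S" for v
    using r[of "{v, f v}"] sub(3) that by auto
  have rg: "?g e \<in> edges G" "ends G (?g e) = f ` ends G e" if "e \<in> edges T" for e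
    using r[of "f ` ends G e"] sub(2) that unfolding T by auto
  have iso: "graph_isomorphism f ?g T T'"
    unfolding graph_isomorphism_def
  proof (intro conjI ballI)
    show "bij_betw f (verts T) (verts T')" using f(1) unfolding T T' by (simp add: bij_betw_def)
    show "ends T' (?g e) = f ` ends T e" if "e \<in> edges T" for e using rg[OF that] unfolding T T' by simp
    have "inj_on ?g (edges T)"
    proof (rule inj_onI)
      fix e e' assume e: "e \<in> edges T" "e' \<in> edges T" "?g e = ?g e'"
      then have "f ` ends G e = f ` ends G e'" using rg by metis
      moreover have "ends G e \<subseteq> V" "ends G e' \<subseteq> V" using e(1,2) SV unfolding T by auto
      ultimately have "ends G e = ends G e'" using inj_on_image_eq_iff[OF f(1)] by simp
      then show "e = e'" using injT e(1,2) T(3) by (metis inj_onD)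
    qed
    moreover have "?g ` edges T = edges T'"
    proof
      show "?g ` edges T \<subseteq> edges T'" using rg unfolding T T' by force
      show "edges T' \<subseteq> ?g ` edges T"
      proof
        fix e assume e: "e \<in> edges T'"
        then obtain s where s: "s \<in> S" "ends G e = f ` s" "e \<in> edges G" unfolding T' by auto
        then obtain d where "d \<in> edges T" "ends G d = s" using imT T(3) by force
        then have "?g d = e" using s(2) r'[OF s(3)] by metis
        then show "e \<in> ?g ` edges T" using \<open>d \<in> edges T\<close> by blast
      qed
    qed
    ultimately show "bij_betw ?g (edges T) (edges T')" by (simp add: bij_betw_def)
  qed
  have "isomorphic_leaf_matching T G"
    unfolding isomorphic_leaf_matching_def lv
  proof (intro exI conjI ballI)
    show "verts T \<inter> verts T' = {}" using f(2) unfolding T T' by auto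
    show "edges T \<inter> edges T' = {}" using disj unfolding T T' by auto
    show "graph_isomorphism f ?g T T'" by (rule iso)
    show "inj_on ?h (leaf_set V S)"
    proof (rule inj_onI)
      fix v w assume vw: "v \<in> leaf_set V S" "w \<in> leaf_set V S" "?h v = ?h w"
      have "{v, f v} = {w, f w}" using rh(2)[OF vw(1)] rh(2)[OF vw(2)] vw(3) by metis
      moreover have "v \<noteq> f w" using vw lV f(2) by blast
      ultimately show "v = w" by (auto simp: doubleton_eq_iff)
    qed
    have "?h v \<notin> edges T \<union> edges T'" if v: "v \<in> leaf_set V S" for v
    proof
      assume "?h v \<in> edges T \<union> edges T'"
      then have "ends G (?h v) \<in> S \<union> (`) f ` S" unfolding T T' by blast
      then show False using rh(2)[OF v] cross[OF v] by metis
    qed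
    then show "?h ` leaf_set V S \<inter> (edges T \<union> edges T') = {}" by blast
    show "verts G = verts T \<union> verts T'" using V unfolding T T' by simp
    show "edges G = edges T \<union> edges T' \<union> ?h ` leaf_set V S"
    proof
      show "edges T \<union> edges T' \<union> ?h ` leaf_set V S \<subseteq> edges G" using rh(1) unfolding T T' by auto
      show "edges G \<subseteq> edges T \<union> edges T' \<union> ?h ` leaf_set V S"
      proof
        fix e assume e: "e \<in> edges G"
        then have "ends G e \<in> doubled V S f" using im by blast
        then consider "ends G e \<in> S" | "ends G e \<in> (`) f ` S" | v where "v \<in> leaf_set V S" "ends G e = {v, f v}"
          unfolding doubled_def by blast
        then show "e \<in> edges T \<union> edges T' \<union> ?h ` leaf_set V S"
        proof cases
          case 3
          then have "e = ?h v" using r'[OF e] by simp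
          then show ?thesis using 3 by blast
        qed (use e in \<open>auto simp: T T'\<close>)
      qed
    qed
  qed (use rh(2) T(3) T'(3) in auto)
  then show ?thesis using tree by blast
qed

theorem theorem1p3:
  fixes G :: "('v, 'e) graph"
  assumes "multigraph G"
  shows "(minimal_bipartite_matching_covered G \<and> two_vertex_extremal G) \<longleftrightarrow>
         (\<exists>T :: ('v, 'e) graph. halin_tree T \<and> isomorphic_leaf_matching T G)"
  using extremal_imp_leaf_matching[OF assms] leaf_matching_imp_extremal[OF assms] by blast

end
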